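(* Let $\mu,\nu\in\mathcal{P}_2(\mathbb{R}^d)$ with $[\mu]=[\nu]$ and set $$\mathcal{V}(\mu,\nu)=\inf\{\mathrm{var}(\rho):\rho\in\mathcal{P}_2(\mathbb{R}^d),\ \rho\succeq_c\mu,\ \rho\succeq_c\nu\}.$$ (i) With $f=\nu-\mu$, $$\mathcal{I}(f)=\mathcal{V}(\mu,\nu)-\frac{\mathrm{var}(\mu)+\mathrm{var}(\nu)}{2}=\mathcal{J}(\mu,\nu).$$ Moreover, $\pi\in\Sigma(\mu,\nu)$ is a minimizer of $\mathcal{J}(\mu,\nu)$ if and only if its third marginal is a minimizer of $\mathcal{V}(\mu,\nu)$. (ii) The infimum $\mathcal{V}(\mu,\nu)$ is attained, and for every minimizer $\rho$ there exists at least one minimizer $\pi$ of $\mathcal{J}(\mu,\nu)$ whose marginals are $\mu,\nu,\rho$ respectively.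
   Context: $\mathrm{var}(\rho)=\int|x-[\rho]|^2\rho(dx)$, $[\rho]=\int x\,\rho(dx)$. Convex order: $\rho\succeq_c\mu$ means $\int\varphi\,d\rho\ge\int\varphi\,d\mu$ for every convex $\varphi:\mathbb{R}^d\to\mathbb{R}$. $\mathcal{I}(f)=\sup\{\int u\,d\nu-\int u\,d\mu:u\in C^{1,1}(\mathbb{R}^d),\ \mathrm{lip}(\nabla u)\le1\}$. $\mathcal{J}(\mu,\nu)=\inf\{\iiint c\,d\pi:\pi\in\Sigma(\mu,\nu)\}$ with $c(x,y,z)=\tfrac12(|z-x|^2+|z-y|^2)$, where $\Sigma(\mu,\nu)$ is the set of $\pi\in\mathcal{P}_2((\mathbb{R}^d)^3)$ with first marginal $\mu$, second marginal $\nu$, and $\iiint\langle z-x,\Phi(x)\rangle\,d\pi=\iiint\langle z-y,\Psi(y)\rangle\,d\pi=0$ for all smooth compactly supported $\Phi,\Psi:\mathbb{R}^d\to\mathbb{R}^d$. *)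

theory Defs
  imports "HOL-Probability.Probability"
begin

definition P2 :: "'a::euclidean_space measure set" where
  "P2 = {M. prob_space M \<and> sets M = sets borel \<and> integrable M (\<lambda>x. (norm x)\<^sup>2)}"

definition bary :: "'a::euclidean_space measure \<Rightarrow> 'a" where
  "bary M = (\<integral>x. x \<partial>M)"

definition var :: "'a::euclidean_space measure \<Rightarrow> real" where
  "var M = (\<integral>x. (norm (x - bary M))\<^sup>2 \<partial>M)"

text \<open>Extended-real integral (positive part minus negative part); used for
  integrals of convex functions, which take values in (-infinity, +infinity].\<close>
definition eint :: "'a measure \<Rightarrow> ('a \<Rightarrow> real) \<Rightarrow> ereal" where
  "eint M f = enn2ereal (\<integral>\<^sup>+x. ennreal (f x) \<partial>M) - enn2ereal (\<integral>\<^sup>+x. ennreal (- f x) \<partial>M)"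

definition convex_dom :: "'a::euclidean_space measure \<Rightarrow> 'a measure \<Rightarrow> bool" where
  "convex_dom \<rho> \<mu> \<longleftrightarrow> (\<forall>\<phi>::'a \<Rightarrow> real. convex_on UNIV \<phi> \<longrightarrow> eint \<mu> \<phi> \<le> eint \<rho> \<phi>)"

inductive_set iter_derivs :: "('a::real_normed_vector \<Rightarrow> 'b::real_normed_vector) \<Rightarrow> ('a \<Rightarrow> 'b) set"
  for f where
  base: "f \<in> iter_derivs f"
| step: "g \<in> iter_derivs f \<Longrightarrow> (\<forall>x. g differentiable (at x))
           \<Longrightarrow> (\<lambda>x. frechet_derivative g (at x) v) \<in> iter_derivs f"

definition smooth :: "('a::real_normed_vector \<Rightarrow> 'b::real_normed_vector) \<Rightarrow> bool" where
  "smooth f \<longleftrightarrow> (\<forall>g \<in> iter_derivs f. \<forall>x. g differentiable (at x))"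

definition compact_support :: "('a::real_normed_vector \<Rightarrow> 'b::real_normed_vector) \<Rightarrow> bool" where
  "compact_support f \<longleftrightarrow> compact (closure {x. f x \<noteq> 0})"

definition test_field :: "('a::euclidean_space \<Rightarrow> 'a) \<Rightarrow> bool" where
  "test_field \<Phi> \<longleftrightarrow> smooth \<Phi> \<and> compact_support \<Phi>"

definition C11_1 :: "('a::euclidean_space \<Rightarrow> real) \<Rightarrow> bool" where
  "C11_1 u \<longleftrightarrow> (\<exists>g. (\<forall>x. (u has_derivative (\<lambda>h. g x \<bullet> h)) (at x))
                   \<and> (\<forall>x y. norm (g x - g y) \<le> norm (x - y)))"

definition Ifun :: "'a::euclidean_space measure \<Rightarrow> 'a measure \<Rightarrow> ereal" where
  "Ifun \<mu> \<nu> = (SUP u \<in> {u. C11_1 u}. ereal ((\<integral>x. u x \<partial>\<nu>) - (\<integral>x. u x \<partial>\<mu>)))"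

definition Vfun :: "'a::euclidean_space measure \<Rightarrow> 'a measure \<Rightarrow> ereal" where
  "Vfun \<mu> \<nu> = (INF \<rho> \<in> {\<rho>. \<rho> \<in> P2 \<and> convex_dom \<rho> \<mu> \<and> convex_dom \<rho> \<nu>}. ereal (var \<rho>))"

definition Vmin :: "'a::euclidean_space measure \<Rightarrow> 'a measure \<Rightarrow> 'a measure \<Rightarrow> bool" where
  "Vmin \<mu> \<nu> \<rho> \<longleftrightarrow> \<rho> \<in> P2 \<and> convex_dom \<rho> \<mu> \<and> convex_dom \<rho> \<nu> \<and> ereal (var \<rho>) = Vfun \<mu> \<nu>"

definition cost :: "'a::euclidean_space \<times> 'a \<times> 'a \<Rightarrow> real" where
  "cost = (\<lambda>(x,y,z). ((norm (z - x))\<^sup>2 + (norm (z - y))\<^sup>2) / 2)"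

definition marg1 :: "('a::euclidean_space \<times> 'a \<times> 'a) measure \<Rightarrow> 'a measure" where
  "marg1 \<pi> = distr \<pi> borel (\<lambda>(x,y,z). x)"
definition marg2 :: "('a::euclidean_space \<times> 'a \<times> 'a) measure \<Rightarrow> 'a measure" where
  "marg2 \<pi> = distr \<pi> borel (\<lambda>(x,y,z). y)"
definition marg3 :: "('a::euclidean_space \<times> 'a \<times> 'a) measure \<Rightarrow> 'a measure" where
  "marg3 \<pi> = distr \<pi> borel (\<lambda>(x,y,z). z)"

definition Sigma_set :: "'a::euclidean_space measure \<Rightarrow> 'a measure \<Rightarrow> ('a \<times> 'a \<times> 'a) measure set" where
  "Sigma_set \<mu> \<nu> = {\<pi>. \<pi> \<in> P2 \<and> marg1 \<pi> = \<mu> \<and> marg2 \<pi> = \<nu> \<and>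
     (\<forall>\<Phi>. test_field \<Phi> \<longrightarrow> (\<integral>(x,y,z). (z - x) \<bullet> \<Phi> x \<partial>\<pi>) = 0) \<and>
     (\<forall>\<Psi>. test_field \<Psi> \<longrightarrow> (\<integral>(x,y,z). (z - y) \<bullet> \<Psi> y \<partial>\<pi>) = 0)}"

definition Jfun :: "'a::euclidean_space measure \<Rightarrow> 'a measure \<Rightarrow> ereal" where
  "Jfun \<mu> \<nu> = (INF \<pi> \<in> Sigma_set \<mu> \<nu>. ereal (\<integral>p. cost p \<partial>\<pi>))"

definition Jmin :: "'a::euclidean_space measure \<Rightarrow> 'a measure \<Rightarrow> ('a \<times> 'a \<times> 'a) measure \<Rightarrow> bool" where
  "Jmin \<mu> \<nu> \<pi> \<longleftrightarrow> \<pi> \<in> Sigma_set \<mu> \<nu> \<and> ereal (\<integral>p. cost p \<partial>\<pi>) = Jfun \<mu> \<nu>"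

end

theory Submission
  imports Defs
begin

text \<open>
  Weak duality comes from the convexity of \<open>\<bar>x\<bar>\<^sup>2/2 \<plusminus> u\<close> for \<open>u\<close> with 1-Lipschitz gradient. Conversely, if
  \<open>A\<close>, \<open>B\<close> are convex with \<open>A + B \<le> \<bar>z\<bar>\<^sup>2 - m\<close>, the largest convex minorant \<open>\<psi>\<close> of \<open>\<bar>z\<bar>\<^sup>2 - m - A\<close> is such that
  \<open>\<bar>z\<bar>\<^sup>2 - \<psi>\<close> is convex too, so \<open>u = \<psi> - \<bar>z\<bar>\<^sup>2/2\<close> has a 1-Lipschitz gradient and separates the two functions.

  An optimal \<open>\<pi>\<close> is a probability measure with finite second moment subject to countably many linear constraints
  (marginals and martingale conditions, tested on smooth bumps). Minimizing the second moment plus a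
  quadratic penalty for finitely many constraints, the first-order condition tested against point masses is a pointwise
  inequality \<open>m \<le> \<bar>x\<bar>\<^sup>2 + \<bar>y\<bar>\<^sup>2 + \<bar>z\<bar>\<^sup>2 + \<phi>(x) + \<psi>(y) + (z - x)\<cdot>\<Phi>(x) + (z - y)\<cdot>\<Psi>(y) + \<kappa>(z)\<close>;
  taking suprema over \<open>x\<close> and \<open>y\<close> turns it into a pair of convex functions, hence into a bound by the dual value. Letting the
  penalty grow gives \<open>\<pi>\<close>. With the third marginal free (\<open>\<kappa> = 0\<close>) this is strong duality and attainment; with the third
  marginal prescribed it is Strassen's theorem, simultaneously for \<open>\<mu>\<close> and \<open>\<nu>\<close>. Weak compactness is reduced
  to Helly's theorem on the line by a space-filling curve with a measurable section.
\<close>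

section \<open>Convex functions and functions with Lipschitz gradient\<close>

text \<open>No minimax theorem is invoked. The multipliers are the residuals of a penalized
  minimizer, scaled by twice the penalty weight, so the dual bound is needed for finite combinations
  only. The objective is the full second moment in (x, y, z) although only the part in z matters:
  this gives compactness, and the parts in x and y become constants once the marginals are right. An
  asymmetry shapes the limit passages: functions of linear growth, such as (z - x).Phi(x) with
  bounded Phi, have convergent integrals under bounded second moments, whereas the second moment
  itself is only lower semicontinuous. So the constraints survive as equalities and the bound on the
  second moment as an inequality, which weak duality later turns into an equality. Equal barycentres
  make the dual value finite: the affine part of u cancels between the two measures, and the rest is
  controlled by second moments.\<close>

lemma convex_subgradient:
  fixes f :: "'a::euclidean_space \<Rightarrow> real"
  assumes "convex_on UNIV f"
  obtains p where "\<And>y. f y \<ge> f x + p \<bullet> (y - x)"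
proof -
  define S where "S = {(x, f x)}"
  define T where "T = {(y, t). f y < t}"
  have cT: "convex T"
  proof (rule convexI)
    fix a b :: "'a \<times> real" and u v :: real
    assume a: "a \<in> T" and b: "b \<in> T" and uv: "0 \<le> u" "0 \<le> v" "u + v = 1"
    have "f (u *\<^sub>R fst a + v *\<^sub>R fst b) \<le> u * f (fst a) + v * f (fst b)"
      using assms uv by (auto simp: convex_on_def)
    also have "\<dots> < u * snd a + v * snd b"
    proof (cases "u = 0")
      case True
      then show ?thesis using a b uv by (auto simp: T_def)
    next
      case False
      then have "u * f (fst a) < u * snd a" using a uv by (auto simp: T_def)
      moreover have "v * f (fst b) \<le> v * snd b" using b uv by (auto simp: T_def intro!: mult_left_mono)
      ultimately show ?thesis by linarith
    qed
    finally show "u *\<^sub>R a + v *\<^sub>R b \<in> T" by (simp add: T_def case_prod_beta)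
  qed
  have "T \<noteq> {}" by (auto simp: T_def intro!: exI[of _ "x"] exI[of _ "f x + 1"])
  moreover have "S \<inter> T = {}" by (auto simp: S_def T_def)
  ultimately obtain a b where ab: "a \<noteq> 0" "\<forall>s\<in>S. inner a s \<le> b" "\<forall>t\<in>T. inner a t \<ge> b"
    using separating_hyperplane_sets[of S T] cT by (auto simp: S_def)
  obtain q r where a: "a = (q, r)" by force
  have 1: "q \<bullet> x + r * f x \<le> b" using ab(2) by (simp add: S_def a)
  have 2: "q \<bullet> y + r * t \<ge> b" if "f y < t" for y t using ab(3) that by (auto simp: T_def a)
  have "r \<ge> 0" using 1 2[of x "f x + 1"] by (auto simp: algebra_simps)
  \<comment> \<open>A vertical hyperplane is excluded because the epigraph lies over the whole
    space: a point above \<open>x - q\<close> would violate the separation.\<close>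
  moreover have "r \<noteq> 0"
  proof
    assume r: "r = 0"
    then have "q \<noteq> 0" using ab(1) a by (auto simp: zero_prod_def)
    moreover have "q \<bullet> (x - q) \<ge> q \<bullet> x" using 1 2[of "x - q" "f (x - q) + 1"] r by simp
    ultimately have "q \<noteq> 0" "q \<bullet> q \<le> 0" by (simp_all add: inner_diff_right)
    then show False using inner_gt_zero_iff[of q] by linarith
  qed
  ultimately have r: "r > 0" by simp
  show ?thesis
  proof
    fix y
    show "f y \<ge> f x + (- (1/r) *\<^sub>R q) \<bullet> (y - x)"
    proof (rule field_le_epsilon)
      fix e :: real assume "e > 0"
      then have "q \<bullet> x + r * f x \<le> q \<bullet> y + r * (f y + e)" using 1 2[of y "f y + e"] by simp
      then show "f x + (- (1/r) *\<^sub>R q) \<bullet> (y - x) \<le> f y + e"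
        using r by (simp add: field_simps inner_diff_right)
    qed
  qed
qed

lemma convex_on_UNIV_continuous:
  fixes f :: "'a::euclidean_space \<Rightarrow> real"
  assumes "convex_on UNIV f"
  shows "continuous_on UNIV f"
  using convex_on_continuous[OF open_UNIV assms] .

lemma convex_on_UNIV_measurable:
  fixes f :: "'a::euclidean_space \<Rightarrow> real"
  assumes "convex_on UNIV f"
  shows "f \<in> borel_measurable borel"
  using borel_measurable_continuous_onI[OF convex_on_UNIV_continuous[OF assms]] .

lemma convex_on_UNIV_I:
  fixes f :: "'a::real_vector \<Rightarrow> real"
  assumes "\<And>t x y. 0 < t \<Longrightarrow> t < 1 \<Longrightarrow> f ((1 - t) *\<^sub>R x + t *\<^sub>R y) \<le> (1 - t) * f x + t * f y"
  shows "convex_on UNIV f"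
  using assms by (intro convex_onI) auto

lemma convex_on_UNIV_cSUP:
  fixes f :: "'i \<Rightarrow> 'a::real_vector \<Rightarrow> real"
  assumes "I \<noteq> {}" and cv: "\<And>i. i \<in> I \<Longrightarrow> convex_on UNIV (f i)"
    and bd: "\<And>x. bdd_above ((\<lambda>i. f i x) ` I)"
  shows "convex_on UNIV (\<lambda>x. SUP i\<in>I. f i x)"
proof (rule convex_on_UNIV_I)
  fix t :: real and x y assume t: "0 < t" "t < 1"
  show "(SUP i\<in>I. f i ((1 - t) *\<^sub>R x + t *\<^sub>R y)) \<le> (1 - t) * (SUP i\<in>I. f i x) + t * (SUP i\<in>I. f i y)"
  proof (rule cSUP_least[OF \<open>I \<noteq> {}\<close>])
    fix i assume i: "i \<in> I"
    have "f i ((1 - t) *\<^sub>R x + t *\<^sub>R y) \<le> (1 - t) * f i x + t * f i y"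
      using convex_onD[OF cv[OF i], of t x y] t by simp
    also have "\<dots> \<le> (1 - t) * (SUP i\<in>I. f i x) + t * (SUP i\<in>I. f i y)"
      using t by (intro add_mono mult_left_mono cSUP_upper[OF i bd]) auto
    finally show "f i ((1 - t) *\<^sub>R x + t *\<^sub>R y) \<le> (1 - t) * (SUP i\<in>I. f i x) + t * (SUP i\<in>I. f i y)" .
  qed
qed

lemma convex_on_UNIV_affine: "convex_on UNIV (\<lambda>x. c + p \<bullet> (x - a))"
  by (rule convex_on_UNIV_I) (simp add: algebra_simps inner_diff_right inner_add_right)

text \<open>Subgradients near \<open>z\<close> need no bound. The subgradient inequality at
  \<open>q\<close>, read at the reflected point \<open>2 *\<^sub>R q - z\<close>, shows that the
  supporting plane at \<open>q\<close> has at \<open>z\<close> a value of at least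
  \<open>2 * f q - f (2 *\<^sub>R q - z)\<close>, and this tends to \<open>f z\<close> by continuity
  alone.\<close>

lemma convex_SUP_affine_dense:
  fixes f :: "'a::euclidean_space \<Rightarrow> real"
  assumes f: "convex_on UNIV f" and p: "\<And>x y. f y \<ge> f x + p x \<bullet> (y - x)"
    and D: "\<And>x e. e > 0 \<Longrightarrow> \<exists>q\<in>D. dist q x < e" and "e > 0"
  shows "\<exists>q\<in>D. f z - e < f q + p q \<bullet> (z - q)"
proof -
  have "isCont f z" for z using convex_on_UNIV_continuous[OF f] by (simp add: continuous_on_eq_continuous_at)
  then have "isCont (\<lambda>q. 2 * f q - f (2 *\<^sub>R q - z)) z"
    by (intro continuous_intros) (auto intro!: continuous_intros isCont_o2[where g=f and f="\<lambda>q. 2 *\<^sub>R q - z"])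
  then obtain d where d: "d > 0" "\<And>q. dist q z < d \<Longrightarrow> dist (2 * f q - f (2 *\<^sub>R q - z)) (2 * f z - f (2 *\<^sub>R z - z)) < e"
    using \<open>e > 0\<close> unfolding continuous_at_eps_delta by blast
  obtain q where q: "q \<in> D" "dist q z < d" using D[OF d(1)] by blast
  have "f (2 *\<^sub>R q - z) \<ge> f q + p q \<bullet> (2 *\<^sub>R q - z - q)" by (rule p)
  also have "2 *\<^sub>R q - z - q = - (z - q)" by (simp add: scaleR_2)
  finally have "f q + p q \<bullet> (z - q) \<ge> 2 * f q - f (2 *\<^sub>R q - z)" by (simp add: inner_diff_right)
  then show ?thesis using d(2)[OF q(2)] q(1) by (intro bexI[of _ q]) (auto simp: dist_real_def scaleR_2)
qed

text \<open>The two convex functions add up to |x|^2, so their subgradients \<open>p\<close> and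
  \<open>q\<close> at \<open>x\<close> must add up to its gradient 2x. The two subgradient
  inequalities then bound \<open>u\<close> from both sides with the same slope
  \<open>p - x\<close>.\<close>

lemma two_sided_quadratic_bound:
  fixes u :: "'a::euclidean_space \<Rightarrow> real"
  assumes c1: "convex_on UNIV (\<lambda>x. (norm x)\<^sup>2 / 2 + u x)" and c2: "convex_on UNIV (\<lambda>x. (norm x)\<^sup>2 / 2 - u x)"
  shows "\<exists>g. \<forall>y. \<bar>u y - u x - g \<bullet> (y - x)\<bar> \<le> (norm (y - x))\<^sup>2 / 2"
proof -
  obtain p where p: "\<And>y. (norm y)\<^sup>2 / 2 + u y \<ge> (norm x)\<^sup>2 / 2 + u x + p \<bullet> (y - x)"
    using convex_subgradient[OF c1, of x] by blast
  obtain q where q: "\<And>y. (norm y)\<^sup>2 / 2 - u y \<ge> (norm x)\<^sup>2 / 2 - u x + q \<bullet> (y - x)"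
    using convex_subgradient[OF c2, of x] by blast
  have pq: "(p + q) \<bullet> h - 2 * (x \<bullet> h) \<le> (norm h)\<^sup>2" for h
    using p[of "x + h"] q[of "x + h"] by (simp add: power2_norm_eq_inner algebra_simps inner_commute add_divide_distrib)
  have "p + q - 2 *\<^sub>R x = 0"
  proof (rule ccontr)
    define w where "w = p + q - 2 *\<^sub>R x"
    assume "p + q - 2 *\<^sub>R x \<noteq> 0"
    then have "w \<bullet> w > 0" by (simp add: w_def)
    moreover have "w \<bullet> ((1/2) *\<^sub>R w) \<le> (norm ((1/2) *\<^sub>R w))\<^sup>2" using pq[of "(1/2) *\<^sub>R w"]
      by (simp add: w_def inner_diff_left)
    ultimately show False unfolding power2_norm_eq_inner by simp
  qed
  then have q': "q = 2 *\<^sub>R x - p" by (simp add: algebra_simps)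
  have "\<bar>u y - u x - (p - x) \<bullet> (y - x)\<bar> \<le> (norm (y - x))\<^sup>2 / 2" for y
  proof (rule abs_leI)
    show "u y - u x - (p - x) \<bullet> (y - x) \<le> (norm (y - x))\<^sup>2 / 2"
      using q[of y] unfolding q' power2_norm_eq_inner by (simp add: algebra_simps inner_commute)
    show "- (u y - u x - (p - x) \<bullet> (y - x)) \<le> (norm (y - x))\<^sup>2 / 2"
      using p[of y] unfolding power2_norm_eq_inner by (simp add: algebra_simps inner_commute)
  qed
  then show ?thesis by blast
qed

text \<open>Differentiability follows from the two-sided quadratic bound. To reach the Lipschitz
  constant 1 exactly, the bounds based at \<open>x\<close> and at \<open>y\<close> are compared at
  two points symmetric about the midpoint \<open>m\<close>, where the quadratic errors add up by the
  parallelogram law.\<close>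

lemma C11_1_if_convex:
  fixes u :: "'a::euclidean_space \<Rightarrow> real"
  assumes c1: "convex_on UNIV (\<lambda>x. (norm x)\<^sup>2 / 2 + u x)" and c2: "convex_on UNIV (\<lambda>x. (norm x)\<^sup>2 / 2 - u x)"
  shows "C11_1 u"
proof -
  obtain g where g: "\<And>x y. \<bar>u y - u x - g x \<bullet> (y - x)\<bar> \<le> (norm (y - x))\<^sup>2 / 2"
    using two_sided_quadratic_bound[OF assms] by metis
  have "(u has_derivative (\<lambda>h. g x \<bullet> h)) (at x)" for x
  proof (rule has_derivativeI)
    show "bounded_linear ((\<bullet>) (g x))" by (rule bounded_linear_inner_right)
    have "((\<lambda>y. norm (y - x) / 2) \<longlongrightarrow> norm (x - x) / 2) (at x)" by (intro tendsto_intros) auto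
    then have lim: "((\<lambda>y. norm (y - x) / 2) \<longlongrightarrow> 0) (at x)" by simp
    show "((\<lambda>y. (u y - u x - g x \<bullet> (y - x)) /\<^sub>R norm (y - x)) \<longlongrightarrow> 0) (at x)"
    proof (rule tendsto_0_le[OF lim, where K=1], rule always_eventually, rule allI)
      fix y
      show "norm ((u y - u x - g x \<bullet> (y - x)) /\<^sub>R norm (y - x)) \<le> norm (norm (y - x) / 2) * 1"
      proof (cases "y = x")
        case False
        then show ?thesis using g[of y x] by (simp add: divide_simps power2_eq_square)
      qed simp
    qed
  qed
  moreover have "norm (g x - g y) \<le> norm (x - y)" for x y
  proof (cases "g x = g y \<or> x = y")
    case False
    define w where "w = g y - g x"
    define m where "m = (1/2) *\<^sub>R (x + y)"
    \<comment> \<open>For \<open>k\<close> a positive multiple of \<open>w\<close> the four bounds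
      give |w| <= |k| + |x - y|^2 / (4 |k|); the right-hand side is least for |k| = |x - y| /
      2.\<close>
    define k where "k = (norm (x - y) / (2 * norm w)) *\<^sub>R w"
    have w: "norm w > 0" using False unfolding w_def by (metis right_minus_eq zero_less_norm_iff)
    have a1: "u (m+k) \<le> u x + g x \<bullet> (m+k - x) + (norm (m+k - x))\<^sup>2/2" using g[of "m+k" x] by linarith
    have a2: "u (m+k) \<ge> u y + g y \<bullet> (m+k - y) - (norm (m+k - y))\<^sup>2/2" using g[of "m+k" y] by linarith
    have a3: "u (m-k) \<le> u y + g y \<bullet> (m-k - y) + (norm (m-k - y))\<^sup>2/2" using g[of "m-k" y] by linarith
    have a4: "u (m-k) \<ge> u x + g x \<bullet> (m-k - x) - (norm (m-k - x))\<^sup>2/2" using g[of "m-k" x] by linarith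
    have eq: "(norm (m+k - x))\<^sup>2 + (norm (m+k - y))\<^sup>2 + (norm (m-k - y))\<^sup>2 + (norm (m-k - x))\<^sup>2 = 4 * (norm k)\<^sup>2 + (norm (x - y))\<^sup>2"
      unfolding m_def power2_norm_eq_inner by (simp add: algebra_simps inner_commute)
    have "g y \<bullet> (m+k - y) - g y \<bullet> (m-k - y) + (g x \<bullet> (m-k - x) - g x \<bullet> (m+k - x)) = 2 * (w \<bullet> k)"
      unfolding w_def by (simp add: algebra_simps inner_commute)
    then have "2 * (w \<bullet> k) \<le> 2 * (norm k)\<^sup>2 + (norm (x - y))\<^sup>2 / 2" using a1 a2 a3 a4 eq by argo
    moreover have "w \<bullet> k = norm (x - y) * norm w / 2" using w
      by (simp add: k_def power2_norm_eq_inner[symmetric] power2_eq_square)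
    moreover have "norm k = norm (x - y) / 2" using w by (simp add: k_def)
    ultimately have "norm (x - y) * norm w \<le> norm (x - y) * norm (x - y)" by (simp add: power2_eq_square)
    then have "norm w \<le> norm (x - y)" using False by simp
    then show ?thesis by (simp add: w_def norm_minus_commute)
  qed auto
  ultimately show ?thesis unfolding C11_1_def by blast
qed

text \<open>Along a segment the derivative of \<open>F\<close> is nondecreasing: a 1-Lipschitz
  \<open>g\<close> cannot decrease faster than the identity increases.\<close>

lemma C11_1_imp_convex:
  fixes u :: "'a::euclidean_space \<Rightarrow> real"
  assumes "C11_1 u"
  shows "convex_on UNIV (\<lambda>x. (norm x)\<^sup>2 / 2 + u x)"
proof (rule convex_on_UNIV_I)
  fix t :: real and x y :: 'a assume t: "0 < t" "t < 1"
  obtain g where d: "\<And>x. (u has_derivative (\<lambda>h. g x \<bullet> h)) (at x)"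
    and l: "\<And>x y. norm (g x - g y) \<le> norm (x - y)" using assms by (auto simp: C11_1_def)
  define F where "F s = (norm (x + s *\<^sub>R (y - x)))\<^sup>2 / 2 + u (x + s *\<^sub>R (y - x))" for s
  have "convex_on UNIV F"
  proof (rule convex_on_realI)
    show "(F has_real_derivative ((x + s *\<^sub>R (y - x)) + g (x + s *\<^sub>R (y - x))) \<bullet> (y - x)) (at s)" for s
      unfolding F_def has_field_derivative_def power2_norm_eq_inner
      by (rule derivative_eq_intros has_derivative_compose[OF _ d] refl | simp)+
         (auto simp: fun_eq_iff algebra_simps inner_commute add_divide_distrib diff_divide_distrib)
    fix s r :: real assume sr: "s \<le> r"
    define a where "a = x + s *\<^sub>R (y - x)" define b where "b = x + r *\<^sub>R (y - x)"
    have ba: "b - a = (r - s) *\<^sub>R (y - x)" by (simp add: a_def b_def algebra_simps)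
    have "(g a - g b) \<bullet> (b - a) \<le> norm (g a - g b) * norm (b - a)" by (rule norm_cauchy_schwarz)
    also have "\<dots> \<le> norm (a - b) * norm (b - a)" using l[of a b] by (intro mult_right_mono) auto
    also have "\<dots> = (b - a) \<bullet> (b - a)" by (simp add: norm_minus_commute power2_norm_eq_inner[symmetric] power2_eq_square)
    finally have "((b + g b) - (a + g a)) \<bullet> (b - a) \<ge> 0" by (simp add: algebra_simps)
    then have "(r - s) * (((b + g b) - (a + g a)) \<bullet> (y - x)) \<ge> 0" unfolding ba by simp
    then show "(a + g a) \<bullet> (y - x) \<le> (b + g b) \<bullet> (y - x)"
      by (cases "r = s") (use sr in \<open>auto simp: zero_le_mult_iff inner_diff_left inner_add_left a_def b_def\<close>)
  qed auto
  from convex_onD[OF this, of t 0 1] t have "F t \<le> (1 - t) * F 0 + t * F 1" by simp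
  then show "(norm ((1 - t) *\<^sub>R x + t *\<^sub>R y))\<^sup>2 / 2 + u ((1 - t) *\<^sub>R x + t *\<^sub>R y)
     \<le> (1 - t) * ((norm x)\<^sup>2 / 2 + u x) + t * ((norm y)\<^sup>2 / 2 + u y)"
    by (simp add: F_def algebra_simps)
qed

lemma C11_1_uminus: "C11_1 u \<Longrightarrow> C11_1 (\<lambda>x. - u x)"
proof -
  assume "C11_1 u"
  then obtain g where "\<And>x. (u has_derivative (\<lambda>h. g x \<bullet> h)) (at x)" "\<And>x y. norm (g x - g y) \<le> norm (x - y)"
    by (auto simp: C11_1_def)
  then show ?thesis unfolding C11_1_def
    by (intro exI[of _ "\<lambda>x. - g x"]) (auto intro!: derivative_eq_intros simp: norm_minus_commute)
qed

text \<open>Convexity of |z|^2 - \<psi> comes from the maximality of \<open>\<psi>\<close>. For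
  fixed \<open>t\<close> and \<open>h\<close>, averaging two translates of \<open>\<psi>\<close> and
  subtracting \<open>(1 - t) * t * (norm h)\<^sup>2\<close> gives a convex function
  \<open>k\<close>. It stays below \<open>G\<close> because \<open>A\<close> is convex and the
  subtracted term is exactly the excess of the averaged translates of |z|^2. Hence \<open>k\<close>
  lies below \<open>\<psi>\<close>, and at the averaged point this is the required
  inequality.\<close>

lemma C11_1_between:
  fixes A B :: "'a::euclidean_space \<Rightarrow> real"
  assumes A: "convex_on UNIV A" and B: "convex_on UNIV B"
    and AB: "\<And>z. A z + B z \<le> (norm z)\<^sup>2 - m"
  obtains u where "C11_1 u" "\<And>z. B z \<le> (norm z)\<^sup>2 / 2 + u z" "\<And>z. A z \<le> (norm z)\<^sup>2 / 2 - u z - m"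
proof -
  define G where "G z = (norm z)\<^sup>2 - m - A z" for z
  define K where "K = {k. convex_on UNIV k \<and> (\<forall>z. k z \<le> G z)}"
  have BK: "B \<in> K" using B AB by (auto simp: K_def G_def algebra_simps)
  have bd: "bdd_above ((\<lambda>k. k z) ` K)" for z
    by (rule bdd_aboveI[of _ "G z"]) (auto simp: K_def)
  define \<psi> where "\<psi> z = (SUP k\<in>K. k z)" for z
  have cv: "convex_on UNIV \<psi>" unfolding \<psi>_def
    using BK bd by (intro convex_on_UNIV_cSUP) (auto simp: K_def)
  have up: "k z \<le> \<psi> z" if "k \<in> K" for k z unfolding \<psi>_def using that bd by (intro cSUP_upper)
  have \<psi>G: "\<psi> z \<le> G z" for z unfolding \<psi>_def using BK by (intro cSUP_least) (auto simp: K_def)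
  have cv2: "convex_on UNIV (\<lambda>z. (norm z)\<^sup>2 - \<psi> z)"
  proof (rule convex_on_UNIV_I)
    fix t :: real and x y :: 'a assume t: "0 < t" "t < 1"
    define h where "h = y - x"
    define k where "k z = (1 - t) * \<psi> (z - t *\<^sub>R h) + t * \<psi> (z + (1 - t) *\<^sub>R h) - (1 - t) * t * (norm h)\<^sup>2" for z
    have quad: "(1 - t) * (norm (z - t *\<^sub>R h))\<^sup>2 + t * (norm (z + (1 - t) *\<^sub>R h))\<^sup>2
                 = (norm z)\<^sup>2 + (1 - t) * t * (norm h)\<^sup>2" for z
      unfolding power2_norm_eq_inner by (simp add: algebra_simps inner_commute)
    have bary: "(1 - t) *\<^sub>R (z - t *\<^sub>R h) + t *\<^sub>R (z + (1 - t) *\<^sub>R h) = z" for z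
      by (simp add: algebra_simps)
    have "k \<in> K" unfolding K_def
    proof safe
      have shift: "convex_on UNIV (\<lambda>z. \<psi> (z + w))" for w
      proof (rule convex_on_UNIV_I)
        fix t :: real and x y :: 'a assume t: "0 < t" "t < 1"
        have "(1 - t) *\<^sub>R x + t *\<^sub>R y + w = (1 - t) *\<^sub>R (x + w) + t *\<^sub>R (y + w)" by (simp add: algebra_simps)
        then show "\<psi> ((1 - t) *\<^sub>R x + t *\<^sub>R y + w) \<le> (1 - t) * \<psi> (x + w) + t * \<psi> (y + w)"
          using convex_onD[OF cv, of t "x + w" "y + w"] t by simp
      qed
      have "convex_on UNIV (\<lambda>z. (1 - t) * \<psi> (z + - (t *\<^sub>R h)) + t * \<psi> (z + (1 - t) *\<^sub>R h) + (- ((1 - t) * t * (norm h)\<^sup>2)))"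
        by (intro convex_on_add convex_on_cmul shift convex_on_const[THEN iffD2]) (use t in auto)
      then show "convex_on UNIV k" by (simp add: k_def[abs_def])
      fix z
      have "A z \<le> (1 - t) * A (z - t *\<^sub>R h) + t * A (z + (1 - t) *\<^sub>R h)"
        using convex_onD[OF A, of t "z - t *\<^sub>R h" "z + (1 - t) *\<^sub>R h"] t by (simp add: bary)
      moreover have "(1 - t) * \<psi> (z - t *\<^sub>R h) \<le> (1 - t) * G (z - t *\<^sub>R h)"
         "t * \<psi> (z + (1 - t) *\<^sub>R h) \<le> t * G (z + (1 - t) *\<^sub>R h)" using t \<psi>G by (auto intro!: mult_left_mono)
      ultimately show "k z \<le> G z" using quad[of z] by (simp add: k_def G_def algebra_simps)
    qed
    from up[OF this, of "(1 - t) *\<^sub>R x + t *\<^sub>R y"]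
    have "(1 - t) * \<psi> x + t * \<psi> y - (1 - t) * t * (norm h)\<^sup>2 \<le> \<psi> ((1 - t) *\<^sub>R x + t *\<^sub>R y)"
      by (simp add: k_def h_def algebra_simps)
    moreover have "(1 - t) * (norm x)\<^sup>2 + t * (norm y)\<^sup>2 = (norm ((1 - t) *\<^sub>R x + t *\<^sub>R y))\<^sup>2 + (1 - t) * t * (norm h)\<^sup>2"
      unfolding h_def power2_norm_eq_inner by (simp add: algebra_simps inner_commute)
    ultimately show "(norm ((1 - t) *\<^sub>R x + t *\<^sub>R y))\<^sup>2 - \<psi> ((1 - t) *\<^sub>R x + t *\<^sub>R y)
      \<le> (1 - t) * ((norm x)\<^sup>2 - \<psi> x) + t * ((norm y)\<^sup>2 - \<psi> y)" by (simp add: algebra_simps)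
  qed
  show ?thesis
  proof (rule that[of "\<lambda>z. \<psi> z - (norm z)\<^sup>2 / 2"])
    show "C11_1 (\<lambda>z. \<psi> z - (norm z)\<^sup>2 / 2)"
    proof (rule C11_1_if_convex)
      show "convex_on UNIV (\<lambda>x. (norm x)\<^sup>2 / 2 + (\<psi> x - (norm x)\<^sup>2 / 2))" using cv by simp
      have "(\<lambda>x. (norm x)\<^sup>2 / 2 - (\<psi> x - (norm x)\<^sup>2 / 2)) = (\<lambda>z. (norm z)\<^sup>2 - \<psi> z)" by auto
      then show "convex_on UNIV (\<lambda>x. (norm x)\<^sup>2 / 2 - (\<psi> x - (norm x)\<^sup>2 / 2))" using cv2 by simp
    qed
    show "B z \<le> (norm z)\<^sup>2 / 2 + (\<psi> z - (norm z)\<^sup>2 / 2)" for z using up[OF BK, of z] by simp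
    show "A z \<le> (norm z)\<^sup>2 / 2 - (\<psi> z - (norm z)\<^sup>2 / 2) - m" for z using \<psi>G[of z] by (simp add: G_def)
  qed
qed

section \<open>Smooth bump functions separate finite measures\<close>

text \<open>Smoothness by invariance: \<open>f\<close> only has to lie in a class of differentiable
  functions that is closed under directional derivatives. Multiples of members of
  \<open>bump_algebra\<close> by a fixed vector form such a class.\<close>

lemma smoothI:
  assumes "f \<in> S" "\<And>g x. g \<in> S \<Longrightarrow> g differentiable (at x)"
    "\<And>g v. g \<in> S \<Longrightarrow> (\<lambda>x. frechet_derivative g (at x) v) \<in> S"
  shows "smooth f"
proof -
  have "g \<in> S" if "g \<in> iter_derivs f" for g
    using that by induction (use assms in auto)
  then show ?thesis using assms(2) by (auto simp: smooth_def)
qed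

text \<open>The usual cutoff exp(-1/t) is the case \<open>k = 0\<close>; the powers of t in the
  denominator keep derivatives in the linear span of the family.\<close>

definition flat :: "nat \<Rightarrow> real \<Rightarrow> real" where
  "flat k t = (if t > 0 then exp (- 1 / t) / t ^ k else 0)"

lemma flat_nonneg: "flat k t \<ge> 0" by (simp add: flat_def)
lemma flat_pos_iff: "flat k t > 0 \<longleftrightarrow> t > 0" by (simp add: flat_def)

lemma flat_has_derivative:
  "(flat k has_real_derivative (- real k * flat (Suc k) t + flat (k + 2) t)) (at t)"
proof -
  consider "t > 0" | "t < 0" | "t = 0" by linarith
  then show ?thesis
  proof cases
    case 1
    have eq: "exp (- 1 / t - real j * ln t) = flat j t" if "t > 0" for t j
      using that by (simp add: flat_def exp_diff exp_of_nat_mult)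
    have "((\<lambda>t. exp (- 1 / t - real k * ln t)) has_real_derivative
        exp (- 1 / t - real k * ln t) * (1 / t\<^sup>2 - real k / t)) (at t)"
      using 1 by (auto intro!: derivative_eq_intros simp: power2_eq_square)
    also have "exp (- 1 / t - real k * ln t) * (1 / t\<^sup>2 - real k / t) = - real k * flat (Suc k) t + flat (k + 2) t"
      unfolding eq[OF 1] using 1 by (simp add: flat_def field_simps power2_eq_square)
    finally show ?thesis
      by (rule has_field_derivative_transform_within_open[where S="{0<..}"])
         (use 1 eq in auto)
  next
    case 2
    have "((\<lambda>t. 0) has_real_derivative (- real k * flat (Suc k) t + flat (k + 2) t)) (at t)"
      using 2 by (simp add: flat_def)
    then show ?thesis
      by (rule has_field_derivative_transform_within_open[where S="{..<0}"]) (use 2 in \<open>auto simp: flat_def\<close>)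
  next
    case 3
    \<comment> \<open>With s = 1/t the right difference quotient at 0 is s^(k+1) / exp s.\<close>
    have lim: "((\<lambda>t. inverse t ^ Suc k / exp (inverse t)) \<longlongrightarrow> (0::real)) (at_right 0)"
      by (rule filterlim_compose[OF tendsto_power_div_exp_0 filterlim_inverse_at_top_right])
    have "((\<lambda>h. flat k h / h) \<longlongrightarrow> 0) (at 0)"
      unfolding filterlim_at_split
    proof
      show "((\<lambda>h. flat k h / h) \<longlongrightarrow> 0) (at_left 0)"
        by (rule tendsto_eventually) (auto simp: eventually_at_filter flat_def)
      show "((\<lambda>h. flat k h / h) \<longlongrightarrow> 0) (at_right 0)"
        by (rule Lim_transform_eventually[OF lim])
           (auto simp: eventually_at_filter flat_def field_simps exp_minus)
    qed
    then show ?thesis using 3 by (simp add: DERIV_def flat_def)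
  qed
qed

inductive_set bump_algebra :: "('a::euclidean_space \<Rightarrow> real) set" where
  const: "(\<lambda>_. c) \<in> bump_algebra"
| flat: "(\<lambda>x. flat k (p \<bullet> x + c)) \<in> bump_algebra"
| add: "f \<in> bump_algebra \<Longrightarrow> g \<in> bump_algebra \<Longrightarrow> (\<lambda>x. f x + g x) \<in> bump_algebra"
| mult: "f \<in> bump_algebra \<Longrightarrow> g \<in> bump_algebra \<Longrightarrow> (\<lambda>x. f x * g x) \<in> bump_algebra"
| exp: "f \<in> bump_algebra \<Longrightarrow> (\<lambda>x. exp (f x)) \<in> bump_algebra"

lemma bump_algebra_has_derivative:
  "f \<in> bump_algebra \<Longrightarrow> \<exists>D. (\<forall>x. (f has_derivative (\<lambda>v. D v x)) (at x)) \<and> (\<forall>v. D v \<in> bump_algebra)"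
proof (induction rule: bump_algebra.induct)
  case (const c)
  show ?case by (rule exI[of _ "\<lambda>v x. 0"]) (auto intro: bump_algebra.const)
next
  case (flat k p c)
  let ?D = "\<lambda>v x. (p \<bullet> v) * ((- real k) * flat (Suc k) (p \<bullet> x + c) + flat (k + 2) (p \<bullet> x + c))"
  have "((\<lambda>x. flat k (p \<bullet> x + c)) has_derivative (\<lambda>v. ?D v x)) (at x)" for x
  proof -
    have 1: "((\<lambda>x. p \<bullet> x + c) has_derivative (\<lambda>v. p \<bullet> v)) (at x)"
      by (auto intro!: derivative_eq_intros)
    show ?thesis
      using has_derivative_compose[OF 1 flat_has_derivative[of k "p \<bullet> x + c", unfolded has_field_derivative_def]]
      by (simp add: mult.commute)
  qed
  moreover have "?D v \<in> bump_algebra" for v by (intro bump_algebra.intros)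
  ultimately show ?case by (intro exI[of _ ?D] conjI allI)
next
  case (add f g)
  then obtain D E where "\<forall>x. (f has_derivative (\<lambda>v. D v x)) (at x)" "\<forall>v. D v \<in> bump_algebra"
    "\<forall>x. (g has_derivative (\<lambda>v. E v x)) (at x)" "\<forall>v. E v \<in> bump_algebra" by blast
  then show ?case by (intro exI[of _ "\<lambda>v x. D v x + E v x"]) (auto intro!: derivative_intros bump_algebra.intros)
next
  case (mult f g)
  then obtain D E where "\<forall>x. (f has_derivative (\<lambda>v. D v x)) (at x)" "\<forall>v. D v \<in> bump_algebra"
    "\<forall>x. (g has_derivative (\<lambda>v. E v x)) (at x)" "\<forall>v. E v \<in> bump_algebra" by blast
  then show ?case using mult.hyps
    by (intro exI[of _ "\<lambda>v x. f x * E v x + D v x * g x"]) (auto intro!: derivative_intros bump_algebra.intros)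
next
  case (exp f)
  then obtain D where "\<forall>x. (f has_derivative (\<lambda>v. D v x)) (at x)" "\<forall>v. D v \<in> bump_algebra" by blast
  then show ?case using exp.hyps
    by (intro exI[of _ "\<lambda>v x. exp (f x) * D v x"])
       (auto intro!: derivative_eq_intros bump_algebra.intros)
qed

lemma bump_algebra_prod:
  "finite I \<Longrightarrow> (\<And>i. i \<in> I \<Longrightarrow> f i \<in> bump_algebra) \<Longrightarrow> (\<lambda>x. \<Prod>i\<in>I. f i x) \<in> bump_algebra"
  by (induction rule: finite_induct) (auto intro: bump_algebra.intros)

lemma smooth_bump_algebra:
  assumes "f \<in> bump_algebra"
  shows "smooth (\<lambda>x. f x *\<^sub>R c)"
proof (rule smoothI[where S="(\<lambda>f x. f x *\<^sub>R c) ` bump_algebra"])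
  have *: "(\<forall>x. (\<lambda>x. f x *\<^sub>R c) differentiable (at x)) \<and>
           (\<forall>v. (\<lambda>x. frechet_derivative (\<lambda>x. f x *\<^sub>R c) (at x) v) \<in> (\<lambda>f x. f x *\<^sub>R c) ` bump_algebra)"
    if f: "f \<in> bump_algebra" for f :: "'a \<Rightarrow> real"
  proof -
    obtain D where D: "\<forall>x. (f has_derivative (\<lambda>v. D v x)) (at x)" "\<forall>v. D v \<in> bump_algebra"
      using bump_algebra_has_derivative[OF f] by blast
    have d: "((\<lambda>x. f x *\<^sub>R c) has_derivative (\<lambda>v. D v x *\<^sub>R c)) (at x)" for x
      using D(1) by (intro has_derivative_scaleR_left) auto
    then have "(\<lambda>x. frechet_derivative (\<lambda>x. f x *\<^sub>R c) (at x) v) = (\<lambda>x. D v x *\<^sub>R c)" for v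
      by (intro ext) (metis frechet_derivative_at)
    then show ?thesis using d D(2) by (auto simp: differentiable_def)
  qed
  show "(\<lambda>x. f x *\<^sub>R c) \<in> (\<lambda>f x. f x *\<^sub>R c) ` bump_algebra" using assms by auto
  fix g :: "'a \<Rightarrow> 'b" assume "g \<in> (\<lambda>f x. f x *\<^sub>R c) ` bump_algebra"
  then show "g differentiable (at x)" "(\<lambda>x. frechet_derivative g (at x) v) \<in> (\<lambda>f x. f x *\<^sub>R c) ` bump_algebra" for x v
    using * by auto
qed

definition hump :: "'a::euclidean_space \<Rightarrow> 'a \<Rightarrow> 'a \<Rightarrow> real" where
  "hump a b x = (\<Prod>i\<in>Basis. flat 0 (i \<bullet> x + - (i \<bullet> a)) * flat 0 ((- i) \<bullet> x + i \<bullet> b))"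

text \<open>Composing the hump with 1 - exp(-n s) still gives 0 off the box, and the limit in n is
  the indicator of the box. Here and in \<open>hump\<close>, sums with negated terms replace
  subtraction so that the rules of \<open>bump_algebra\<close> apply literally.\<close>

definition bump :: "nat \<Rightarrow> 'a::euclidean_space \<Rightarrow> 'a \<Rightarrow> 'a \<Rightarrow> real" where
  "bump n a b x = 1 + (-1) * exp (- real n * hump a b x)"

lemma hump_nonneg: "hump a b x \<ge> 0"
  unfolding hump_def by (intro prod_nonneg mult_nonneg_nonneg ballI flat_nonneg)

lemma hump_pos: "x \<in> box a b \<Longrightarrow> hump a b x > 0"
  unfolding hump_def by (intro prod_pos mult_pos_pos) (auto simp: flat_pos_iff mem_box inner_commute)

lemma hump_zero: "x \<notin> box a b \<Longrightarrow> hump a b x = 0"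
  unfolding hump_def by (auto simp: flat_def mem_box inner_commute)

lemma bump_in_algebra: "bump n a b \<in> bump_algebra"
  unfolding bump_def[abs_def] hump_def by (intro bump_algebra.intros bump_algebra_prod) auto

lemma continuous_on_bump: "continuous_on S (bump n a b)"
proof -
  obtain D where "\<forall>x. (bump n a b has_derivative (\<lambda>v. D v x)) (at x)"
    using bump_algebra_has_derivative[OF bump_in_algebra] by blast
  then show ?thesis by (auto intro!: continuous_at_imp_continuous_on has_derivative_continuous)
qed

lemma measurable_bump [measurable]: "bump n a b \<in> borel_measurable borel"
  by (intro borel_measurable_continuous_onI continuous_on_bump)

lemma abs_bump_le_1: "\<bar>bump n a b x\<bar> \<le> 1"
  using hump_nonneg[of a b x] by (auto simp: bump_def abs_le_iff)

lemma bump_zero: "x \<notin> box a b \<Longrightarrow> bump n a b x = 0"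
  by (simp add: bump_def hump_zero)

lemma bump_tendsto_indicator: "(\<lambda>n. bump n a b x) \<longlonglongrightarrow> indicator (box a b) x"
proof (cases "x \<in> box a b")
  case True
  have "norm (exp (- hump a b x)) < 1" using hump_pos[OF True] by simp
  then have "(\<lambda>n. exp (- hump a b x) ^ n) \<longlonglongrightarrow> 0" by (rule LIMSEQ_power_zero)
  then have "(\<lambda>n. 1 + (-1) * exp (- hump a b x) ^ n) \<longlonglongrightarrow> 1 + (-1) * 0"
    by (intro tendsto_add[OF tendsto_const] tendsto_mult_left)
  then show ?thesis using True by (simp add: bump_def exp_of_nat_mult[symmetric])
qed (simp add: bump_zero)

lemma test_field_bump: "test_field (\<lambda>x. bump n a b x *\<^sub>R c)"
proof -
  have "{x. bump n a b x *\<^sub>R c \<noteq> 0} \<subseteq> box a b" using bump_zero by force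
  then have "bounded (closure {x. bump n a b x *\<^sub>R c \<noteq> 0})"
    using bounded_subset[OF bounded_box] by blast
  then show ?thesis unfolding test_field_def compact_support_def
    using smooth_bump_algebra[OF bump_in_algebra] by (auto simp: compact_eq_bounded_closed)
qed

section \<open>Countably many bumps determine a finite measure\<close>

definition rat_points :: "'a::euclidean_space set" where
  "rat_points = {a. \<forall>i\<in>Basis. a \<bullet> i \<in> \<rat>}"

definition bumps :: "('a::euclidean_space \<Rightarrow> real) set" where
  "bumps = (\<lambda>(n, a, b). bump n a b) ` (UNIV \<times> rat_points \<times> rat_points)"

lemma countable_rat_points: "countable (rat_points :: 'a::euclidean_space set)"
proof -
  have "(rat_points :: 'a set) \<subseteq> (\<lambda>f. \<Sum>i\<in>Basis. f i *\<^sub>R i) ` (Basis \<rightarrow>\<^sub>E \<rat>)"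
  proof
    fix a :: 'a assume "a \<in> rat_points"
    then have "(\<lambda>i\<in>Basis. a \<bullet> i) \<in> Basis \<rightarrow>\<^sub>E \<rat>" by (auto simp: rat_points_def)
    moreover have "a = (\<Sum>i\<in>Basis. (\<lambda>i\<in>Basis. a \<bullet> i) i *\<^sub>R i)" by (simp add: euclidean_representation)
    ultimately show "a \<in> (\<lambda>f. \<Sum>i\<in>Basis. f i *\<^sub>R i) ` (Basis \<rightarrow>\<^sub>E \<rat>)" by blast
  qed
  moreover have "countable ((\<lambda>f. \<Sum>i\<in>Basis. f i *\<^sub>R i) ` (Basis \<rightarrow>\<^sub>E \<rat>) :: 'a set)"
    by (intro countable_image countable_PiE countable_rat) auto
  ultimately show ?thesis by (rule countable_subset)
qed

lemma countable_bumps: "countable (bumps :: ('a::euclidean_space \<Rightarrow> real) set)"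
  unfolding bumps_def by (intro countable_image countable_SIGMA countable_rat_points) auto

lemma bumps_nonempty: "bumps \<noteq> {}"
  by (auto simp: bumps_def rat_points_def intro!: exI[of _ 0])

lemma borel_eq_sigma_rat_boxes:
  "sets (borel :: 'a::euclidean_space measure) = sigma_sets UNIV ((\<lambda>(a, b). box a b) ` (rat_points \<times> rat_points))"
proof -
  let ?B = "(\<lambda>(a, b). box a b) ` (rat_points \<times> rat_points) :: 'a set set"
  have "topological_basis ?B"
  proof (rule topological_basisI)
    fix O' :: "'a set" and x assume "open O'" "x \<in> O'"
    then obtain e where e: "e > 0" "ball x e \<subseteq> O'" using openE by blast
    then obtain a b where "\<forall>i\<in>Basis. a \<bullet> i \<in> \<rat> \<and> b \<bullet> i \<in> \<rat>" "x \<in> box a b" "box a b \<subseteq> ball x e"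
      using rational_boxes by blast
    then show "\<exists>B'\<in>?B. x \<in> B' \<and> B' \<subseteq> O'" using e by (intro bexI[of _ "box a b"]) (auto simp: rat_points_def)
  qed (auto intro: open_box)
  moreover have "countable ?B" by (intro countable_image countable_SIGMA countable_rat_points)
  ultimately have "(borel :: 'a measure) = sigma UNIV ?B" by (intro borel_eq_countable_basis)
  then have "sets (borel :: 'a measure) = sets (sigma UNIV ?B)" by (rule arg_cong)
  then show ?thesis by (simp add: sets_measure_of)
qed

text \<open>Open boxes with rational corners form a countable intersection-stable generator of the
  Borel sets, and their indicators are bounded pointwise limits of bumps.\<close>

lemma finite_measure_eqI_bumps:
  fixes M N :: "'a::euclidean_space measure"
  assumes "finite_measure M" "finite_measure N" and [measurable_cong]: "sets M = sets borel" "sets N = sets borel"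
    and eq: "\<And>\<phi>. \<phi> \<in> bumps \<Longrightarrow> (\<integral>x. \<phi> x \<partial>M) = (\<integral>x. \<phi> x \<partial>N)"
  shows "M = N"
proof (rule measure_eqI_generator_eq_countable[where E="(\<lambda>(a, b). box a b) ` (rat_points \<times> rat_points)" and \<Omega>=UNIV
      and A="(\<lambda>(a, b). box a b) ` (rat_points \<times> rat_points)"])
  interpret M: finite_measure M by fact
  interpret N: finite_measure N by fact
  let ?B = "(\<lambda>(a, b). box a b) ` (rat_points \<times> rat_points) :: 'a set set"
  show "sets M = sigma_sets UNIV ?B" "sets N = sigma_sets UNIV ?B"
    using assms borel_eq_sigma_rat_boxes by auto
  show "Int_stable ?B"
  proof (rule Int_stableI, clarsimp)
    fix a b c d :: 'a assume q: "a \<in> rat_points" "b \<in> rat_points" "c \<in> rat_points" "d \<in> rat_points"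
    let ?l = "\<Sum>i\<in>Basis. max (a \<bullet> i) (c \<bullet> i) *\<^sub>R i" let ?u = "\<Sum>i\<in>Basis. min (b \<bullet> i) (d \<bullet> i) *\<^sub>R i"
    have "box a b \<inter> box c d = box ?l ?u" by (auto simp: set_eq_iff mem_box)
    moreover have "?l \<in> rat_points" "?u \<in> rat_points" using q by (auto simp: rat_points_def max_def min_def)
    ultimately show "box a b \<inter> box c d \<in> ?B" by auto
  qed
  show "\<Union>?B = UNIV"
  proof (intro set_eqI iffI UNIV_I)
    fix x :: 'a
    obtain a b where "\<forall>i\<in>Basis. a \<bullet> i \<in> \<rat> \<and> b \<bullet> i \<in> \<rat>" "x \<in> box a b" "box a b \<subseteq> ball x 1"
      using rational_boxes[of 1 x] by auto
    then show "x \<in> \<Union>?B" by (auto simp: rat_points_def)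
  qed
  fix X assume "X \<in> ?B"
  then obtain a b where X: "X = box a b" "a \<in> rat_points" "b \<in> rat_points" by auto
  have lim: "(\<lambda>n. \<integral>x. bump n a b x \<partial>K) \<longlonglongrightarrow> measure K X" if "finite_measure K" and [measurable_cong]: "sets K = sets borel" for K
  proof -
    interpret K: finite_measure K by fact
    have sp: "space K = UNIV" using sets_eq_imp_space_eq[OF that(2)] by simp
    have "(\<lambda>n. \<integral>x. bump n a b x \<partial>K) \<longlonglongrightarrow> (\<integral>x. indicator X x \<partial>K)"
      by (rule integral_dominated_convergence[where w="\<lambda>_. 1"])
         (auto simp: X abs_bump_le_1 bump_tendsto_indicator)
    then show ?thesis by (simp add: sp)
  qed
  have "(\<integral>x. bump n a b x \<partial>M) = (\<integral>x. bump n a b x \<partial>N)" for n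
    using X by (intro eq) (force simp: bumps_def)
  then have "measure M X = measure N X"
    using lim[of M] lim[of N] assms LIMSEQ_unique by auto
  then show "emeasure M X = emeasure N X" by (simp add: M.emeasure_eq_measure N.emeasure_eq_measure)
next
  show "emeasure M X \<noteq> \<infinity>" for X
    using finite_measure.emeasure_finite[OF assms(1)] by simp
qed (auto intro!: countable_image countable_SIGMA countable_rat_points)

text \<open>The positive and negative parts of \<open>g\<close> push forward along \<open>X\<close> to two finite measures, which the bumps separate.\<close>
lemma integral_mult_zero_if_bumps:
  fixes X :: "'b \<Rightarrow> 'a::euclidean_space" and f :: "'a \<Rightarrow> real"
  assumes g: "integrable M g" and X[measurable]: "X \<in> measurable M borel"
    and z: "\<And>\<phi>. \<phi> \<in> bumps \<Longrightarrow> (\<integral>w. g w * \<phi> (X w) \<partial>M) = 0"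
    and f[measurable]: "f \<in> borel_measurable borel" and bd: "\<And>x. \<bar>f x\<bar> \<le> C"
  shows "(\<integral>w. g w * f (X w) \<partial>M) = 0"
proof -
  have [measurable]: "g \<in> borel_measurable M" using g by auto
  define P where "P = distr (density M (\<lambda>w. ennreal (max 0 (g w)))) borel X"
  define N where "N = distr (density M (\<lambda>w. ennreal (max 0 (- g w)))) borel X"
  have ig: "integrable M (\<lambda>w. max 0 (g w))" "integrable M (\<lambda>w. max 0 (- g w))"
    using g by auto
  have iP: "(\<integral>x. h x \<partial>P) = (\<integral>w. max 0 (g w) * h (X w) \<partial>M)"
    and iN: "(\<integral>x. h x \<partial>N) = (\<integral>w. max 0 (- g w) * h (X w) \<partial>M)" if [measurable]: "h \<in> borel_measurable borel" for h :: "'a \<Rightarrow> real"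
    unfolding P_def N_def by (subst integral_distr, simp, simp, subst integral_density; simp)+
  have int: "integrable M (\<lambda>w. k w * h (X w))"
    if [measurable]: "h \<in> borel_measurable borel" and h: "\<And>x. \<bar>h x\<bar> \<le> B" and k: "integrable M k" for h :: "'a \<Rightarrow> real" and B k
  proof (rule Bochner_Integration.integrable_bound[OF integrable_mult_right[OF k, of B]])
    have [measurable]: "k \<in> borel_measurable M" using k by auto
    show "(\<lambda>w. k w * h (X w)) \<in> borel_measurable M" by measurable
    have "\<bar>h x\<bar> \<le> \<bar>B\<bar>" for x using h[of x] by linarith
    then show "AE w in M. norm (k w * h (X w)) \<le> norm (B * k w)"
      by (auto simp: abs_mult mult.commute[of "\<bar>B\<bar>"] intro!: mult_left_mono)
  qed
  have split: "(\<integral>w. g w * h (X w) \<partial>M) = (\<integral>x. h x \<partial>P) - (\<integral>x. h x \<partial>N)"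
    if [measurable]: "h \<in> borel_measurable borel" and "\<And>x. \<bar>h x\<bar> \<le> B" for h :: "'a \<Rightarrow> real" and B
    unfolding iP[OF that(1)] iN[OF that(1)]
    by (subst Bochner_Integration.integral_diff[symmetric, OF int[OF that ig(1)] int[OF that ig(2)]])
       (auto intro!: Bochner_Integration.integral_cong simp: max_def)
  have fin: "finite_measure (distr (density M (\<lambda>w. ennreal (k w))) borel X)"
    if "integrable M k" "\<And>w. 0 \<le> k w" for k
  proof
    have [measurable]: "k \<in> borel_measurable M" using that by auto
    have "emeasure (distr (density M (\<lambda>w. ennreal (k w))) borel X) UNIV = (\<integral>\<^sup>+w. ennreal (k w) \<partial>M)"
      by (subst emeasure_distr) (auto simp: emeasure_density intro!: nn_integral_cong)
    also have "\<dots> < \<infinity>" using that by (simp add: nn_integral_eq_integral)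
    finally show "emeasure (distr (density M (\<lambda>w. ennreal (k w))) borel X) (space (distr (density M (\<lambda>w. ennreal (k w))) borel X)) \<noteq> \<infinity>"
      by simp
  qed
  have "P = N"
  proof (rule finite_measure_eqI_bumps)
    show "finite_measure P" "finite_measure N" unfolding P_def N_def by (rule fin[OF ig(1)], simp, rule fin[OF ig(2)], simp)
    show "sets P = sets borel" "sets N = sets borel" by (auto simp: P_def N_def)
    fix \<phi> :: "'a \<Rightarrow> real" assume p: "\<phi> \<in> bumps"
    then have [measurable]: "\<phi> \<in> borel_measurable borel" by (auto simp: bumps_def)
    show "(\<integral>x. \<phi> x \<partial>P) = (\<integral>x. \<phi> x \<partial>N)"
      using split[of \<phi> 1] z[OF p] p abs_bump_le_1 by (auto simp: bumps_def)
  qed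
  then show ?thesis using split[OF f bd] by simp
qed

section \<open>A space-filling curve\<close>

text \<open>The distance from \<open>t\<close> to the nearest even integer; in this closed form,
  continuity and the period 2 are inherited from the cosine.\<close>

definition triangle_wave :: "real \<Rightarrow> real" where
  "triangle_wave t = arccos (cos (pi * t)) / pi"

lemma continuous_on_triangle_wave: "continuous_on S triangle_wave"
  unfolding triangle_wave_def[abs_def] by (intro continuous_intros) auto

lemma cos_pi_even_int: "cos (pi * (2 * real_of_int j + t)) = cos (pi * t)"
proof -
  have "cos (pi * (2 * real_of_int j + t)) = cos (pi * t + 2 * real_of_int j * pi)" by (simp add: algebra_simps)
  also have "\<dots> = cos (pi * t)"
    by (simp add: cos_add) (metis cos_int_2pin mult.commute mult.assoc mult.left_commute mult_cancel_left1 sin_int_2pin diff_zero mult_zero_right)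
  finally show ?thesis .
qed

lemma triangle_wave_periodic: "triangle_wave (2 * real_of_int j + t) = triangle_wave t"
  by (simp add: triangle_wave_def cos_pi_even_int)

lemma triangle_wave_id: "0 \<le> s \<Longrightarrow> s \<le> 1 \<Longrightarrow> triangle_wave s = s"
  by (simp add: triangle_wave_def arccos_cos)

text \<open>On [0,1] this is 0 up to 1/3, is 1 from 2/3 on, and is linear in between, so it tells a
  first ternary digit 0 from a first digit 2.\<close>

definition plateau :: "real \<Rightarrow> real" where
  "plateau t = max 0 (min 1 (3 * triangle_wave t - 1))"

lemma continuous_on_plateau: "continuous_on S plateau"
  unfolding plateau_def[abs_def] by (intro continuous_intros continuous_on_triangle_wave)

lemma plateau_bounds: "0 \<le> plateau t" "plateau t \<le> 1"
  by (auto simp: plateau_def)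

lemma plateau_periodic: "plateau (2 * real_of_int j + t) = plateau t"
  by (simp add: plateau_def triangle_wave_periodic)

text \<open>In base 3 the digits of \<open>cantor_sum a\<close> are \<open>2 * a n\<close>; after a shift by \<open>N\<close> places the plateau reads off \<open>a N\<close>.\<close>
definition cantor_sum :: "(nat \<Rightarrow> real) \<Rightarrow> real" where
  "cantor_sum a = (\<Sum>n. 2 * a n / 3 ^ Suc n)"

lemma summable_cantor:
  assumes "\<And>n. a n \<in> {0, 1}"
  shows "summable (\<lambda>n. 2 * a (n + k) / (3::real) ^ Suc n)"
proof (rule summable_comparison_test')
  show "summable (\<lambda>n. (2/3) * (1/3::real) ^ n)" by (intro summable_mult summable_geometric) auto
  show "norm (2 * a (n + k) / 3 ^ Suc n) \<le> (2/3) * (1/3::real) ^ n" for n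
    using assms[of "n + k"] by (auto simp: power_divide)
qed

lemma cantor_sum_bounds:
  assumes "\<And>n. a n \<in> {0, 1}"
  shows "0 \<le> cantor_sum a" "cantor_sum a \<le> 1"
proof -
  have s: "summable (\<lambda>n. 2 * a n / (3::real) ^ Suc n)" using summable_cantor[of a 0] assms by simp
  have a: "0 \<le> a n" "a n \<le> 1" for n using assms[of n] by auto
  show "0 \<le> cantor_sum a" unfolding cantor_sum_def using a by (intro suminf_nonneg s) auto
  have g: "(\<lambda>n. (2/3) * (1/3::real) ^ n) sums ((2/3) * (1 / (1 - 1/3)))" by (intro sums_mult geometric_sums) auto
  have "cantor_sum a \<le> (\<Sum>n. (2/3) * (1/3::real) ^ n)" unfolding cantor_sum_def
    using a by (intro suminf_le s sums_summable[OF g]) (auto simp: power_divide divide_simps)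
  also have "\<dots> = 1" using sums_unique[OF g] by simp
  finally show "cantor_sum a \<le> 1" .
qed

lemma plateau_cantor_sum:
  assumes "\<And>n. a n \<in> {0, 1}"
  shows "plateau (3 ^ N * cantor_sum a) = a N"
proof -
  \<comment> \<open>Multiplying by 3^N moves the first N ternary digits in front of the point. Being
    0 or 2, they form an even integer, which the period of \<open>plateau\<close> removes.\<close>
  have "\<exists>j::int. 3 ^ N * cantor_sum a = 2 * real_of_int j + cantor_sum (\<lambda>n. a (n + N))" for N
  proof (induction N)
    case 0
    show ?case by (rule exI[of _ 0]) simp
  next
    case (Suc N)
    then obtain j where j: "3 ^ N * cantor_sum a = 2 * real_of_int j + cantor_sum (\<lambda>n. a (n + N))" by blast
    have s: "summable (\<lambda>n. 2 * a (n + N) / (3::real) ^ Suc n)" by (rule summable_cantor[OF assms])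
    have "cantor_sum (\<lambda>n. a (n + N)) = (\<Sum>n. 2 * a (Suc n + N) / 3 ^ Suc (Suc n)) + 2 * a N / 3"
      using suminf_split_head[OF s] by (simp add: cantor_sum_def)
    also have "(\<Sum>n. 2 * a (Suc n + N) / 3 ^ Suc (Suc n)) = (\<Sum>n. (1/3) * (2 * a (n + Suc N) / 3 ^ Suc n))"
      by (simp add: field_simps)
    also have "\<dots> = cantor_sum (\<lambda>n. a (n + Suc N)) / 3"
      by (subst suminf_mult[OF summable_cantor[OF assms]]) (simp add: cantor_sum_def)
    finally have e: "3 * cantor_sum (\<lambda>n. a (n + N)) = cantor_sum (\<lambda>n. a (n + Suc N)) + 2 * a N" by simp
    have "a N = real_of_int (if a N = 0 then 0 else 1)" using assms[of N] by auto
    then have "3 ^ Suc N * cantor_sum a = 2 * real_of_int (3 * j + (if a N = 0 then 0 else 1)) + cantor_sum (\<lambda>n. a (n + Suc N))"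
      using j e by (simp add: algebra_simps)
    then show ?case by blast
  qed
  then obtain j where j: "3 ^ N * cantor_sum a = 2 * real_of_int j + cantor_sum (\<lambda>n. a (n + N))" by blast
  have s: "summable (\<lambda>n. 2 * a (n + N) / (3::real) ^ Suc n)" by (rule summable_cantor[OF assms])
  have "cantor_sum (\<lambda>n. a (n + N)) = (\<Sum>n. (1/3) * (2 * a (n + Suc N) / 3 ^ Suc n)) + 2 * a N / 3"
    using suminf_split_head[OF s] by (simp add: cantor_sum_def)
  also have "(\<Sum>n. (1/3) * (2 * a (n + Suc N) / 3 ^ Suc n)) = cantor_sum (\<lambda>n. a (n + Suc N)) / 3"
    by (subst suminf_mult[OF summable_cantor[OF assms]]) (simp add: cantor_sum_def)
  finally have e: "cantor_sum (\<lambda>n. a (n + N)) = cantor_sum (\<lambda>n. a (n + Suc N)) / 3 + 2 * a N / 3" .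
  have b: "0 \<le> cantor_sum (\<lambda>n. a (n + k))" "cantor_sum (\<lambda>n. a (n + k)) \<le> 1" for k
    by (rule cantor_sum_bounds, rule assms)+
  have "plateau (3 ^ N * cantor_sum a) = plateau (cantor_sum (\<lambda>n. a (n + N)))" unfolding j plateau_periodic ..
  also have "\<dots> = max 0 (min 1 (3 * cantor_sum (\<lambda>n. a (n + N)) - 1))"
    using b[of N] by (simp add: plateau_def triangle_wave_id)
  also have "\<dots> = a N" unfolding e using b[of "Suc N"] assms[of N] by (auto simp: max_def min_def)
  finally show ?thesis .
qed

section \<open>Binary digits and curves onto the cube and the whole space\<close>

definition bdigit :: "nat \<Rightarrow> real \<Rightarrow> real" where
  "bdigit m x = real_of_int (\<lfloor>2 ^ Suc m * x\<rfloor> mod 2)"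

lemma bdigit_01: "bdigit m x \<in> {0, 1}"
  unfolding bdigit_def by (cases "\<lfloor>2 ^ Suc m * x\<rfloor>" rule: parity_cases) auto

lemma measurable_bdigit [measurable]: "bdigit m \<in> borel_measurable borel"
  unfolding bdigit_def[abs_def] by measurable

lemma bdigit_sums:
  assumes "0 \<le> x" "x < 1"
  shows "(\<lambda>m. bdigit m x / 2 ^ Suc m) sums x"
proof -
  have part: "(\<Sum>m<M. bdigit m x / 2 ^ Suc m) = real_of_int \<lfloor>2 ^ M * x\<rfloor> / 2 ^ M" for M
  proof (induction M)
    case 0
    show ?case using assms by (simp add: floor_eq_iff)
  next
    case (Suc M)
    have "\<lfloor>2 ^ M * x\<rfloor> = \<lfloor>2 ^ Suc M * x\<rfloor> div 2"
      using floor_divide_real_eq_div[of 2 "2 ^ Suc M * x"] by simp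
    then have "real_of_int \<lfloor>2 ^ Suc M * x\<rfloor> = 2 * real_of_int \<lfloor>2 ^ M * x\<rfloor> + bdigit M x"
      unfolding bdigit_def by (metis div_mult_mod_eq mult.commute of_int_add of_int_mult of_int_numeral)
    then show ?case using Suc by (simp add: field_simps)
  qed
  have "(\<lambda>M. real_of_int \<lfloor>2 ^ M * x\<rfloor> / 2 ^ M) \<longlonglongrightarrow> x"
  proof (rule real_tendsto_sandwich)
    have fl: "real_of_int \<lfloor>2 ^ M * x\<rfloor> \<le> 2 ^ M * x" "2 ^ M * x - 1 \<le> real_of_int \<lfloor>2 ^ M * x\<rfloor>" for M by linarith+
    show "\<forall>\<^sub>F M in sequentially. x - (1/2) ^ M \<le> real_of_int \<lfloor>2 ^ M * x\<rfloor> / 2 ^ M"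
    proof (intro always_eventually allI)
      fix M
      show "x - (1/2) ^ M \<le> real_of_int \<lfloor>2 ^ M * x\<rfloor> / 2 ^ M"
        using divide_right_mono[OF fl(2), of "2 ^ M" M] by (simp add: diff_divide_distrib power_divide)
    qed
    show "\<forall>\<^sub>F M in sequentially. real_of_int \<lfloor>2 ^ M * x\<rfloor> / 2 ^ M \<le> x"
      using fl(1) by (auto simp: field_simps)
    have "(\<lambda>M. x - (1/2) ^ M) \<longlonglongrightarrow> x - 0" by (intro tendsto_diff tendsto_const LIMSEQ_power_zero) auto
    then show "(\<lambda>M. x - (1/2) ^ M) \<longlonglongrightarrow> x" by simp
  qed auto
  then show ?thesis unfolding sums_def part .
qed

text \<open>Schoenberg's space-filling curve.\<close>
lemma space_filling_curve:
  obtains g :: "real \<Rightarrow> 'a::euclidean_space" and s :: "'a \<Rightarrow> real"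
  where "continuous_on UNIV g" "s \<in> borel_measurable borel" "\<And>x. 0 \<le> s x" "\<And>x. s x \<le> 1"
    "\<And>x. \<forall>i\<in>Basis. 0 \<le> x \<bullet> i \<and> x \<bullet> i < 1 \<Longrightarrow> g (s x) = x"
    "\<And>j t. g (2 * real_of_int j + t) = g t"
proof -
  define d where "d = DIM('a)"
  have d: "d > 0" by (simp add: d_def)
  obtain \<beta> :: "nat \<Rightarrow> 'a" where \<beta>: "bij_betw \<beta> {..<d} Basis"
    using ex_bij_betw_nat_finite[of "Basis :: 'a set"] by (auto simp: d_def atLeast0LessThan)
  \<comment> \<open>The binary digits of the \<open>d\<close> coordinates are interleaved into one
    ternary expansion: digit \<open>m\<close> of coordinate \<open>k\<close> sits at place
    \<open>d * m + k\<close>.\<close>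
  define C where "C k t = (\<Sum>m. plateau (3 ^ (d * m + k) * t) / 2 ^ Suc m)" for k t
  define g where "g t = (\<Sum>k<d. C k t *\<^sub>R \<beta> k)" for t
  define s where "s x = cantor_sum (\<lambda>n. bdigit (n div d) (x \<bullet> \<beta> (n mod d)))" for x
  have contC: "continuous_on UNIV (C k)" for k
  proof (rule uniform_limit_theorem[where F=sequentially])
    show "uniform_limit UNIV (\<lambda>n t. \<Sum>m<n. plateau (3 ^ (d * m + k) * t) / 2 ^ Suc m) (C k) sequentially"
      unfolding C_def[abs_def]
    proof (rule Weierstrass_m_test)
      show "summable (\<lambda>m. (1/2::real) ^ Suc m)" by (subst summable_Suc_iff) (rule summable_geometric, simp)
      show "norm (plateau (3 ^ (d * m + k) * t) / 2 ^ Suc m) \<le> (1/2) ^ Suc m" for m t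
        using plateau_bounds[of "3 ^ (d * m + k) * t"] by (simp add: power_divide divide_right_mono)
    qed
    show "\<forall>\<^sub>F n in sequentially. continuous_on UNIV (\<lambda>t. \<Sum>m<n. plateau (3 ^ (d * m + k) * t) / 2 ^ Suc m)"
      by (intro always_eventually allI continuous_intros continuous_on_compose2[OF continuous_on_plateau[of UNIV]]) auto
  qed auto
  show ?thesis
  proof
    show "continuous_on UNIV g" unfolding g_def[abs_def] by (intro continuous_intros contC)
    show "s \<in> borel_measurable borel" unfolding s_def[abs_def] cantor_sum_def by measurable
    show "0 \<le> s x" "s x \<le> 1" for x unfolding s_def by (rule cantor_sum_bounds, rule bdigit_01)+
    show "g (2 * real_of_int j + t) = g t" for j t
    proof -
      have "plateau (3 ^ n * (2 * real_of_int j + t)) = plateau (3 ^ n * t)" for n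
        using plateau_periodic[of "3 ^ n * j" "3 ^ n * t"] by (simp add: algebra_simps)
      then show ?thesis by (simp add: g_def C_def)
    qed
    fix x :: 'a assume x: "\<forall>i\<in>Basis. 0 \<le> x \<bullet> i \<and> x \<bullet> i < 1"
    have "C k (s x) = x \<bullet> \<beta> k" if k: "k < d" for k
    proof -
      have "\<beta> k \<in> Basis" using \<beta> k by (auto simp: bij_betw_def)
      then have sums: "(\<lambda>m. bdigit m (x \<bullet> \<beta> k) / 2 ^ Suc m) sums (x \<bullet> \<beta> k)" using x by (intro bdigit_sums) auto
      have "plateau (3 ^ (d * m + k) * s x) = bdigit m (x \<bullet> \<beta> k)" for m
        unfolding s_def using plateau_cantor_sum[of "\<lambda>n. bdigit (n div d) (x \<bullet> \<beta> (n mod d))" "d * m + k", OF bdigit_01] k d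
        by simp
      then show ?thesis using sums_unique[OF sums] by (simp add: C_def)
    qed
    then have "g (s x) = (\<Sum>k<d. (x \<bullet> \<beta> k) *\<^sub>R \<beta> k)" by (simp add: g_def)
    also have "\<dots> = (\<Sum>i\<in>Basis. (x \<bullet> i) *\<^sub>R i)" by (rule sum.reindex_bij_betw[OF \<beta>])
    finally show "g (s x) = x" by (simp add: euclidean_representation)
  qed
qed

text \<open>The curve in the unit cube has period 2, so on [2n, 2n+1] it can be blown up to the cube
  of half-width n: \<open>t - triangle_wave t\<close> equals 2n there and is continuous everywhere.
  A point \<open>x\<close> uses the index \<open>n x\<close>, which exceeds its norm; this puts the
  rescaled point \<open>c x\<close> strictly inside the unit cube, as the binary digits require
  coordinates below 1. The growth bound comes from \<open>n x\<close> being at most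
  \<open>norm x + 2\<close> and \<open>s\<close> at most 1.\<close>

lemma curve_onto_euclidean_space:
  obtains h :: "real \<Rightarrow> 'a::euclidean_space" and e :: "'a \<Rightarrow> real"
  where "continuous_on UNIV h" "e \<in> borel_measurable borel" "\<And>x. \<bar>e x\<bar> \<le> 2 * norm x + 5" "\<And>x. h (e x) = x"
proof -
  obtain g :: "real \<Rightarrow> 'a" and s :: "'a \<Rightarrow> real" where g: "continuous_on UNIV g" and s[measurable]: "s \<in> borel_measurable borel"
    and s01: "\<And>x. 0 \<le> s x" "\<And>x. s x \<le> 1"
    and gs: "\<And>x. \<forall>i\<in>Basis. 0 \<le> x \<bullet> i \<and> x \<bullet> i < 1 \<Longrightarrow> g (s x) = x"
    and per: "\<And>j t. g (2 * real_of_int j + t) = g t"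
    using space_filling_curve by blast
  define n where "n x = \<lceil>norm x\<rceil> + 1" for x :: 'a
  have n: "norm x < real_of_int (n x)" "real_of_int (n x) \<le> norm x + 2" for x unfolding n_def by linarith+
  have n1: "real_of_int (n x) > 0" for x using n(1)[of x] norm_ge_zero[of x] by linarith
  define c where "c x = (1/2) *\<^sub>R ((1 / real_of_int (n x)) *\<^sub>R x + One)" for x :: 'a
  define e where "e x = 2 * real_of_int (n x) + s (c x)" for x
  define h where "h t = ((t - triangle_wave t) / 2) *\<^sub>R (2 *\<^sub>R g t - One)" for t
  show ?thesis
  proof
    show "continuous_on UNIV h" unfolding h_def[abs_def] by (intro continuous_intros g continuous_on_triangle_wave) auto
    have [measurable]: "(\<lambda>x. real_of_int (n x)) \<in> borel_measurable borel" unfolding n_def by measurable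
    show "e \<in> borel_measurable borel" unfolding e_def[abs_def] c_def by measurable
    fix x :: 'a
    show "\<bar>e x\<bar> \<le> 2 * norm x + 5" using n(2)[of x] n1[of x] s01[of "c x"] by (auto simp: e_def)
    have gc: "g (s (c x)) = c x"
    proof (rule gs, rule ballI)
      fix i :: 'a assume i: "i \<in> Basis"
      have "\<bar>x \<bullet> i\<bar> < real_of_int (n x)" using Basis_le_norm[OF i, of x] n(1)[of x] by linarith
      then show "0 \<le> c x \<bullet> i \<and> c x \<bullet> i < 1" using i n1[of x] by (auto simp: c_def inner_add_left field_simps abs_less_iff)
    qed
    have "triangle_wave (e x) = s (c x)" unfolding e_def triangle_wave_periodic using s01 by (intro triangle_wave_id)
    moreover have "g (e x) = c x" unfolding e_def per by (rule gc)
    ultimately have "h (e x) = real_of_int (n x) *\<^sub>R (2 *\<^sub>R c x - One)" by (simp add: h_def e_def)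
    also have "\<dots> = x" using n1[of x] by (simp add: c_def)
    finally show "h (e x) = x" .
  qed
qed

section \<open>Weak compactness of measures with bounded second moment\<close>

lemma P2_D:
  assumes "M \<in> P2"
  shows "prob_space M" "sets M = sets borel" "space M = UNIV" "integrable M (\<lambda>x. (norm x)\<^sup>2)"
  using assms sets_eq_imp_space_eq[of M borel] by (auto simp: P2_def)

lemma P2_integrable_quadratic:
  fixes f :: "'a::euclidean_space \<Rightarrow> 'b::{banach, second_countable_topology}"
  assumes "M \<in> P2" and f: "f \<in> borel_measurable borel" and bd: "\<And>x. norm (f x) \<le> C * (1 + (norm x)\<^sup>2)"
  shows "integrable M f"
proof -
  note P = P2_D[OF assms(1)]
  interpret prob_space M by fact
  note [measurable_cong] = P(2) and [measurable] = f
  show ?thesis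
  proof (rule Bochner_Integration.integrable_bound[where f="\<lambda>x. C * (1 + (norm x)\<^sup>2)"])
    show "integrable M (\<lambda>x. C * (1 + (norm x)\<^sup>2))" using P(4) by auto
    show "AE x in M. norm (f x) \<le> norm (C * (1 + (norm x)\<^sup>2))"
      using bd by (auto intro!: AE_I2 simp del: abs_mult) (meson abs_ge_self order_trans)
  qed measurable
qed

lemma norm_le_quadratic: "norm x \<le> (1 + (norm x)\<^sup>2) / 2"
  using zero_le_power2[of "norm x - 1"] by (simp add: power2_eq_square algebra_simps)

lemma linear_growth_quadratic:
  fixes a :: real assumes "a \<le> C * (1 + norm x)"
  shows "a \<le> (2 * \<bar>C\<bar>) * (1 + (norm x)\<^sup>2)"
proof -
  have 1: "C * (1 + norm x) \<le> \<bar>C\<bar> * (1 + norm x)" by (intro mult_right_mono) auto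
  have "1 + norm x \<le> 2 * (1 + (norm x)\<^sup>2)"
    using norm_le_quadratic[of x] zero_le_power2[of "norm x"] by argo
  then have "\<bar>C\<bar> * (1 + norm x) \<le> \<bar>C\<bar> * (2 * (1 + (norm x)\<^sup>2))" by (intro mult_left_mono) auto
  with 1 show ?thesis using assms by (simp add: algebra_simps)
qed

lemma P2_integrable_linear:
  fixes f :: "'a::euclidean_space \<Rightarrow> 'b::{banach, second_countable_topology}"
  assumes "M \<in> P2" "f \<in> borel_measurable borel" "\<And>x. norm (f x) \<le> C * (1 + norm x)"
  shows "integrable M f"
  using linear_growth_quadratic[OF assms(3)] by (rule P2_integrable_quadratic[OF assms(1,2)])

text \<open>Quantitative uniform integrability: clipping at \<open>k\<close> changes
  \<open>f\<close> by at most f^2 / k, and f^2 is controlled by the second moment because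
  \<open>f\<close> has linear growth.\<close>

lemma integral_truncation_error:
  fixes f :: "'a::euclidean_space \<Rightarrow> real"
  assumes M: "M \<in> P2" and R: "(\<integral>x. (norm x)\<^sup>2 \<partial>M) \<le> R"
    and f: "f \<in> borel_measurable borel" "\<And>x. \<bar>f x\<bar> \<le> C * (1 + norm x)" and k: "k > 0"
  shows "\<bar>(\<integral>x. f x \<partial>M) - (\<integral>x. max (- k) (min k (f x)) \<partial>M)\<bar> \<le> 2 * C\<^sup>2 * (1 + R) / k"
proof -
  interpret prob_space M using P2_D[OF M] by simp
  note [measurable_cong] = P2_D(2)[OF M] and [measurable] = f(1)
  have int: "integrable M f" using f by (intro P2_integrable_linear[OF M, where C=C]) auto
  have int2: "integrable M (\<lambda>x. max (- k) (min k (f x)))"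
    by (rule Bochner_Integration.integrable_bound[OF int]) (use k in auto)
  have sq: "(1 + t)\<^sup>2 \<le> 2 * (1 + t\<^sup>2)" for t :: real
    using sum_power2_ge_zero[of "t - 1" 0] by (simp add: power2_eq_square algebra_simps)
  have bd: "\<bar>f x - max (- k) (min k (f x))\<bar> \<le> 2 * C\<^sup>2 / k * (1 + (norm x)\<^sup>2)" for x
  proof -
    have "\<bar>f x - max (- k) (min k (f x))\<bar> * k \<le> (f x)\<^sup>2"
    proof (cases "\<bar>f x\<bar> \<le> k")
      case True
      then show ?thesis using k by (auto simp: max_def min_def)
    next
      case False
      then have "\<bar>f x - max (- k) (min k (f x))\<bar> \<le> \<bar>f x\<bar>" using k by (auto simp: max_def min_def)
      then have "\<bar>f x - max (- k) (min k (f x))\<bar> * k \<le> \<bar>f x\<bar> * \<bar>f x\<bar>" using False k by (intro mult_mono) auto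
      then show ?thesis by (simp add: power2_eq_square)
    qed
    also have "\<dots> = \<bar>f x\<bar>\<^sup>2" by simp
    also have "\<dots> \<le> (C * (1 + norm x))\<^sup>2" by (intro power_mono f(2)) auto
    also have "\<dots> \<le> C\<^sup>2 * (2 * (1 + (norm x)\<^sup>2))" unfolding power_mult_distrib by (intro mult_left_mono sq) auto
    finally show ?thesis using k by (simp add: field_simps)
  qed
  have "\<bar>(\<integral>x. f x \<partial>M) - (\<integral>x. max (- k) (min k (f x)) \<partial>M)\<bar> = \<bar>\<integral>x. f x - max (- k) (min k (f x)) \<partial>M\<bar>"
    using int int2 by simp
  also have "\<dots> \<le> (\<integral>x. \<bar>f x - max (- k) (min k (f x))\<bar> \<partial>M)" by (rule integral_abs_bound)
  also have "\<dots> \<le> (\<integral>x. 2 * C\<^sup>2 / k * (1 + (norm x)\<^sup>2) \<partial>M)"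
    using int int2 P2_D(4)[OF M] bd by (intro integral_mono) auto
  also have "\<dots> = 2 * C\<^sup>2 / k * (1 + (\<integral>x. (norm x)\<^sup>2 \<partial>M))" using P2_D(4)[OF M] by (simp add: prob_space)
  also have "\<dots> \<le> 2 * C\<^sup>2 / k * (1 + R)" using R k by (intro mult_left_mono) auto
  finally show ?thesis by simp
qed

text \<open>Along the curve \<open>h\<close> with measurable section \<open>e\<close>, compactness reduces to Helly's theorem on the real line.\<close>
lemma P2_subsequence_bounded_continuous:
  fixes \<pi> :: "nat \<Rightarrow> 'a::euclidean_space measure"
  assumes P2: "\<And>n. \<pi> n \<in> P2" and R: "\<And>n. (\<integral>x. (norm x)\<^sup>2 \<partial>\<pi> n) \<le> R"
  obtains r \<pi>' where "strict_mono r" "prob_space \<pi>'" "sets \<pi>' = sets borel"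
    "\<forall>(f :: 'a \<Rightarrow> real) B. continuous_on UNIV f \<longrightarrow> (\<forall>x. \<bar>f x\<bar> \<le> B) \<longrightarrow> (\<lambda>n. \<integral>x. f x \<partial>\<pi> (r n)) \<longlonglongrightarrow> (\<integral>x. f x \<partial>\<pi>')"
proof -
  obtain h :: "real \<Rightarrow> 'a" and e :: "'a \<Rightarrow> real" where h: "continuous_on UNIV h" and e[measurable]: "e \<in> borel_measurable borel"
    and e_le: "\<And>x. \<bar>e x\<bar> \<le> 2 * norm x + 5" and he: "\<And>x. h (e x) = x"
    using curve_onto_euclidean_space by blast
  have [measurable]: "h \<in> borel_measurable borel" by (rule borel_measurable_continuous_onI[OF h])
  note P = P2_D[OF P2] and [measurable_cong] = P2_D(2)[OF P2]
  define \<mu> where "\<mu> n = distr (\<pi> n) borel e" for n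
  have rd: "real_distribution (\<mu> n)" for n
  proof -
    interpret prob_space "\<pi> n" by (rule P(1))
    show ?thesis unfolding \<mu>_def by (rule real_distribution_distr) simp
  qed
  have R0: "R \<ge> 0" by (rule order_trans[OF Bochner_Integration.integral_nonneg R[of 0]]) simp
  have "tight \<mu>" unfolding tight_def
  proof (intro conjI allI impI, rule rd)
    fix \<epsilon> :: real assume \<epsilon>: "\<epsilon> > 0"
    \<comment> \<open>Chosen so that \<open>K\<close> is at least 1 and R / K^2 <= R / K <
      \<open>\<epsilon>\<close>, as Markov's inequality for the second moment requires.\<close>
    define K where "K = (R + 1) / \<epsilon> + 1"
    have K: "K \<ge> 1" using divide_nonneg_pos[OF _ \<epsilon>, of "R + 1"] R0 by (simp add: K_def)
    have "R / \<epsilon> < K" using \<epsilon> by (simp add: K_def add_divide_distrib add_pos_pos)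
    also have "K \<le> K\<^sup>2" using K by (simp add: power2_eq_square)
    finally have "R < K\<^sup>2 * \<epsilon>" using \<epsilon> by (simp add: pos_divide_less_eq)
    then have RK: "R / K\<^sup>2 < \<epsilon>" using K by (simp add: pos_divide_less_eq mult.commute)
    show "\<exists>a b. a < b \<and> (\<forall>n. 1 - \<epsilon> < measure (\<mu> n) {a<..b})"
    proof (rule exI[of _ "- (2 * K + 6)"], rule exI[of _ "2 * K + 6"], intro conjI allI)
      fix n
      interpret prob_space "\<pi> n" by (rule P(1))
      have "measure (\<pi> n) {x\<in>space (\<pi> n). K\<^sup>2 \<le> (norm x)\<^sup>2} \<le> (\<integral>x. (norm x)\<^sup>2 \<partial>\<pi> n) / K\<^sup>2"
        by (rule integral_Markov_inequality_measure[where A="space (\<pi> n)"]) (use K P(4) in auto)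
      also have "\<dots> \<le> R / K\<^sup>2" by (intro divide_right_mono R) auto
      finally have m: "measure (\<pi> n) {x. K\<^sup>2 \<le> (norm x)\<^sup>2} < \<epsilon>" using RK P(3) by simp
      have "- {x. K\<^sup>2 \<le> (norm x)\<^sup>2} \<subseteq> e -` {- (2 * K + 6)<..2 * K + 6}"
      proof (rule subsetI)
        fix x :: 'a assume "x \<in> - {x. K\<^sup>2 \<le> (norm x)\<^sup>2}"
        then have "\<not> K\<^sup>2 \<le> (norm x)\<^sup>2" by simp
        then have "norm x < K" using K power_mono[of K "norm x" 2] by linarith
        then show "x \<in> e -` {- (2 * K + 6)<..2 * K + 6}" using e_le[of x] by auto
      qed
      then have "measure (\<pi> n) (- {x. K\<^sup>2 \<le> (norm x)\<^sup>2}) \<le> measure (\<pi> n) (e -` {- (2 * K + 6)<..2 * K + 6})"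
        by (rule finite_measure_mono) (simp add: P(2) measurable_sets_borel[OF e])
      moreover have "measure (\<pi> n) (- {x. K\<^sup>2 \<le> (norm x)\<^sup>2}) = 1 - measure (\<pi> n) {x. K\<^sup>2 \<le> (norm x)\<^sup>2}"
        using prob_compl[of "{x. K\<^sup>2 \<le> (norm x)\<^sup>2}"] P(3) by (simp add: Compl_eq_Diff_UNIV)
      ultimately show "1 - \<epsilon> < measure (\<mu> n) {- (2 * K + 6)<..2 * K + 6}"
        using m by (simp add: \<mu>_def measure_distr P(3))
    qed (use K in auto)
  qed
  then obtain r M where r: "strict_mono r" and M: "real_distribution M" and wc: "weak_conv_m (\<mu> \<circ> id \<circ> r) M"
    using tight_imp_convergent_subsubsequence[of \<mu> id] by (auto simp: strict_mono_def)
  interpret M: real_distribution M by fact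
  show ?thesis
  \<comment> \<open>Since \<open>h (e x) = x\<close>, an integral of \<open>f\<close> over
    \<open>\<pi> n\<close> is the integral of \<open>f\<close> composed with \<open>h\<close> over
    \<open>\<mu> n\<close>. So the test function on the line is continuous although \<open>e\<close>
    need not be.\<close>
  proof (rule that[OF r, of "distr M borel h"])
    show "prob_space (distr M borel h)" by (rule M.prob_space_distr) simp
    show "\<forall>(f :: 'a \<Rightarrow> real) B. continuous_on UNIV f \<longrightarrow> (\<forall>x. \<bar>f x\<bar> \<le> B) \<longrightarrow>
        (\<lambda>n. \<integral>x. f x \<partial>\<pi> (r n)) \<longlonglongrightarrow> (\<integral>x. f x \<partial>distr M borel h)"
    proof (intro allI impI)
      fix f :: "'a \<Rightarrow> real" and B assume f: "continuous_on UNIV f" and B: "\<forall>x. \<bar>f x\<bar> \<le> B"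
      have [measurable]: "f \<in> borel_measurable borel" by (rule borel_measurable_continuous_onI[OF f])
      have "(\<lambda>n. integral\<^sup>L ((\<mu> \<circ> id \<circ> r) n) (\<lambda>t. f (h t))) \<longlonglongrightarrow> integral\<^sup>L M (\<lambda>t. f (h t))"
      proof (rule weak_conv_imp_integral_bdd_continuous_conv[OF _ M wc])
        have "continuous_on UNIV (\<lambda>t. f (h t))" by (rule continuous_on_compose2[OF f h]) auto
        then show "isCont (\<lambda>t. f (h t)) x" for x by (simp add: continuous_on_eq_continuous_at)
      qed (use rd B in auto)
      then show "(\<lambda>n. \<integral>x. f x \<partial>\<pi> (r n)) \<longlonglongrightarrow> (\<integral>x. f x \<partial>distr M borel h)"
        by (simp add: \<mu>_def integral_distr he)
    qed
  qed simp
qed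

text \<open>The first limit property is lower semicontinuity of the second moment, phrased through
  eventual bounds; it is Fatou's lemma for the truncations min(k, |x|^2). The second extends weak
  convergence to linear growth, by clipping with an error that is uniform along the
  sequence.\<close>

lemma P2_subsequence:
  fixes \<pi> :: "nat \<Rightarrow> 'a::euclidean_space measure"
  assumes P2: "\<And>n. \<pi> n \<in> P2" and R: "\<And>n. (\<integral>x. (norm x)\<^sup>2 \<partial>\<pi> n) \<le> R"
  obtains r \<pi>' where "strict_mono r" "\<pi>' \<in> P2"
    "\<forall>S. (\<forall>\<^sub>F n in sequentially. (\<integral>x. (norm x)\<^sup>2 \<partial>\<pi> (r n)) \<le> S) \<longrightarrow> (\<integral>x. (norm x)\<^sup>2 \<partial>\<pi>') \<le> S"
    "\<forall>(f :: 'a \<Rightarrow> real) C. continuous_on UNIV f \<longrightarrow> (\<forall>x. \<bar>f x\<bar> \<le> C * (1 + norm x)) \<longrightarrow> (\<lambda>n. \<integral>x. f x \<partial>\<pi> (r n)) \<longlonglongrightarrow> (\<integral>x. f x \<partial>\<pi>')"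
proof -
  obtain r \<pi>' where r: "strict_mono r" and pr: "prob_space \<pi>'" and b[measurable_cong]: "sets \<pi>' = sets borel"
    and lim: "\<forall>(f :: 'a \<Rightarrow> real) B. continuous_on UNIV f \<longrightarrow> (\<forall>x. \<bar>f x\<bar> \<le> B) \<longrightarrow> (\<lambda>n. \<integral>x. f x \<partial>\<pi> (r n)) \<longlonglongrightarrow> (\<integral>x. f x \<partial>\<pi>')"
    using P2_subsequence_bounded_continuous[where \<pi>=\<pi>, OF assms] by auto
  interpret prob_space \<pi>' by fact
  have moment: "integrable \<pi>' (\<lambda>x. (norm x)\<^sup>2) \<and> (\<integral>x. (norm x)\<^sup>2 \<partial>\<pi>') \<le> S"
    if S: "\<forall>\<^sub>F n in sequentially. (\<integral>x. (norm x)\<^sup>2 \<partial>\<pi> (r n)) \<le> S" for S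
  proof -
    have "(\<integral>x. min (real k) ((norm x)\<^sup>2) \<partial>\<pi>') \<le> S" for k
    proof (rule tendsto_upperbound)
      show "(\<lambda>n. \<integral>x. min (real k) ((norm x)\<^sup>2) \<partial>\<pi> (r n)) \<longlonglongrightarrow> (\<integral>x. min (real k) ((norm x)\<^sup>2) \<partial>\<pi>')"
        by (rule lim[rule_format, where B="real k"]) (auto intro!: continuous_intros)
      show "\<forall>\<^sub>F n in sequentially. (\<integral>x. min (real k) ((norm x)\<^sup>2) \<partial>\<pi> (r n)) \<le> S"
        using S
      proof eventually_elim
        case (elim n)
        note [measurable_cong] = P2_D(2)[OF P2[of "r n"]]
        have "(\<integral>x. min (real k) ((norm x)\<^sup>2) \<partial>\<pi> (r n)) \<le> (\<integral>x. (norm x)\<^sup>2 \<partial>\<pi> (r n))"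
          using P2_D(4)[OF P2[of "r n"]]
          by (intro integral_mono Bochner_Integration.integrable_bound[OF P2_D(4)[OF P2[of "r n"]]]) auto
        then show ?case using elim by simp
      qed
    qed simp
    moreover have "integrable \<pi>' (\<lambda>x. min (real k) ((norm x)\<^sup>2))" for k
      by (rule integrable_const_bound[where B="real k"]) auto
    ultimately have le: "(\<integral>\<^sup>+x. ennreal (min (real k) ((norm x)\<^sup>2)) \<partial>\<pi>') \<le> ennreal S" for k
      by (subst nn_integral_eq_integral) (auto intro: ennreal_leI)
    have "(\<integral>\<^sup>+x. ennreal ((norm x)\<^sup>2) \<partial>\<pi>') = (\<integral>\<^sup>+x. liminf (\<lambda>k. ennreal (min (real k) ((norm x)\<^sup>2))) \<partial>\<pi>')"
    proof (intro nn_integral_cong)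
      fix x :: 'a
      obtain k0 where k0: "(norm x)\<^sup>2 \<le> real k0" using real_arch_simple by blast
      have "\<forall>\<^sub>F k in sequentially. ennreal (min (real k) ((norm x)\<^sup>2)) = ennreal ((norm x)\<^sup>2)"
        by (rule eventually_mono[OF eventually_ge_at_top[of k0]]) (use k0 in \<open>auto simp: min_def\<close>)
      then have "(\<lambda>k. ennreal (min (real k) ((norm x)\<^sup>2))) \<longlonglongrightarrow> ennreal ((norm x)\<^sup>2)" by (rule tendsto_eventually)
      then show "ennreal ((norm x)\<^sup>2) = liminf (\<lambda>k. ennreal (min (real k) ((norm x)\<^sup>2)))"
        by (rule lim_imp_Liminf[OF trivial_limit_sequentially, symmetric])
    qed
    also have "\<dots> \<le> liminf (\<lambda>k. \<integral>\<^sup>+x. ennreal (min (real k) ((norm x)\<^sup>2)) \<partial>\<pi>')"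
      by (rule nn_integral_liminf) measurable
    also have "\<dots> \<le> ennreal S" by (rule Liminf_le) (use le in auto)
    finally have nn: "(\<integral>\<^sup>+x. ennreal ((norm x)\<^sup>2) \<partial>\<pi>') \<le> ennreal S" .
    have int: "integrable \<pi>' (\<lambda>x. (norm x)\<^sup>2)"
      by (rule integrableI_bounded) (use nn in \<open>auto simp: le_less_trans[OF _ ennreal_less_top]\<close>)
    \<comment> \<open>The sign of \<open>S\<close> matters for returning to the reals, since
      \<open>ennreal\<close> sends negative numbers to 0.\<close>
    obtain n where "(\<integral>x. (norm x)\<^sup>2 \<partial>\<pi> (r n)) \<le> S" using S eventually_happens'[OF sequentially_bot] by blast
    then have "S \<ge> 0" by (meson Bochner_Integration.integral_nonneg order_trans zero_le_power2)
    then show ?thesis using int nn by (simp add: nn_integral_eq_integral)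
  qed
  have P2': "\<pi>' \<in> P2" using moment[of R] R pr b by (auto simp: P2_def)
  show ?thesis
  proof (rule that[OF r P2'])
    show "\<forall>(f :: 'a \<Rightarrow> real) C. continuous_on UNIV f \<longrightarrow> (\<forall>x. \<bar>f x\<bar> \<le> C * (1 + norm x)) \<longrightarrow>
        (\<lambda>n. \<integral>x. f x \<partial>\<pi> (r n)) \<longlonglongrightarrow> (\<integral>x. f x \<partial>\<pi>')"
    proof (intro allI impI)
      fix f :: "'a \<Rightarrow> real" and C assume f: "continuous_on UNIV f" and C': "\<forall>x. \<bar>f x\<bar> \<le> C * (1 + norm x)"
      have C: "\<bar>f x\<bar> \<le> C * (1 + norm x)" for x using C' by blast
      have fm: "f \<in> borel_measurable borel" by (rule borel_measurable_continuous_onI[OF f])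
      have R': "(\<integral>x. (norm x)\<^sup>2 \<partial>\<pi>') \<le> R" using moment[of R] R by auto
      have R0: "R \<ge> 0" using R' by (meson Bochner_Integration.integral_nonneg order_trans zero_le_power2)
      show "(\<lambda>n. \<integral>x. f x \<partial>\<pi> (r n)) \<longlonglongrightarrow> (\<integral>x. f x \<partial>\<pi>')"
      proof (rule LIMSEQ_I)
        fix \<epsilon> :: real assume \<epsilon>: "\<epsilon> > 0"
        define k where "k = 2 * C\<^sup>2 * (1 + R) * 3 / \<epsilon> + 1"
        have k: "k > 0" using \<epsilon> R0 by (auto simp: k_def intro!: add_nonneg_pos)
        have "2 * C\<^sup>2 * (1 + R) * 3 / \<epsilon> < k" by (simp add: k_def)
        then have err: "2 * C\<^sup>2 * (1 + R) / k < \<epsilon> / 3" using \<epsilon> k by (simp add: field_simps)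
        let ?g = "\<lambda>x. max (- k) (min k (f x))"
        have "(\<lambda>n. \<integral>x. ?g x \<partial>\<pi> (r n)) \<longlonglongrightarrow> (\<integral>x. ?g x \<partial>\<pi>')"
          by (rule lim[rule_format, where B=k]) (use k in \<open>auto intro!: continuous_intros f\<close>)
        from LIMSEQ_D[OF this, of "\<epsilon> / 3"] \<epsilon> obtain N where
          N: "\<And>n. n \<ge> N \<Longrightarrow> \<bar>(\<integral>x. ?g x \<partial>\<pi> (r n)) - (\<integral>x. ?g x \<partial>\<pi>')\<bar> < \<epsilon> / 3" by auto
        have "\<bar>(\<integral>x. f x \<partial>\<pi> (r n)) - (\<integral>x. f x \<partial>\<pi>')\<bar> < \<epsilon>" if "n \<ge> N" for n
          using N[OF that] integral_truncation_error[OF P2[of "r n"] R fm C k] integral_truncation_error[OF P2' R' fm C k] err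
          by linarith
        then show "\<exists>N. \<forall>n\<ge>N. norm ((\<integral>x. f x \<partial>\<pi> (r n)) - (\<integral>x. f x \<partial>\<pi>')) < \<epsilon>" by auto
      qed
    qed
  qed (use moment in auto)
qed

section \<open>Existence for moment problems by penalization\<close>

lemma return_in_P2: "return borel (w::'a::euclidean_space) \<in> P2"
proof -
  have "integrable (return borel w) (\<lambda>x. (norm x)\<^sup>2)"
    by (rule integrableI_bounded) (auto simp: nn_integral_return)
  then show ?thesis by (auto simp: P2_def intro: prob_space_return)
qed

text \<open>The mixture of \<open>M\<close> with weight 1 - t and the point mass at \<open>w\<close>
  with weight t, realized as the law of a choice by an independent coin so that its integrals come
  from Fubini.\<close>

definition mix_point :: "real \<Rightarrow> 'a::euclidean_space measure \<Rightarrow> 'a \<Rightarrow> 'a measure" where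
  "mix_point t M w = distr (measure_pmf (bernoulli_pmf t) \<Otimes>\<^sub>M M) borel (\<lambda>(b, x). if b then w else x)"

lemma mix_point:
  assumes M: "M \<in> P2" and t: "0 \<le> t" "t \<le> 1"
  shows mix_point_P2: "mix_point t M w \<in> P2"
    and integral_mix_point: "\<And>f :: 'a::euclidean_space \<Rightarrow> real. f \<in> borel_measurable borel \<Longrightarrow> integrable M f \<Longrightarrow>
      (\<integral>x. f x \<partial>mix_point t M w) = (1 - t) * (\<integral>x. f x \<partial>M) + t * f w"
proof -
  note P = P2_D[OF M] and [measurable_cong] = P2_D(2)[OF M]
  let ?B = "measure_pmf (bernoulli_pmf t)"
  interpret M: prob_space M by (rule P)
  interpret pair_prob_space ?B M ..
  have [measurable]: "(\<lambda>(b, x). if b then w else x) \<in> borel_measurable (?B \<Otimes>\<^sub>M M)" by measurable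
  have fub: "integrable (?B \<Otimes>\<^sub>M M) (\<lambda>(b, x). f (if b then w else x)) \<and>
     (\<integral>p. (case p of (b, x) \<Rightarrow> f (if b then w else x)) \<partial>(?B \<Otimes>\<^sub>M M)) = (1 - t) * (\<integral>x. f x \<partial>M) + t * f w"
    if [measurable]: "f \<in> borel_measurable borel" and int: "integrable M f" for f :: "'a \<Rightarrow> real"
  proof
    show i: "integrable (?B \<Otimes>\<^sub>M M) (\<lambda>(b, x). f (if b then w else x))"
    proof (rule Fubini_integrable)
      show "integrable ?B (\<lambda>b. \<integral>x. norm (case (b, x) of (b, x) \<Rightarrow> f (if b then w else x)) \<partial>M)"
        by (rule integrable_measure_pmf_finite) auto
      show "AE b in ?B. integrable M (\<lambda>x. case (b, x) of (b, x) \<Rightarrow> f (if b then w else x))"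
      proof (rule AE_I2)
        show "integrable M (\<lambda>x. case (b, x) of (b, x) \<Rightarrow> f (if b then w else x))" for b
          using int by (cases b) auto
      qed
    qed measurable
    have "(\<integral>p. (case p of (b, x) \<Rightarrow> f (if b then w else x)) \<partial>(?B \<Otimes>\<^sub>M M)) = (\<integral>b. (\<integral>x. f (if b then w else x) \<partial>M) \<partial>?B)"
      using integral_fst'[OF i] by simp
    also have "\<dots> = (1 - t) * (\<integral>x. f x \<partial>M) + t * f w"
      using t by (simp add: M.prob_space)
    finally show "(\<integral>p. (case p of (b, x) \<Rightarrow> f (if b then w else x)) \<partial>(?B \<Otimes>\<^sub>M M)) = (1 - t) * (\<integral>x. f x \<partial>M) + t * f w" .
  qed
  have d: "integrable (mix_point t M w) f \<longleftrightarrow> integrable (?B \<Otimes>\<^sub>M M) (\<lambda>(b, x). f (if b then w else x))"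
      "(\<integral>x. f x \<partial>mix_point t M w) = (\<integral>p. (case p of (b, x) \<Rightarrow> f (if b then w else x)) \<partial>(?B \<Otimes>\<^sub>M M))"
    if [measurable]: "f \<in> borel_measurable borel" for f :: "'a \<Rightarrow> real"
    unfolding mix_point_def by (simp_all add: integrable_distr_eq integral_distr case_prod_beta')
  have "prob_space (mix_point t M w)" unfolding mix_point_def by (rule prob_space_distr) simp
  then show "mix_point t M w \<in> P2" using fub[of "\<lambda>x. (norm x)\<^sup>2"] d(1)[of "\<lambda>x. (norm x)\<^sup>2"] P(4)
    by (auto simp: P2_def mix_point_def)
  show "(\<integral>x. f x \<partial>mix_point t M w) = (1 - t) * (\<integral>x. f x \<partial>M) + t * f w"
    if "f \<in> borel_measurable borel" "integrable M f" for f :: "'a \<Rightarrow> real"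
    using fub[OF that] d(2)[OF that(1)] by simp
qed

lemma nonneg_of_small_perturbation:
  fixes A B :: real
  assumes "\<And>t. 0 < t \<Longrightarrow> t < 1 \<Longrightarrow> 0 \<le> A + t * B"
  shows "0 \<le> A"
proof (rule tendsto_lowerbound)
  show "((\<lambda>t. A + t * B) \<longlongrightarrow> A) (at_right 0)"
    by (rule tendsto_eq_intros refl | simp)+
  show "\<forall>\<^sub>F t in at_right 0. 0 \<le> A + t * B"
    by (rule eventually_at_rightI[of 0 1]) (use assms in auto)
qed simp

text \<open>The index \<open>N\<close> is both the number of constraints considered and the weight
  of the penalty, so a single limit enforces all constraints.\<close>

definition penalized :: "(nat \<Rightarrow> 'a::euclidean_space \<Rightarrow> real) \<Rightarrow> nat \<Rightarrow> 'a measure \<Rightarrow> real" where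
  "penalized h N M = (\<integral>x. (norm x)\<^sup>2 \<partial>M) + real N * (\<Sum>k<N. (\<integral>x. h k x \<partial>M)\<^sup>2)"

text \<open>The direct method. Along a minimizing subsequence the penalty converges because the
  \<open>h k\<close> have linear growth; hence the second moments converge as well, and lower
  semicontinuity gives the limit measure a value of at most \<open>I\<close>.\<close>

lemma penalized_minimizer:
  fixes h :: "nat \<Rightarrow> 'a::euclidean_space \<Rightarrow> real"
  assumes h: "\<And>k. continuous_on UNIV (h k)" and C: "\<And>k x. \<bar>h k x\<bar> \<le> C k * (1 + norm x)"
  obtains M where "M \<in> P2" "\<And>M'. M' \<in> P2 \<Longrightarrow> penalized h N M \<le> penalized h N M'"
proof -
  let ?G = "penalized h N"
  have nonneg: "0 \<le> ?G M" for M unfolding penalized_def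
    by (intro add_nonneg_nonneg mult_nonneg_nonneg sum_nonneg Bochner_Integration.integral_nonneg) auto
  have bdd: "bdd_below (?G ` P2)" using nonneg by (intro bdd_belowI[of _ 0]) auto
  define I where "I = (INF M\<in>P2. ?G M)"
  have I_le: "I \<le> ?G M" if "M \<in> P2" for M unfolding I_def by (rule cINF_lower[OF bdd that])
  have "\<exists>M\<in>P2. ?G M < I + 1 / real (Suc n)" for n
  proof -
    have "I < I + 1 / real (Suc n)" by simp
    then show ?thesis using cINF_less_iff[OF _ bdd] return_in_P2 unfolding I_def by blast
  qed
  then obtain \<pi> where \<pi>: "\<And>n. \<pi> n \<in> P2" "\<And>n. ?G (\<pi> n) < I + 1 / real (Suc n)" by metis
  have "(\<integral>x. (norm x)\<^sup>2 \<partial>\<pi> n) \<le> I + 1" for n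
  proof -
    have "(\<integral>x. (norm x)\<^sup>2 \<partial>\<pi> n) \<le> ?G (\<pi> n)" by (auto simp: penalized_def intro!: mult_nonneg_nonneg sum_nonneg)
    also have "\<dots> \<le> I + 1 / real (Suc n)" using \<pi>(2)[of n] by simp
    also have "\<dots> \<le> I + 1" by simp
    finally show ?thesis .
  qed
  then obtain r \<pi>' where r: "strict_mono r" and \<pi>': "\<pi>' \<in> P2"
    and lsc: "\<forall>S. (\<forall>\<^sub>F n in sequentially. (\<integral>x. (norm x)\<^sup>2 \<partial>\<pi> (r n)) \<le> S) \<longrightarrow> (\<integral>x. (norm x)\<^sup>2 \<partial>\<pi>') \<le> S"
    and lim: "\<forall>(f :: 'a \<Rightarrow> real) C. continuous_on UNIV f \<longrightarrow> (\<forall>x. \<bar>f x\<bar> \<le> C * (1 + norm x)) \<longrightarrow>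
        (\<lambda>n. \<integral>x. f x \<partial>\<pi> (r n)) \<longlonglongrightarrow> (\<integral>x. f x \<partial>\<pi>')"
    using P2_subsequence[of \<pi>, OF \<pi>(1)] by metis
  define Q where "Q M = real N * (\<Sum>k<N. (\<integral>x. h k x \<partial>M)\<^sup>2)" for M
  have hlim: "(\<lambda>n. \<integral>x. h k x \<partial>\<pi> (r n)) \<longlonglongrightarrow> (\<integral>x. h k x \<partial>\<pi>')" for k using lim h C by blast
  have Q: "(\<lambda>n. Q (\<pi> (r n))) \<longlonglongrightarrow> Q \<pi>'" unfolding Q_def by (intro tendsto_intros hlim)
  have "(\<lambda>n. ?G (\<pi> n)) \<longlonglongrightarrow> I"
  proof (rule real_tendsto_sandwich)
    show "\<forall>\<^sub>F n in sequentially. I \<le> ?G (\<pi> n)" using I_le \<pi>(1) by simp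
    show "\<forall>\<^sub>F n in sequentially. ?G (\<pi> n) \<le> I + 1 / real (Suc n)" using \<pi>(2) by (auto simp: less_imp_le)
    have "(\<lambda>n. I + 1 / real (Suc n)) \<longlonglongrightarrow> I + 0" by (intro tendsto_add tendsto_const LIMSEQ_Suc[OF lim_1_over_n])
    then show "(\<lambda>n. I + 1 / real (Suc n)) \<longlonglongrightarrow> I" by simp
  qed simp
  then have "(\<lambda>n. ?G (\<pi> (r n)) - Q (\<pi> (r n))) \<longlonglongrightarrow> I - Q \<pi>'"
    by (intro tendsto_diff Q) (use LIMSEQ_subseq_LIMSEQ[OF _ r] in \<open>auto simp: o_def\<close>)
  then have mlim: "(\<lambda>n. \<integral>x. (norm x)\<^sup>2 \<partial>\<pi> (r n)) \<longlonglongrightarrow> I - Q \<pi>'" by (simp add: penalized_def Q_def)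
  have "(\<integral>x. (norm x)\<^sup>2 \<partial>\<pi>') \<le> I - Q \<pi>'"
  proof (rule field_le_epsilon)
    fix e :: real assume "e > 0"
    then have "\<forall>\<^sub>F n in sequentially. (\<integral>x. (norm x)\<^sup>2 \<partial>\<pi> (r n)) < I - Q \<pi>' + e" by (intro order_tendstoD(2)[OF mlim]) simp
    then have "\<forall>\<^sub>F n in sequentially. (\<integral>x. (norm x)\<^sup>2 \<partial>\<pi> (r n)) \<le> I - Q \<pi>' + e" by (rule eventually_mono) simp
    then show "(\<integral>x. (norm x)\<^sup>2 \<partial>\<pi>') \<le> I - Q \<pi>' + e" using lsc by blast
  qed
  then have "?G \<pi>' \<le> I" by (simp add: penalized_def Q_def)
  then show ?thesis using that[OF \<pi>'] I_le by force
qed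

text \<open>The multipliers are read off the first-order condition of the penalized problem, tested against point masses.\<close>
lemma penalized_minimizer_bound:
  fixes h :: "nat \<Rightarrow> 'a::euclidean_space \<Rightarrow> real"
  assumes h: "\<And>k. continuous_on UNIV (h k)" and C: "\<And>k x. \<bar>h k x\<bar> \<le> C k * (1 + norm x)"
    and dual: "\<And>n a m. (\<And>x. m \<le> (norm x)\<^sup>2 + (\<Sum>k<n. a k * h k x)) \<Longrightarrow> m \<le> D"
    and M: "M \<in> P2" and min: "\<And>M'. M' \<in> P2 \<Longrightarrow> penalized h N M \<le> penalized h N M'"
  shows "(\<integral>x. (norm x)\<^sup>2 \<partial>M) + 2 * real N * (\<Sum>k<N. (\<integral>x. h k x \<partial>M)\<^sup>2) \<le> D"
proof (rule dual[where n=N])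
  fix w :: 'a
  define c where "c k = (\<integral>x. h k x \<partial>M)" for k
  define m where "m = (\<integral>x. (norm x)\<^sup>2 \<partial>M)"
  have hm: "h k \<in> borel_measurable borel" for k by (rule borel_measurable_continuous_onI[OF h])
  have hi: "integrable M (h k)" for k using C by (intro P2_integrable_linear[OF M hm, where C="C k"]) auto
  have "0 \<le> ((norm w)\<^sup>2 - m + 2 * real N * (\<Sum>k<N. c k * (h k w - c k))) + t * (real N * (\<Sum>k<N. (h k w - c k)\<^sup>2))"
    if t: "0 < t" "t < 1" for t
  proof -
    have "penalized h N M \<le> penalized h N (mix_point t M w)"
      using t by (intro min mix_point_P2[OF M]) auto
    also have "\<dots> = (1 - t) * m + t * (norm w)\<^sup>2 + real N * (\<Sum>k<N. ((1 - t) * c k + t * h k w)\<^sup>2)"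
      using t by (simp add: penalized_def integral_mix_point[OF M] hm hi P2_D(4)[OF M] c_def m_def)
    also have "(\<Sum>k<N. ((1 - t) * c k + t * h k w)\<^sup>2) =
        (\<Sum>k<N. (c k)\<^sup>2 + 2 * t * (c k * (h k w - c k)) + t\<^sup>2 * (h k w - c k)\<^sup>2)"
      by (intro sum.cong refl) (simp add: power2_eq_square algebra_simps)
    also have "\<dots> = (\<Sum>k<N. (c k)\<^sup>2) + 2 * t * (\<Sum>k<N. c k * (h k w - c k)) + t\<^sup>2 * (\<Sum>k<N. (h k w - c k)\<^sup>2)"
      by (simp add: sum.distrib sum_distrib_left)
    finally have "m + real N * (\<Sum>k<N. (c k)\<^sup>2) \<le> (1 - t) * m + t * (norm w)\<^sup>2 + real N *
        ((\<Sum>k<N. (c k)\<^sup>2) + 2 * t * (\<Sum>k<N. c k * (h k w - c k)) + t\<^sup>2 * (\<Sum>k<N. (h k w - c k)\<^sup>2))"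
      by (simp only: penalized_def c_def m_def)
    then have "0 \<le> t * (((norm w)\<^sup>2 - m + 2 * real N * (\<Sum>k<N. c k * (h k w - c k))) + t * (real N * (\<Sum>k<N. (h k w - c k)\<^sup>2)))"
      unfolding power2_eq_square[of t] by argo
    then show ?thesis using t by (simp add: zero_le_mult_iff)
  qed
  \<comment> \<open>This is the linear coefficient in \<open>t\<close>. The multipliers are
    \<open>2 * real N * c k\<close>; moving the squares of \<open>c k\<close> to the other side
    produces the factor 2 before the penalty in the bound.\<close>
  then have "0 \<le> (norm w)\<^sup>2 - m + 2 * real N * (\<Sum>k<N. c k * (h k w - c k))" by (rule nonneg_of_small_perturbation)
  also have "(\<Sum>k<N. c k * (h k w - c k)) = (\<Sum>k<N. c k * h k w) - (\<Sum>k<N. (c k)\<^sup>2)"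
    by (simp add: right_diff_distrib sum_subtractf power2_eq_square)
  finally show "(\<integral>x. (norm x)\<^sup>2 \<partial>M) + 2 * real N * (\<Sum>k<N. (\<integral>x. h k x \<partial>M)\<^sup>2)
     \<le> (norm w)\<^sup>2 + (\<Sum>k<N. (2 * real N * c k) * h k w)"
    by (simp add: c_def[symmetric] m_def[symmetric] sum_distrib_left algebra_simps)
qed

text \<open>The hypothesis \<open>dual\<close> says that no finite combination of constraints
  certifies a lower bound above \<open>D\<close>. Applied to the multipliers of penalized minimizers
  it bounds their second moments by \<open>D\<close> and each squared residual with k < N by D /
  (2N), so a weak limit meets every constraint.\<close>

theorem moment_problem:
  fixes h :: "nat \<Rightarrow> 'a::euclidean_space \<Rightarrow> real"
  assumes h: "\<And>k. continuous_on UNIV (h k)" and C: "\<And>k x. \<bar>h k x\<bar> \<le> C k * (1 + norm x)"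
    and dual: "\<And>n a m. (\<And>x. m \<le> (norm x)\<^sup>2 + (\<Sum>k<n. a k * h k x)) \<Longrightarrow> m \<le> D"
  shows "\<exists>M\<in>P2. (\<forall>k. (\<integral>x. h k x \<partial>M) = 0) \<and> (\<integral>x. (norm x)\<^sup>2 \<partial>M) \<le> D"
proof -
  have "\<exists>M\<in>P2. (\<integral>x. (norm x)\<^sup>2 \<partial>M) + 2 * real N * (\<Sum>k<N. (\<integral>x. h k x \<partial>M)\<^sup>2) \<le> D" for N
  proof -
    obtain M where M: "M \<in> P2" and min: "\<And>M'. M' \<in> P2 \<Longrightarrow> penalized h N M \<le> penalized h N M'"
      using penalized_minimizer[where h=h and N=N, OF h C] by blast
    show ?thesis by (rule bexI[OF _ M], rule penalized_minimizer_bound[OF h C _ M min]) (rule dual)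
  qed
  then obtain \<pi> where \<pi>: "\<And>N. \<pi> N \<in> P2"
    and bound: "\<And>N. (\<integral>x. (norm x)\<^sup>2 \<partial>\<pi> N) + 2 * real N * (\<Sum>k<N. (\<integral>x. h k x \<partial>\<pi> N)\<^sup>2) \<le> D" by metis
  have "(\<integral>x. (norm x)\<^sup>2 \<partial>\<pi> N) \<le> D" for N
  proof -
    have "0 \<le> 2 * real N * (\<Sum>k<N. (\<integral>x. h k x \<partial>\<pi> N)\<^sup>2)" by (intro mult_nonneg_nonneg sum_nonneg) auto
    then show ?thesis using bound[of N] by linarith
  qed
  then obtain r \<pi>' where r: "strict_mono r" and \<pi>': "\<pi>' \<in> P2"
    and lsc: "\<forall>S. (\<forall>\<^sub>F n in sequentially. (\<integral>x. (norm x)\<^sup>2 \<partial>\<pi> (r n)) \<le> S) \<longrightarrow> (\<integral>x. (norm x)\<^sup>2 \<partial>\<pi>') \<le> S"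
    and lim: "\<forall>(f :: 'a \<Rightarrow> real) C. continuous_on UNIV f \<longrightarrow> (\<forall>x. \<bar>f x\<bar> \<le> C * (1 + norm x)) \<longrightarrow>
        (\<lambda>n. \<integral>x. f x \<partial>\<pi> (r n)) \<longlonglongrightarrow> (\<integral>x. f x \<partial>\<pi>')"
    and le: "\<And>N. (\<integral>x. (norm x)\<^sup>2 \<partial>\<pi> N) \<le> D"
    using P2_subsequence[of \<pi>, OF \<pi>] by metis
  show ?thesis
  proof (intro bexI[OF _ \<pi>'] conjI allI)
    show "(\<integral>x. (norm x)\<^sup>2 \<partial>\<pi>') \<le> D" using lsc le by auto
    fix k
    have "(\<lambda>N. (\<integral>x. h k x \<partial>\<pi> N)\<^sup>2) \<longlonglongrightarrow> 0"
    proof (rule real_tendsto_sandwich)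
      show "\<forall>\<^sub>F N in sequentially. 0 \<le> (\<integral>x. h k x \<partial>\<pi> N)\<^sup>2" by simp
      show "\<forall>\<^sub>F N in sequentially. (\<integral>x. h k x \<partial>\<pi> N)\<^sup>2 \<le> (D / 2) * (1 / real N)"
        using eventually_gt_at_top[of k]
      proof eventually_elim
        case (elim N)
        have "(\<integral>x. h k x \<partial>\<pi> N)\<^sup>2 \<le> (\<Sum>k<N. (\<integral>x. h k x \<partial>\<pi> N)\<^sup>2)"
          using elim by (intro member_le_sum) auto
        then have "2 * real N * (\<integral>x. h k x \<partial>\<pi> N)\<^sup>2 \<le> 2 * real N * (\<Sum>k<N. (\<integral>x. h k x \<partial>\<pi> N)\<^sup>2)"
          by (intro mult_left_mono) auto
        moreover have "0 \<le> (\<integral>x. (norm x)\<^sup>2 \<partial>\<pi> N)" by (intro Bochner_Integration.integral_nonneg) auto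
        ultimately have "2 * real N * (\<integral>x. h k x \<partial>\<pi> N)\<^sup>2 \<le> D" using bound[of N] by linarith
        then show ?case using elim by (simp add: field_simps)
      qed
      show "(\<lambda>N. (D / 2) * (1 / real N)) \<longlonglongrightarrow> 0" by (rule tendsto_mult_right_zero[OF lim_1_over_n])
    qed simp
    then have "(\<lambda>n. (\<integral>x. h k x \<partial>\<pi> (r n))\<^sup>2) \<longlonglongrightarrow> 0" using LIMSEQ_subseq_LIMSEQ[OF _ r] by (auto simp: o_def)
    moreover have "(\<lambda>n. (\<integral>x. h k x \<partial>\<pi> (r n))\<^sup>2) \<longlonglongrightarrow> (\<integral>x. h k x \<partial>\<pi>')\<^sup>2"
      using lim h C by (intro tendsto_power) blast
    ultimately have "(\<integral>x. h k x \<partial>\<pi>')\<^sup>2 = 0" using LIMSEQ_unique by blast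
    then show "(\<integral>x. h k x \<partial>\<pi>') = 0" by simp
  qed
qed

section \<open>Martingale constraints and the convex order\<close>

lemma eint_eq_integral: "integrable M f \<Longrightarrow> eint M f = ereal (\<integral>x. f x \<partial>M)"
proof -
  assume f: "integrable M f"
  have "(\<integral>\<^sup>+x. ennreal (f x) \<partial>M) < \<infinity>" "(\<integral>\<^sup>+x. ennreal (- f x) \<partial>M) < \<infinity>"
    using integrableD(2)[OF f] integrableD(2)[OF integrable_minus[OF f]]
    by (auto simp: less_top real_integrable_def f)
  then show ?thesis unfolding eint_def real_lebesgue_integral_def[OF f]
    by (cases "\<integral>\<^sup>+x. ennreal (f x) \<partial>M"; cases "\<integral>\<^sup>+x. ennreal (- f x) \<partial>M") (auto simp: enn2ereal_ennreal)
qed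

text \<open>Monotone convergence handles the positive parts, and domination by the negative part of
  \<open>F 0\<close> the negative ones. The negative integral of the limit is finite, so the
  extended difference passes to the limit even when that is infinite.\<close>

lemma eint_tendsto:
  assumes F: "\<And>n. integrable M (F n)" and inc: "\<And>x. incseq (\<lambda>n. F n x)" and lim: "\<And>x. (\<lambda>n. F n x) \<longlonglongrightarrow> f x"
  shows "(\<lambda>n. ereal (\<integral>x. F n x \<partial>M)) \<longlonglongrightarrow> eint M f"
proof -
  have Fm[measurable]: "F n \<in> borel_measurable M" for n using F by auto
  have fm[measurable]: "f \<in> borel_measurable M" by (rule borel_measurable_LIMSEQ_real[OF lim Fm])
  have fin: "(\<integral>\<^sup>+x. ennreal (- F 0 x) \<partial>M) < \<infinity>" using F[of 0] by (simp add: real_integrable_def less_top)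
  have "(\<lambda>n. \<integral>\<^sup>+x. ennreal (F n x) \<partial>M) \<longlonglongrightarrow> (\<integral>\<^sup>+x. ennreal (f x) \<partial>M)"
  proof (rule nn_integral_LIMSEQ)
    show "incseq (\<lambda>n x. ennreal (F n x))" using inc by (auto simp: incseq_def le_fun_def intro: ennreal_leI)
    show "(\<lambda>n. ennreal (F n x)) \<longlonglongrightarrow> ennreal (f x)" for x by (intro tendsto_ennrealI lim)
  qed measurable
  moreover have B: "(\<lambda>n. \<integral>\<^sup>+x. ennreal (- F n x) \<partial>M) \<longlonglongrightarrow> (\<integral>\<^sup>+x. ennreal (- f x) \<partial>M)"
  proof (rule nn_integral_dominated_convergence[where w="\<lambda>x. ennreal (- F 0 x)"])
    show "AE x in M. ennreal (- F n x) \<le> ennreal (- F 0 x)" for n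
      using inc by (auto intro!: AE_I2 ennreal_leI simp: incseq_def)
    show "AE x in M. (\<lambda>n. ennreal (- F n x)) \<longlonglongrightarrow> ennreal (- f x)"
      by (intro AE_I2 tendsto_ennrealI tendsto_minus lim)
  qed (use fin in auto)
  moreover have "(\<integral>\<^sup>+x. ennreal (- f x) \<partial>M) < \<infinity>"
  proof (rule le_less_trans[OF _ fin], rule nn_integral_mono, rule ennreal_leI)
    show "- f x \<le> - F 0 x" for x by (simp add: incseq_le[OF inc lim])
  qed
  ultimately have "(\<lambda>n. eint M (F n)) \<longlonglongrightarrow> eint M f"
    unfolding eint_def by (intro tendsto_diff_ereal_general tendsto_enn2erealI) (auto simp: less_top)
  then show ?thesis by (simp add: eint_eq_integral F)
qed

text \<open>A convex function may have an infinite integral and unbounded subgradients. Maxima of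
  finitely many supporting planes at a dense sequence avoid both: they have linear growth, increase
  to \<open>f\<close>, and carry a bounded Borel subgradient field \<open>G n\<close> that can serve
  as a test field.\<close>

lemma convex_approx_Lipschitz:
  fixes f :: "'a::euclidean_space \<Rightarrow> real"
  assumes f: "convex_on UNIV f"
  obtains F G B where "\<And>n. F n \<in> borel_measurable borel" "\<And>n. G n \<in> borel_measurable borel"
    "\<And>n x. norm (G n x) \<le> B n" "\<And>n x z. F n x + G n x \<bullet> (z - x) \<le> F n z"
    "\<And>x. incseq (\<lambda>n. F n x)" "\<And>x. (\<lambda>n. F n x) \<longlonglongrightarrow> f x"
proof -
  have "\<exists>p. \<forall>y. f y \<ge> f x + p \<bullet> (y - x)" for x using convex_subgradient[OF f, of x] by blast
  then obtain p where p: "\<And>x y. f y \<ge> f x + p x \<bullet> (y - x)" by metis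
  obtain D :: "'a set" where D: "countable D" "\<And>X. open X \<Longrightarrow> X \<noteq> {} \<Longrightarrow> \<exists>d\<in>D. d \<in> X"
    using countable_dense_exists by blast
  have Dne: "D \<noteq> {}" using D(2)[of UNIV] by auto
  define q where "q = from_nat_into D"
  have Dd: "\<exists>d\<in>D. dist d x < e" if "e > 0" for x e using D(2)[of "ball x e"] that by (auto simp: dist_commute)
  define l where "l k z = f (q k) + p (q k) \<bullet> (z - q k)" for k z
  define F where "F = rec_nat (l 0) (\<lambda>n g x. max (g x) (l (Suc n) x))"
  \<comment> \<open>\<open>G\<close> follows the slope of a plane attaining the maximum and switches
    only where the new plane is strictly larger, which makes it Borel by recursion.\<close>
  define G where "G = rec_nat (\<lambda>x. p (q 0)) (\<lambda>n g x. if F n x < l (Suc n) x then p (q (Suc n)) else g x)"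
  have F0: "F 0 = l 0" and FS: "F (Suc n) = (\<lambda>x. max (F n x) (l (Suc n) x))" for n by (simp_all add: F_def)
  have G0: "G 0 = (\<lambda>x. p (q 0))" and GS: "G (Suc n) = (\<lambda>x. if F n x < l (Suc n) x then p (q (Suc n)) else G n x)" for n
    unfolding G_def by simp_all
  have lm[measurable]: "l k \<in> borel_measurable borel" for k unfolding l_def[abs_def] by measurable
  have Fm[measurable]: "F n \<in> borel_measurable borel" for n
    by (induction n) (simp_all add: F0 FS lm)
  have Gm: "G n \<in> borel_measurable borel" for n
    by (induction n) (simp_all add: G0 GS)
  have GB: "norm (G n x) \<le> (\<Sum>k\<le>n. norm (p (q k)))" for n x
  proof (induction n)
    case (Suc n)
    have "norm (p (q (Suc n))) \<le> (\<Sum>k\<le>Suc n. norm (p (q k)))" by (intro member_le_sum) auto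
    then show ?case using Suc by (auto simp: GS intro: add_increasing2)
  qed (simp add: G0)
  have sub: "F n x + G n x \<bullet> (z - x) \<le> F n z" for n x z
  proof (induction n)
    case 0
    show ?case by (simp add: F0 G0 l_def inner_diff_right)
  next
    case (Suc n)
    have "l (Suc n) x + p (q (Suc n)) \<bullet> (z - x) = l (Suc n) z" by (simp add: l_def inner_diff_right)
    then show ?case using Suc by (auto simp: FS GS)
  qed
  have inc: "incseq (\<lambda>n. F n x)" for x by (rule incseq_SucI) (simp add: FS)
  have lF: "l k x \<le> F n x" if "k \<le> n" for k n x
    using that by (induction n) (auto simp: F0 FS le_Suc_eq le_max_iff_disj)
  have Ff: "F n x \<le> f x" for n x
    by (induction n) (use p in \<open>auto simp: F0 FS l_def\<close>)
  have "(\<lambda>n. F n x) \<longlonglongrightarrow> f x" for x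
  proof (rule increasing_tendsto)
    fix y assume "y < f x"
    then obtain d where d: "d \<in> D" "y < f d + p d \<bullet> (x - d)"
      using convex_SUP_affine_dense[OF f p Dd, of "f x - y" x] by auto
    then obtain k where "q k = d" unfolding q_def using from_nat_into_surj[OF D(1)] by blast
    then have "y < l k x" using d by (simp add: l_def)
    then show "\<forall>\<^sub>F n in sequentially. y < F n x"
      using lF[of k _ x] by (auto intro!: eventually_sequentiallyI[of k] intro: less_le_trans)
  qed (use Ff in auto)
  then show ?thesis using that[of F G "\<lambda>n. \<Sum>k\<le>n. norm (p (q k))"] Fm Gm GB sub inc by blast
qed

text \<open>The relation E[Z | X] = X for square-integrable variables, with the tests cut down to
  countably many scalar bumps in each coordinate so that it fits a sequence of moment
  constraints.\<close>

definition martingale_pair :: "'b measure \<Rightarrow> ('b \<Rightarrow> 'a::euclidean_space) \<Rightarrow> ('b \<Rightarrow> 'a) \<Rightarrow> bool" where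
  "martingale_pair M X Z \<longleftrightarrow> prob_space M \<and> X \<in> borel_measurable M \<and> Z \<in> borel_measurable M \<and>
     integrable M (\<lambda>w. (norm (X w))\<^sup>2) \<and> integrable M (\<lambda>w. (norm (Z w))\<^sup>2) \<and>
     (\<forall>\<phi>\<in>bumps. \<forall>b\<in>Basis. (\<integral>w. ((Z w - X w) \<bullet> b) * \<phi> (X w) \<partial>M) = 0)"

lemma martingale_pair_D:
  assumes "martingale_pair M X Z"
  shows "prob_space M" "X \<in> borel_measurable M" "Z \<in> borel_measurable M"
     "integrable M (\<lambda>w. (norm (X w))\<^sup>2)" "integrable M (\<lambda>w. (norm (Z w))\<^sup>2)"
     "\<phi> \<in> bumps \<Longrightarrow> b \<in> Basis \<Longrightarrow> (\<integral>w. ((Z w - X w) \<bullet> b) * \<phi> (X w) \<partial>M) = 0"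
  using assms unfolding martingale_pair_def by blast+

lemma (in finite_measure) integrable_of_norm_square:
  fixes X :: "'a \<Rightarrow> 'b::euclidean_space"
  assumes [measurable]: "X \<in> borel_measurable M" and sq: "integrable M (\<lambda>w. (norm (X w))\<^sup>2)"
  shows "integrable M X"
proof (rule Bochner_Integration.integrable_bound)
  show "integrable M (\<lambda>w. (1 + (norm (X w))\<^sup>2) / 2)" using sq by simp
  show "AE w in M. norm (X w) \<le> norm ((1 + (norm (X w))\<^sup>2) / 2)"
    using norm_le_quadratic by (intro AE_I2) (simp add: order_trans[OF norm_le_quadratic])
qed measurable

text \<open>The extension from bumps to bounded Borel fields is needed because the fields used
  below, the truncated identity and the subgradient fields \<open>G n\<close>, are in general
  discontinuous.\<close>

lemma martingale_pair_test_field: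
  assumes m: "martingale_pair M X Z" and \<Phi>[measurable]: "\<Phi> \<in> borel_measurable borel" and C: "\<And>x. norm (\<Phi> x) \<le> C"
  shows "integrable M (\<lambda>w. (Z w - X w) \<bullet> \<Phi> (X w))" "(\<integral>w. (Z w - X w) \<bullet> \<Phi> (X w) \<partial>M) = 0"
proof -
  interpret prob_space M by (rule martingale_pair_D[OF m])
  have [measurable]: "X \<in> borel_measurable M" "Z \<in> borel_measurable M" by (rule martingale_pair_D[OF m])+
  have ZX: "integrable M (\<lambda>w. Z w - X w)"
    by (rule Bochner_Integration.integrable_diff[OF integrable_of_norm_square[OF martingale_pair_D(3,5)[OF m]] integrable_of_norm_square[OF martingale_pair_D(2,4)[OF m]]])
  have C0: "C \<ge> 0" by (rule order_trans[OF norm_ge_zero C])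
  show int: "integrable M (\<lambda>w. (Z w - X w) \<bullet> \<Phi> (X w))"
  proof (rule Bochner_Integration.integrable_bound)
    show "integrable M (\<lambda>w. C * norm (Z w - X w))" using ZX by auto
    show "AE w in M. norm ((Z w - X w) \<bullet> \<Phi> (X w)) \<le> norm (C * norm (Z w - X w))"
    proof (rule AE_I2)
      fix w
      have "\<bar>(Z w - X w) \<bullet> \<Phi> (X w)\<bar> \<le> norm (Z w - X w) * norm (\<Phi> (X w))" by (rule Cauchy_Schwarz_ineq2)
      also have "\<dots> \<le> norm (Z w - X w) * C" by (intro mult_left_mono C) simp
      finally show "norm ((Z w - X w) \<bullet> \<Phi> (X w)) \<le> norm (C * norm (Z w - X w))" using C0 by (simp add: mult.commute)
    qed
  qed measurable
  have b: "integrable M (\<lambda>w. ((Z w - X w) \<bullet> b) * (\<Phi> (X w) \<bullet> b)) \<and> (\<integral>w. ((Z w - X w) \<bullet> b) * (\<Phi> (X w) \<bullet> b) \<partial>M) = 0"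
    if b: "b \<in> Basis" for b
  proof
    have Cb: "\<bar>\<Phi> x \<bullet> b\<bar> \<le> C" for x by (rule order_trans[OF Basis_le_norm[OF b] C])
    show "(\<integral>w. ((Z w - X w) \<bullet> b) * (\<Phi> (X w) \<bullet> b) \<partial>M) = 0"
      by (rule integral_mult_zero_if_bumps[where f="\<lambda>x. \<Phi> x \<bullet> b" and C=C])
         (use b Cb ZX martingale_pair_D(6)[OF m] in auto)
    show "integrable M (\<lambda>w. ((Z w - X w) \<bullet> b) * (\<Phi> (X w) \<bullet> b))"
      by (rule Bochner_Integration.integrable_bound[where f="\<lambda>w. C * ((Z w - X w) \<bullet> b)"])
         (use ZX Cb C0 in \<open>auto simp: abs_mult mult.commute[of C] intro!: mult_left_mono\<close>)
  qed
  have "(\<integral>w. (Z w - X w) \<bullet> \<Phi> (X w) \<partial>M) = (\<integral>w. (\<Sum>b\<in>Basis. ((Z w - X w) \<bullet> b) * (\<Phi> (X w) \<bullet> b)) \<partial>M)"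
    by (simp add: euclidean_inner[symmetric])
  also have "\<dots> = 0" using b by (simp add: Bochner_Integration.integral_sum)
  finally show "(\<integral>w. (Z w - X w) \<bullet> \<Phi> (X w) \<partial>M) = 0" .
qed

text \<open>Pythagoras: \<open>Z - X\<close> is orthogonal to \<open>X\<close>. Since
  \<open>X\<close> need not be bounded, it is first replaced by 0 where its norm exceeds n, and
  dominated convergence removes the cut.\<close>

lemma martingale_pair_second_moment:
  assumes m: "martingale_pair M X Z"
  shows "integrable M (\<lambda>w. (norm (Z w - X w))\<^sup>2)"
    "(\<integral>w. (norm (Z w - X w))\<^sup>2 \<partial>M) = (\<integral>w. (norm (Z w))\<^sup>2 \<partial>M) - (\<integral>w. (norm (X w))\<^sup>2 \<partial>M)"
proof -
  interpret prob_space M by (rule martingale_pair_D[OF m])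
  have [measurable]: "X \<in> borel_measurable M" "Z \<in> borel_measurable M" by (rule martingale_pair_D[OF m])+
  have sq: "integrable M (\<lambda>w. (norm (X w))\<^sup>2)" "integrable M (\<lambda>w. (norm (Z w))\<^sup>2)" by (rule martingale_pair_D[OF m])+
  have dom: "\<bar>(Z w - X w) \<bullet> X w\<bar> \<le> (norm (Z w))\<^sup>2 + 2 * (norm (X w))\<^sup>2" for w
  proof -
    have "\<bar>Z w \<bullet> X w\<bar> \<le> norm (Z w) * norm (X w)" by (rule Cauchy_Schwarz_ineq2)
    also have "\<dots> \<le> (norm (Z w))\<^sup>2 + (norm (X w))\<^sup>2"
      using sum_squares_bound[of "norm (Z w)" "norm (X w)"] zero_le_power2[of "norm (Z w)"] zero_le_power2[of "norm (X w)"] by linarith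
    finally have "\<bar>Z w \<bullet> X w\<bar> \<le> (norm (Z w))\<^sup>2 + (norm (X w))\<^sup>2" .
    moreover have "(Z w - X w) \<bullet> X w = Z w \<bullet> X w - (norm (X w))\<^sup>2" by (simp add: inner_diff_left power2_norm_eq_inner)
    ultimately show ?thesis using zero_le_power2[of "norm (X w)"] by linarith
  qed
  have idom: "integrable M (\<lambda>w. (norm (Z w))\<^sup>2 + 2 * (norm (X w))\<^sup>2)" using sq by auto
  have iXZ: "integrable M (\<lambda>w. (Z w - X w) \<bullet> X w)"
    by (rule Bochner_Integration.integrable_bound[OF idom]) (use dom in auto)
  let ?f = "\<lambda>n w. (Z w - X w) \<bullet> (if norm (X w) \<le> real n then X w else 0)"
  have "(\<lambda>n. \<integral>w. ?f n w \<partial>M) \<longlonglongrightarrow> (\<integral>w. (Z w - X w) \<bullet> X w \<partial>M)"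
  proof (rule integral_dominated_convergence[OF _ _ idom])
    show "AE w in M. (\<lambda>n. ?f n w) \<longlonglongrightarrow> (Z w - X w) \<bullet> X w"
    proof (rule AE_I2)
      fix w
      obtain n0 where n0: "norm (X w) \<le> real n0" using real_arch_simple by blast
      have "\<forall>\<^sub>F n in sequentially. ?f n w = (Z w - X w) \<bullet> X w"
        by (rule eventually_mono[OF eventually_ge_at_top[of n0]]) (use n0 in auto)
      then show "(\<lambda>n. ?f n w) \<longlonglongrightarrow> (Z w - X w) \<bullet> X w" by (rule tendsto_eventually)
    qed
    show "AE w in M. norm (?f n w) \<le> (norm (Z w))\<^sup>2 + 2 * (norm (X w))\<^sup>2" for n
      using dom by (intro AE_I2) auto
  qed measurable
  moreover have "(\<integral>w. ?f n w \<partial>M) = 0" for n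
    by (rule martingale_pair_test_field(2)[OF m, where \<Phi>="\<lambda>x. if norm x \<le> real n then x else 0" and C="real n"]) auto
  ultimately have z: "(\<integral>w. (Z w - X w) \<bullet> X w \<partial>M) = 0" by (simp add: LIMSEQ_const_iff)
  have eq: "(norm (Z w - X w))\<^sup>2 = (norm (Z w))\<^sup>2 - (norm (X w))\<^sup>2 - 2 * ((Z w - X w) \<bullet> X w)" for w
    by (simp add: power2_norm_eq_inner algebra_simps inner_commute)
  show "integrable M (\<lambda>w. (norm (Z w - X w))\<^sup>2)" unfolding eq using sq iXZ by auto
  show "(\<integral>w. (norm (Z w - X w))\<^sup>2 \<partial>M) = (\<integral>w. (norm (Z w))\<^sup>2 \<partial>M) - (\<integral>w. (norm (X w))\<^sup>2 \<partial>M)"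
    unfolding eq using sq iXZ z by simp
qed

lemma distr_in_P2:
  fixes X :: "'b \<Rightarrow> 'a::euclidean_space"
  assumes "prob_space M" and [measurable]: "X \<in> borel_measurable M" and "integrable M (\<lambda>w. (norm (X w))\<^sup>2)"
  shows "distr M borel X \<in> P2"
  using assms by (auto simp: P2_def integrable_distr_eq intro: prob_space.prob_space_distr)

text \<open>Jensen's inequality without conditional expectations: the subgradient inequality of
  \<open>F n\<close> is integrated with the test field \<open>G n\<close>, and then n grows. The
  limits may be infinite.\<close>

lemma martingale_pair_convex_dom:
  assumes m: "martingale_pair M X Z"
  shows "convex_dom (distr M borel Z) (distr M borel X)"
  unfolding convex_dom_def
proof (intro allI impI)
  fix f :: "'b \<Rightarrow> real" assume f: "convex_on UNIV f"
  interpret prob_space M by (rule martingale_pair_D[OF m])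
  have [measurable]: "X \<in> borel_measurable M" "Z \<in> borel_measurable M" by (rule martingale_pair_D[OF m])+
  have P2: "distr M borel X \<in> P2" "distr M borel Z \<in> P2" by (intro distr_in_P2 martingale_pair_D[OF m])+
  obtain F G B where Fm[measurable]: "\<And>n. F n \<in> borel_measurable borel" and Gm[measurable]: "\<And>n. G n \<in> borel_measurable borel"
    and GB: "\<And>n x. norm (G n x) \<le> B n" and sub: "\<And>n x z. F n x + G n x \<bullet> (z - x) \<le> F n z"
    and inc: "\<And>x. incseq (\<lambda>n. F n x)" and lim: "\<And>x. (\<lambda>n. F n x) \<longlonglongrightarrow> f x"
    using convex_approx_Lipschitz[OF f] by blast
  have growth: "\<bar>F n z\<bar> \<le> (\<bar>F n 0\<bar> + B n) * (1 + norm z)" for n z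
  proof -
    have a: "\<bar>G n x \<bullet> z\<bar> \<le> B n * norm z" for x
      by (rule order_trans[OF Cauchy_Schwarz_ineq2]) (intro mult_right_mono GB norm_ge_zero)
    have "\<bar>F n z\<bar> \<le> \<bar>F n 0\<bar> + B n * norm z"
      using sub[of n 0 z] sub[of n z 0] a[of 0] a[of z] by (simp add: abs_le_iff) argo
    also have "\<dots> \<le> (\<bar>F n 0\<bar> + B n) * (1 + norm z)"
      using order_trans[OF norm_ge_zero GB[of n 0]] by (simp add: algebra_simps mult_nonneg_nonneg)
    finally show ?thesis .
  qed
  have int: "integrable N (F n)" if "N \<in> P2" for N n
    using growth by (intro P2_integrable_linear[OF that Fm, where C="\<bar>F n 0\<bar> + B n"]) simp
  have iX: "integrable M (\<lambda>w. F n (X w))" and iZ: "integrable M (\<lambda>w. F n (Z w))" for n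
    using int[OF P2(1), of n] int[OF P2(2), of n] by (simp_all add: integrable_distr_eq)
  have "(\<integral>x. F n x \<partial>distr M borel X) \<le> (\<integral>x. F n x \<partial>distr M borel Z)" for n
  proof -
    note t = martingale_pair_test_field[OF m Gm GB, of n]
    have "(\<integral>w. F n (X w) \<partial>M) = (\<integral>w. F n (X w) + (Z w - X w) \<bullet> G n (X w) \<partial>M)"
      using t iX by simp
    also have "\<dots> \<le> (\<integral>w. F n (Z w) \<partial>M)"
      using t(1) iX iZ sub by (intro integral_mono) (auto simp: inner_commute)
    finally show ?thesis by (simp add: integral_distr)
  qed
  then show "eint (distr M borel X) f \<le> eint (distr M borel Z) f"
    using LIMSEQ_le[OF eint_tendsto[OF int[OF P2(1)] inc lim] eint_tendsto[OF int[OF P2(2)] inc lim]] by auto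
qed

section \<open>Duality for pairs of martingale couplings\<close>

text \<open>Each convex function has an affine minorant, so an upper bound on the sum bounds each
  summand from above as well.\<close>

lemma convex_sum_quadratic:
  fixes A B :: "'a::euclidean_space \<Rightarrow> real"
  assumes A: "convex_on UNIV A" and B: "convex_on UNIV B" and AB: "\<And>z. A z + B z \<le> K * (1 + (norm z)\<^sup>2)"
  obtains C where "\<And>z. \<bar>A z\<bar> \<le> C * (1 + (norm z)\<^sup>2)" "\<And>z. \<bar>B z\<bar> \<le> C * (1 + (norm z)\<^sup>2)"
proof -
  have lower: "\<exists>c\<ge>0. \<forall>z. - (c * (1 + (norm z)\<^sup>2)) \<le> f z" if f: "convex_on UNIV f" for f :: "'a \<Rightarrow> real"
  proof -
    obtain p where p: "\<And>y. f y \<ge> f 0 + p \<bullet> (y - 0)" using convex_subgradient[OF f, of 0] by blast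
    have "- ((\<bar>f 0\<bar> + norm p) * (1 + (norm z)\<^sup>2)) \<le> f z" for z
    proof -
      have "norm p * norm z \<le> norm p * (1 + (norm z)\<^sup>2)"
        using norm_le_quadratic[of z] zero_le_power2[of "norm z"] by (intro mult_left_mono norm_ge_zero) argo
      moreover have "\<bar>f 0\<bar> \<le> \<bar>f 0\<bar> * (1 + (norm z)\<^sup>2)" by (simp add: algebra_simps)
      moreover have "\<bar>p \<bullet> z\<bar> \<le> norm p * norm z" by (rule Cauchy_Schwarz_ineq2)
      moreover have "f z \<ge> f 0 + p \<bullet> z" using p[of z] by simp
      ultimately show ?thesis unfolding distrib_right by linarith
    qed
    then show ?thesis by (intro exI[of _ "\<bar>f 0\<bar> + norm p"]) auto
  qed
  obtain a where a: "a \<ge> 0" "\<And>z. - (a * (1 + (norm z)\<^sup>2)) \<le> A z" using lower[OF A] by blast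
  obtain b where b: "b \<ge> 0" "\<And>z. - (b * (1 + (norm z)\<^sup>2)) \<le> B z" using lower[OF B] by blast
  show ?thesis
  proof (rule that[of "a + b + \<bar>K\<bar>"])
    fix z :: 'a
    have q: "1 + (norm z)\<^sup>2 \<ge> 0" by simp
    have "K * (1 + (norm z)\<^sup>2) \<le> \<bar>K\<bar> * (1 + (norm z)\<^sup>2)" by (rule mult_right_mono) auto
    moreover have "0 \<le> \<bar>K\<bar> * (1 + (norm z)\<^sup>2)" "0 \<le> a * (1 + (norm z)\<^sup>2)" "0 \<le> b * (1 + (norm z)\<^sup>2)"
      using a b q by (auto intro!: mult_nonneg_nonneg)
    ultimately show "\<bar>A z\<bar> \<le> (a + b + \<bar>K\<bar>) * (1 + (norm z)\<^sup>2)" "\<bar>B z\<bar> \<le> (a + b + \<bar>K\<bar>) * (1 + (norm z)\<^sup>2)"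
      using a(2)[of z] b(2)[of z] AB[of z] unfolding distrib_right[of "a + b"] distrib_right[of a b] by linarith+
  qed
qed

section \<open>Measures on triples and their linear constraints\<close>

lemma measurable_components [measurable]:
  "(\<lambda>w :: 'a::euclidean_space \<times> 'a \<times> 'a. fst w) \<in> borel_measurable borel"
  "(\<lambda>w :: 'a::euclidean_space \<times> 'a \<times> 'a. fst (snd w)) \<in> borel_measurable borel"
  "(\<lambda>w :: 'a::euclidean_space \<times> 'a \<times> 'a. snd (snd w)) \<in> borel_measurable borel"
  by (intro borel_measurable_continuous_onI continuous_intros)+

lemma norm_triple: "(norm w)\<^sup>2 = (norm (fst w))\<^sup>2 + (norm (fst (snd w)))\<^sup>2 + (norm (snd (snd w)))\<^sup>2"
  by (cases w) (simp add: norm_Pair)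

lemma P2_triple_integrable:
  fixes M :: "('a::euclidean_space \<times> 'a \<times> 'a) measure"
  assumes "M \<in> P2"
  shows "integrable M (\<lambda>w. (norm (fst w))\<^sup>2)" "integrable M (\<lambda>w. (norm (fst (snd w)))\<^sup>2)" "integrable M (\<lambda>w. (norm (snd (snd w)))\<^sup>2)"
proof -
  note [measurable_cong] = P2_D(2)[OF assms]
  show "integrable M (\<lambda>w. (norm (fst w))\<^sup>2)" "integrable M (\<lambda>w. (norm (fst (snd w)))\<^sup>2)" "integrable M (\<lambda>w. (norm (snd (snd w)))\<^sup>2)"
    by (rule Bochner_Integration.integrable_bound[OF P2_D(4)[OF assms]]; auto simp: norm_triple)+
qed

lemma norm_components_le: "norm (fst w) \<le> norm w" "norm (fst (snd w)) \<le> norm w" "norm (snd (snd w)) \<le> norm w"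
  by (rule power2_le_imp_le, simp add: norm_triple, simp)+

lemma marg_eq_distr:
  "marg1 \<pi> = distr \<pi> borel fst" "marg2 \<pi> = distr \<pi> borel (\<lambda>w. fst (snd w))" "marg3 \<pi> = distr \<pi> borel (\<lambda>w. snd (snd w))"
  by (simp_all add: marg1_def marg2_def marg3_def case_prod_beta')

text \<open>One formula for five kinds of constraint: two prescribed marginals, two martingale
  conditions, and a condition on the third marginal. The constraints used later have at most one
  nonzero entry each.\<close>

definition constraint ::
  "('a::euclidean_space \<Rightarrow> real) \<Rightarrow> ('a \<Rightarrow> real) \<Rightarrow> ('a \<Rightarrow> 'a) \<Rightarrow> ('a \<Rightarrow> 'a) \<Rightarrow> ('a \<Rightarrow> real) \<Rightarrow> 'a \<times> 'a \<times> 'a \<Rightarrow> real" where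
  "constraint \<phi> \<psi> \<Phi> \<Psi> \<kappa> w = \<phi> (fst w) + \<psi> (fst (snd w)) + (snd (snd w) - fst w) \<bullet> \<Phi> (fst w)
     + (snd (snd w) - fst (snd w)) \<bullet> \<Psi> (fst (snd w)) + \<kappa> (snd (snd w))"

lemma constraint_growth:
  assumes "\<And>x. \<bar>\<phi> x\<bar> \<le> K" "\<And>x. \<bar>\<psi> x\<bar> \<le> K" "\<And>x. norm (\<Phi> x) \<le> K" "\<And>x. norm (\<Psi> x) \<le> K" "\<And>x. \<bar>\<kappa> x\<bar> \<le> K"
  shows "\<bar>constraint \<phi> \<psi> \<Phi> \<Psi> \<kappa> w\<bar> \<le> (4 * K) * (1 + norm w)"
proof -
  have K: "K \<ge> 0" using assms(1)[of 0] by linarith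
  have *: "\<bar>(snd (snd w) - x) \<bullet> v\<bar> \<le> 2 * K * norm w" if "norm x \<le> norm w" "norm v \<le> K" for x v
  proof -
    have "\<bar>(snd (snd w) - x) \<bullet> v\<bar> \<le> norm (snd (snd w) - x) * norm v" by (rule Cauchy_Schwarz_ineq2)
    also have "\<dots> \<le> (norm w + norm w) * K"
      by (intro mult_mono order_trans[OF norm_triangle_ineq4] add_mono norm_components_le that) auto
    finally show ?thesis by (simp add: algebra_simps)
  qed
  show ?thesis using assms(1)[of "fst w"] assms(2)[of "fst (snd w)"] assms(5)[of "snd (snd w)"] K
    *[OF norm_components_le(1)[of w] assms(3)[of "fst w"]] *[OF norm_components_le(2)[of w] assms(4)[of "fst (snd w)"]]
    unfolding constraint_def by (simp add: distrib_left)
qed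

text \<open>For fixed \<open>z\<close> the Lagrangian splits into a term in \<open>x\<close> and a
  term in \<open>y\<close>, each affine in \<open>z\<close>, so their suprema \<open>A\<close> and
  \<open>B\<close> are convex and \<open>dual\<close> applies to them. On the diagonal,
  \<open>A x\<close> is at least \<open>- ((norm x)\<^sup>2 + f x)\<close>; as \<open>f\<close> has
  mean zero under \<open>\<mu>\<close>, integration returns minus the second moment of
  \<open>\<mu>\<close>. The same holds for \<open>B\<close> and \<open>\<nu>\<close>.\<close>

lemma coupling_duality:
  fixes \<mu> \<nu> :: "'a::euclidean_space measure" and \<phi> \<psi> \<kappa> :: "nat \<Rightarrow> 'a \<Rightarrow> real" and \<Phi> \<Psi> :: "nat \<Rightarrow> 'a \<Rightarrow> 'a"
  assumes P2: "\<mu> \<in> P2" "\<nu> \<in> P2"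
    and cont: "\<And>i. continuous_on UNIV (\<phi> i)" "\<And>i. continuous_on UNIV (\<psi> i)" "\<And>i. continuous_on UNIV (\<Phi> i)"
      "\<And>i. continuous_on UNIV (\<Psi> i)" "\<And>i. continuous_on UNIV (\<kappa> i)"
    and bd: "\<And>i x. \<bar>\<phi> i x\<bar> \<le> K i" "\<And>i x. \<bar>\<psi> i x\<bar> \<le> K i" "\<And>i x. norm (\<Phi> i x) \<le> K i"
      "\<And>i x. norm (\<Psi> i x) \<le> K i" "\<And>i x. \<bar>\<kappa> i x\<bar> \<le> K i"
    and zero: "\<And>i. (\<integral>x. \<phi> i x \<partial>\<mu>) = 0" "\<And>i. (\<integral>x. \<psi> i x \<partial>\<nu>) = 0"
    and dual: "\<And>n a A B m. convex_on UNIV A \<Longrightarrow> convex_on UNIV B \<Longrightarrow>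
      (\<And>z. A z + B z \<le> (norm z)\<^sup>2 + (\<Sum>i<n. a i * \<kappa> i z) - m) \<Longrightarrow> (\<integral>x. A x \<partial>\<mu>) + (\<integral>x. B x \<partial>\<nu>) + m \<le> D"
  shows "\<exists>M\<in>P2. (\<forall>i. (\<integral>w. constraint (\<phi> i) (\<psi> i) (\<Phi> i) (\<Psi> i) (\<kappa> i) w \<partial>M) = 0) \<and>
    (\<integral>w. (norm w)\<^sup>2 \<partial>M) \<le> (\<integral>x. (norm x)\<^sup>2 \<partial>\<mu>) + (\<integral>x. (norm x)\<^sup>2 \<partial>\<nu>) + D"
proof (rule moment_problem[where h="\<lambda>i. constraint (\<phi> i) (\<psi> i) (\<Phi> i) (\<Psi> i) (\<kappa> i)" and C="\<lambda>i. 4 * K i"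
     and D="(\<integral>x. (norm x)\<^sup>2 \<partial>\<mu>) + (\<integral>x. (norm x)\<^sup>2 \<partial>\<nu>) + D"])
  show "continuous_on UNIV (constraint (\<phi> i) (\<psi> i) (\<Phi> i) (\<Psi> i) (\<kappa> i))" for i
    unfolding constraint_def[abs_def]
    by (intro continuous_intros continuous_on_compose2[OF cont(1)] continuous_on_compose2[OF cont(2)]
      continuous_on_compose2[OF cont(3)] continuous_on_compose2[OF cont(4)] continuous_on_compose2[OF cont(5)] subset_UNIV)
  show "\<bar>constraint (\<phi> i) (\<psi> i) (\<Phi> i) (\<Psi> i) (\<kappa> i) w\<bar> \<le> 4 * K i * (1 + norm w)" for i w
    by (rule constraint_growth) (rule bd)+
  fix n :: nat and a :: "nat \<Rightarrow> real" and m
  assume le: "\<And>w. m \<le> (norm w)\<^sup>2 + (\<Sum>i<n. a i * constraint (\<phi> i) (\<psi> i) (\<Phi> i) (\<Psi> i) (\<kappa> i) w)"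
  define f where "f x = (\<Sum>i<n. a i * \<phi> i x)" for x
  define g where "g x = (\<Sum>i<n. a i * \<psi> i x)" for x
  define F where "F x = (\<Sum>i<n. a i *\<^sub>R \<Phi> i x)" for x
  define G where "G x = (\<Sum>i<n. a i *\<^sub>R \<Psi> i x)" for x
  define k where "k z = (\<Sum>i<n. a i * \<kappa> i z)" for z
  have sum: "(\<Sum>i<n. a i * constraint (\<phi> i) (\<psi> i) (\<Phi> i) (\<Psi> i) (\<kappa> i) (x, y, z))
     = f x + g y + (z - x) \<bullet> F x + (z - y) \<bullet> G y + k z" for x y z
    unfolding f_def g_def F_def G_def k_def constraint_def
    by (simp add: sum.distrib distrib_left inner_sum_right)
  define \<alpha> where "\<alpha> x z = - ((norm x)\<^sup>2 + f x) + (- F x) \<bullet> (z - x)" for x z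
  define \<beta> where "\<beta> y z = - ((norm y)\<^sup>2 + g y) + (- G y) \<bullet> (z - y)" for y z
  have ab: "\<alpha> x z + \<beta> y z \<le> (norm z)\<^sup>2 + k z - m" for x y z
    using le[of "(x, y, z)"] unfolding sum norm_triple by (simp add: \<alpha>_def \<beta>_def inner_commute)
  define A where "A z = (SUP x. \<alpha> x z)" for z
  define B where "B z = (SUP y. \<beta> y z)" for z
  \<comment> \<open>Freezing the other variable at 0 bounds the family, and so makes the real-valued
    supremum meaningful.\<close>
  have bdA: "bdd_above (range (\<lambda>x. \<alpha> x z))" for z
    by (rule bdd_aboveI[of _ "(norm z)\<^sup>2 + k z - m - \<beta> 0 z"]) (use ab[of _ z 0] in \<open>auto simp: le_diff_eq\<close>)
  have bdB: "bdd_above (range (\<lambda>y. \<beta> y z))" for z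
    by (rule bdd_aboveI[of _ "(norm z)\<^sup>2 + k z - m - \<alpha> 0 z"]) (use ab[of 0 z] in \<open>auto simp: le_diff_eq add.commute\<close>)
  have cA: "convex_on UNIV A" unfolding A_def
  proof (rule convex_on_UNIV_cSUP[OF UNIV_not_empty _ bdA])
    show "convex_on UNIV (\<alpha> x)" for x unfolding \<alpha>_def[abs_def] by (rule convex_on_UNIV_affine)
  qed
  have cB: "convex_on UNIV B" unfolding B_def
  proof (rule convex_on_UNIV_cSUP[OF UNIV_not_empty _ bdB])
    show "convex_on UNIV (\<beta> x)" for x unfolding \<beta>_def[abs_def] by (rule convex_on_UNIV_affine)
  qed
  have AB: "A z + B z \<le> (norm z)\<^sup>2 + k z - m" for z
  proof -
    have "A z \<le> (norm z)\<^sup>2 + k z - m - \<beta> y z" for y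
      unfolding A_def by (rule cSUP_least) (use ab[of _ z y] in \<open>auto simp: le_diff_eq\<close>)
    then have "\<beta> y z \<le> (norm z)\<^sup>2 + k z - m - A z" for y by (simp add: algebra_simps)
    then have "B z \<le> (norm z)\<^sup>2 + k z - m - A z" unfolding B_def by (intro cSUP_least) auto
    then show ?thesis by linarith
  qed
  have bk: "\<bar>k z\<bar> \<le> (\<Sum>i<n. \<bar>a i\<bar> * K i)" for z
    unfolding k_def by (rule order_trans[OF sum_abs]) (auto intro!: sum_mono mult_left_mono bd simp: abs_mult)
  define L where "L = 1 + (\<Sum>i<n. \<bar>a i\<bar> * K i) + \<bar>m\<bar>"
  have L: "L \<ge> 1" using bk[of 0] by (simp add: L_def)
  have ABL: "A z + B z \<le> L * (1 + (norm z)\<^sup>2)" for z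
  proof -
    have "(norm z)\<^sup>2 \<le> L * (norm z)\<^sup>2" using L mult_right_mono[of 1 L "(norm z)\<^sup>2"] by simp
    then show ?thesis using AB[of z] bk[of z] by (simp add: distrib_left L_def)
  qed
  obtain C where C: "\<And>z. \<bar>A z\<bar> \<le> C * (1 + (norm z)\<^sup>2)" "\<And>z. \<bar>B z\<bar> \<le> C * (1 + (norm z)\<^sup>2)"
    using convex_sum_quadratic[OF cA cB ABL] by blast
  have iA: "integrable \<mu> A" and iB: "integrable \<nu> B"
    using C by (auto intro!: P2_integrable_quadratic[OF P2(1), where C=C] P2_integrable_quadratic[OF P2(2), where C=C]
       convex_on_UNIV_measurable cA cB)
  have i: "integrable \<mu> (\<phi> i)" "integrable \<nu> (\<psi> i)" for i
    by (rule P2_integrable_quadratic[OF _ borel_measurable_continuous_onI, where C="K i"],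
        use P2 cont bd abs_ge_zero[THEN order_trans, OF bd(1)] in \<open>auto intro!: order_trans[OF bd(1)] order_trans[OF bd(2)] simp: algebra_simps\<close>)+
  have "- (\<integral>x. (norm x)\<^sup>2 \<partial>\<mu>) = (\<integral>x. - ((norm x)\<^sup>2 + f x) \<partial>\<mu>)"
    using i zero P2_D(4)[OF P2(1)] by (simp add: f_def Bochner_Integration.integral_sum)
  also have "\<dots> \<le> (\<integral>x. A x \<partial>\<mu>)"
  proof (rule integral_mono[OF _ iA])
    show "integrable \<mu> (\<lambda>x. - ((norm x)\<^sup>2 + f x))" using i P2_D(4)[OF P2(1)] by (auto simp: f_def)
    show "- ((norm x)\<^sup>2 + f x) \<le> A x" for x
      using cSUP_upper[OF UNIV_I bdA, of x x] by (simp add: A_def \<alpha>_def)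
  qed
  finally have 1: "- (\<integral>x. (norm x)\<^sup>2 \<partial>\<mu>) \<le> (\<integral>x. A x \<partial>\<mu>)" .
  have "- (\<integral>x. (norm x)\<^sup>2 \<partial>\<nu>) = (\<integral>x. - ((norm x)\<^sup>2 + g x) \<partial>\<nu>)"
    using i zero P2_D(4)[OF P2(2)] by (simp add: g_def Bochner_Integration.integral_sum)
  also have "\<dots> \<le> (\<integral>x. B x \<partial>\<nu>)"
  proof (rule integral_mono[OF _ iB])
    show "integrable \<nu> (\<lambda>x. - ((norm x)\<^sup>2 + g x))" using i P2_D(4)[OF P2(2)] by (auto simp: g_def)
    show "- ((norm x)\<^sup>2 + g x) \<le> B x" for x
      using cSUP_upper[OF UNIV_I bdB, of x x] by (simp add: B_def \<beta>_def)
  qed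
  finally have 2: "- (\<integral>x. (norm x)\<^sup>2 \<partial>\<nu>) \<le> (\<integral>x. B x \<partial>\<nu>)" .
  have "(\<integral>x. A x \<partial>\<mu>) + (\<integral>x. B x \<partial>\<nu>) + m \<le> D"
    by (rule dual[OF cA cB]) (use AB in \<open>simp add: k_def\<close>)
  then show "m \<le> (\<integral>x. (norm x)\<^sup>2 \<partial>\<mu>) + (\<integral>x. (norm x)\<^sup>2 \<partial>\<nu>) + D" using 1 2 by linarith
qed

text \<open>The \<open>\<xi> k\<close> are optional conditions on the third marginal: zero functions
  leave it free, centred bumps prescribe it. Once the first two marginals are right, their second
  moments drop out of the bound and leave \<open>D\<close> for the third component.\<close>

lemma martingale_coupling_exists:
  fixes \<mu> \<nu> :: "'a::euclidean_space measure"
  assumes P2: "\<mu> \<in> P2" "\<nu> \<in> P2"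
    and \<xi>: "\<And>k. continuous_on UNIV (\<xi> k)" "\<And>k x. \<bar>\<xi> k x\<bar> \<le> K k"
    and dual: "\<And>n a A B m \<kappa>. (\<And>i :: nat. \<kappa> i \<in> insert (\<lambda>_. 0) (range \<xi>)) \<Longrightarrow> convex_on UNIV A \<Longrightarrow> convex_on UNIV B \<Longrightarrow>
      (\<And>z. A z + B z \<le> (norm z)\<^sup>2 + (\<Sum>i<n. a i * \<kappa> i z) - m) \<Longrightarrow> (\<integral>x. A x \<partial>\<mu>) + (\<integral>x. B x \<partial>\<nu>) + m \<le> D"
  shows "\<exists>M\<in>P2. marg1 M = \<mu> \<and> marg2 M = \<nu> \<and> martingale_pair M fst (\<lambda>w. snd (snd w)) \<and>
    martingale_pair M (\<lambda>w. fst (snd w)) (\<lambda>w. snd (snd w)) \<and> (\<integral>w. (norm (snd (snd w)))\<^sup>2 \<partial>M) \<le> D \<and>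
    (\<forall>k :: nat. (\<integral>w. \<xi> k (snd (snd w)) \<partial>M) = 0)"
proof -
  define \<beta> :: "nat \<Rightarrow> 'a \<Rightarrow> real" where "\<beta> = from_nat_into bumps"
  \<comment> \<open>The basis is finite; \<open>from_nat_into\<close> gives the surplus indices some
    basis vector, so every \<open>b k\<close> is a legitimate direction.\<close>
  define b :: "nat \<Rightarrow> 'a" where "b = from_nat_into Basis"
  have \<beta>in: "\<beta> k \<in> bumps" for k unfolding \<beta>_def by (rule from_nat_into[OF bumps_nonempty])
  have bin: "b k \<in> Basis" for k unfolding b_def by (rule from_nat_into) simp
  have \<beta>c: "continuous_on UNIV (\<beta> k)" and \<beta>1: "\<bar>\<beta> k x\<bar> \<le> 1" for k x
    using \<beta>in[of k] by (auto simp: bumps_def continuous_on_bump abs_bump_le_1)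
  have \<beta>m[measurable]: "\<beta> k \<in> borel_measurable borel" for k by (rule borel_measurable_continuous_onI[OF \<beta>c])
  have \<beta>i: "integrable N (\<beta> k)" and \<beta>I: "\<bar>\<integral>x. \<beta> k x \<partial>N\<bar> \<le> 1" if "N \<in> P2" for N k
  proof -
    note P2_D(2)[OF that, measurable_cong]
    interpret prob_space N by (rule P2_D[OF that])
    show i: "integrable N (\<beta> k)" by (rule integrable_const_bound[where B=1]) (use \<beta>1 in auto)
    have "\<bar>\<integral>x. \<beta> k x \<partial>N\<bar> \<le> (\<integral>x. \<bar>\<beta> k x\<bar> \<partial>N)" by (rule integral_abs_bound)
    also have "\<dots> \<le> (\<integral>x. 1 \<partial>N)" using i \<beta>1 by (intro integral_mono) auto
    finally show "\<bar>\<integral>x. \<beta> k x \<partial>N\<bar> \<le> 1" by (simp add: prob_space)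
  qed
  \<comment> \<open>Five sequences are interleaved: \<open>i mod 5\<close> selects the kind of
    constraint and \<open>i div 5\<close> its index. For the martingale conditions that index codes
    a pair of a bump and a basis vector.\<close>
  define \<phi> where "\<phi> i = (if i mod 5 = 0 then (\<lambda>x. \<beta> (i div 5) x - (\<integral>x. \<beta> (i div 5) x \<partial>\<mu>)) else (\<lambda>_. 0))" for i
  define \<psi> where "\<psi> i = (if i mod 5 = 1 then (\<lambda>x. \<beta> (i div 5) x - (\<integral>x. \<beta> (i div 5) x \<partial>\<nu>)) else (\<lambda>_. 0))" for i
  define T where "T j x = \<beta> (fst (prod_decode j)) x *\<^sub>R b (snd (prod_decode j))" for j x
  define \<Phi> where "\<Phi> i = (if i mod 5 = 2 then T (i div 5) else (\<lambda>_. 0))" for i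
  define \<Psi> where "\<Psi> i = (if i mod 5 = 3 then T (i div 5) else (\<lambda>_. 0))" for i
  define \<kappa> where "\<kappa> i = (if i mod 5 = 4 then \<xi> (i div 5) else (\<lambda>_. 0))" for i
  have Tc: "continuous_on UNIV (T j)" and T1: "norm (T j x) \<le> 1" for j x
    unfolding T_def[abs_def] using \<beta>1 bin by (auto intro!: continuous_intros \<beta>c)
  have K0: "0 \<le> \<bar>K k\<bar>" "\<bar>\<xi> k x\<bar> \<le> \<bar>K k\<bar>" for k x using \<xi>(2)[of k x] by auto
  have bd2: "\<bar>\<beta> k x - (\<integral>x. \<beta> k x \<partial>N)\<bar> \<le> 2" if "N \<in> P2" for N k x
    using \<beta>1[of k x] \<beta>I[OF that, of k] by linarith
  have "\<exists>M\<in>P2. (\<forall>i. (\<integral>w. constraint (\<phi> i) (\<psi> i) (\<Phi> i) (\<Psi> i) (\<kappa> i) w \<partial>M) = 0) \<and>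
    (\<integral>w. (norm w)\<^sup>2 \<partial>M) \<le> (\<integral>x. (norm x)\<^sup>2 \<partial>\<mu>) + (\<integral>x. (norm x)\<^sup>2 \<partial>\<nu>) + D"
  proof (rule coupling_duality[OF P2, where \<phi>=\<phi> and \<psi>=\<psi> and \<Phi>=\<Phi> and \<Psi>=\<Psi> and \<kappa>=\<kappa> and K="\<lambda>i. 2 + \<bar>K (i div 5)\<bar>" and D=D])
    fix i x
    show "continuous_on UNIV (\<phi> i)" "continuous_on UNIV (\<psi> i)"
      "continuous_on UNIV (\<Phi> i)" "continuous_on UNIV (\<Psi> i)" "continuous_on UNIV (\<kappa> i)"
      by (auto simp: \<phi>_def \<psi>_def \<Phi>_def \<Psi>_def \<kappa>_def intro!: continuous_intros \<beta>c Tc \<xi>)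
    show "\<bar>\<phi> i x\<bar> \<le> 2 + \<bar>K (i div 5)\<bar>" "\<bar>\<psi> i x\<bar> \<le> 2 + \<bar>K (i div 5)\<bar>"
      using bd2[OF P2(1), of "i div 5" x] bd2[OF P2(2), of "i div 5" x] by (auto simp: \<phi>_def \<psi>_def intro: add_increasing2)
    show "norm (\<Phi> i x) \<le> 2 + \<bar>K (i div 5)\<bar>" "norm (\<Psi> i x) \<le> 2 + \<bar>K (i div 5)\<bar>" "\<bar>\<kappa> i x\<bar> \<le> 2 + \<bar>K (i div 5)\<bar>"
      using T1[of "i div 5" x] K0(2)[of "i div 5" x] by (auto simp: \<Phi>_def \<Psi>_def \<kappa>_def)
    show "(\<integral>x. \<phi> i x \<partial>\<mu>) = 0" "(\<integral>x. \<psi> i x \<partial>\<nu>) = 0"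
      using \<beta>i[OF P2(1)] \<beta>i[OF P2(2)] P2_D(1)[OF P2(1)] P2_D(1)[OF P2(2)]
      by (auto simp: \<phi>_def \<psi>_def prob_space.prob_space prob_space_def finite_measure.integrable_const)
  next
    fix n a A B m assume "convex_on UNIV A" "convex_on UNIV B" "\<And>z. A z + B z \<le> (norm z)\<^sup>2 + (\<Sum>i<n. a i * \<kappa> i z) - m"
    then show "(\<integral>x. A x \<partial>\<mu>) + (\<integral>x. B x \<partial>\<nu>) + m \<le> D" by (intro dual[of \<kappa>]) (auto simp: \<kappa>_def)
  qed
  then obtain M where M: "M \<in> P2" and z: "\<And>i. (\<integral>w. constraint (\<phi> i) (\<psi> i) (\<Phi> i) (\<Psi> i) (\<kappa> i) w \<partial>M) = 0"
    and m2: "(\<integral>w. (norm w)\<^sup>2 \<partial>M) \<le> (\<integral>x. (norm x)\<^sup>2 \<partial>\<mu>) + (\<integral>x. (norm x)\<^sup>2 \<partial>\<nu>) + D"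
    by auto
  note [measurable_cong] = P2_D(2)[OF M]
  interpret prob_space M by (rule P2_D[OF M])
  have div5: "(5 * j + r) div 5 = j" "(5 * j + r) mod 5 = r" if "r < 5" for j r :: nat using that by auto
  have cz: "(\<integral>w. constraint (if r = 0 then \<lambda>x. \<beta> j x - (\<integral>x. \<beta> j x \<partial>\<mu>) else (\<lambda>_. 0))
      (if r = 1 then \<lambda>x. \<beta> j x - (\<integral>x. \<beta> j x \<partial>\<nu>) else (\<lambda>_. 0)) (if r = 2 then T j else (\<lambda>_. 0))
      (if r = 3 then T j else (\<lambda>_. 0)) (if r = 4 then \<xi> j else (\<lambda>_. 0)) w \<partial>M) = 0" if "r < 5" for j r :: nat
    using z[of "5 * j + r"] unfolding \<phi>_def \<psi>_def \<Phi>_def \<Psi>_def \<kappa>_def div5[OF that] .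
  note sq = P2_triple_integrable[OF M]
  have P2': "marg1 M \<in> P2" "marg2 M \<in> P2" unfolding marg_eq_distr
    by (intro distr_in_P2 sq prob_space_axioms; measurable)+
  have \<beta>w: "integrable M (\<lambda>w. \<beta> k (fst w))" "integrable M (\<lambda>w. \<beta> k (fst (snd w)))" for k
    by (rule integrable_const_bound[where B=1], use \<beta>1 in auto)+
  have "(\<integral>w. \<beta> k (fst w) \<partial>M) = (\<integral>x. \<beta> k x \<partial>\<mu>)" for k
    using cz[of 0 k] \<beta>w[of k] by (simp add: constraint_def prob_space)
  then have m1: "(\<integral>x. \<beta> k x \<partial>marg1 M) = (\<integral>x. \<beta> k x \<partial>\<mu>)" for k by (simp add: marg_eq_distr integral_distr)
  have "(\<integral>w. \<beta> k (fst (snd w)) \<partial>M) = (\<integral>x. \<beta> k x \<partial>\<nu>)" for k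
    using cz[of 1 k] \<beta>w[of k] by (simp add: constraint_def prob_space)
  then have m2': "(\<integral>x. \<beta> k x \<partial>marg2 M) = (\<integral>x. \<beta> k x \<partial>\<nu>)" for k by (simp add: marg_eq_distr integral_distr)
  have ex\<beta>: "\<exists>k. \<phi> = \<beta> k" if "\<phi> \<in> bumps" for \<phi> unfolding \<beta>_def
    using from_nat_into_surj[OF countable_bumps that] by metis
  have exb: "\<exists>k. v = b k" if "v \<in> Basis" for v unfolding b_def
    using from_nat_into_surj[OF countable_finite[OF finite_Basis] that] by metis
  have marg: "marg1 M = \<mu>" "marg2 M = \<nu>"
  proof -
    have *: "N = N'" if "N \<in> P2" "N' \<in> P2" "\<And>k. (\<integral>x. \<beta> k x \<partial>N) = (\<integral>x. \<beta> k x \<partial>N')" for N N' :: "'a measure"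
    proof (rule finite_measure_eqI_bumps)
      show "(\<integral>x. \<theta> x \<partial>N) = (\<integral>x. \<theta> x \<partial>N')" if "\<theta> \<in> bumps" for \<theta>
        using ex\<beta>[OF that] \<open>\<And>k. (\<integral>x. \<beta> k x \<partial>N) = (\<integral>x. \<beta> k x \<partial>N')\<close> by auto
    qed (use P2_D[OF that(1)] P2_D[OF that(2)] prob_space.finite_measure in auto)
    show "marg1 M = \<mu>" by (rule *[OF P2'(1) P2(1) m1])
    show "marg2 M = \<nu>" by (rule *[OF P2'(2) P2(2) m2'])
  qed
  have mart1: "martingale_pair M fst (\<lambda>w. snd (snd w))" unfolding martingale_pair_def
  proof (intro conjI ballI sq prob_space_axioms)
    fix \<theta> :: "'a \<Rightarrow> real" and v :: 'a assume "\<theta> \<in> bumps" "v \<in> Basis"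
    then obtain k l where "\<theta> = \<beta> k" "v = b l" using ex\<beta> exb by metis
    then show "(\<integral>w. ((snd (snd w) - fst w) \<bullet> v) * \<theta> (fst w) \<partial>M) = 0"
      using cz[of 2 "prod_encode (k, l)"] by (simp add: constraint_def T_def mult.commute)
  qed measurable
  have mart2: "martingale_pair M (\<lambda>w. fst (snd w)) (\<lambda>w. snd (snd w))" unfolding martingale_pair_def
  proof (intro conjI ballI sq prob_space_axioms)
    fix \<theta> :: "'a \<Rightarrow> real" and v :: 'a assume "\<theta> \<in> bumps" "v \<in> Basis"
    then obtain k l where "\<theta> = \<beta> k" "v = b l" using ex\<beta> exb by metis
    then show "(\<integral>w. ((snd (snd w) - fst (snd w)) \<bullet> v) * \<theta> (fst (snd w)) \<partial>M) = 0"
      using cz[of 3 "prod_encode (k, l)"] by (simp add: constraint_def T_def mult.commute)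
  qed measurable
  have "(\<integral>w. (norm w)\<^sup>2 \<partial>M) = (\<integral>w. (norm (fst w))\<^sup>2 \<partial>M) + (\<integral>w. (norm (fst (snd w)))\<^sup>2 \<partial>M) + (\<integral>w. (norm (snd (snd w)))\<^sup>2 \<partial>M)"
    unfolding norm_triple using sq by simp
  moreover have "(\<integral>w. (norm (fst w))\<^sup>2 \<partial>M) = (\<integral>x. (norm x)\<^sup>2 \<partial>\<mu>)" "(\<integral>w. (norm (fst (snd w)))\<^sup>2 \<partial>M) = (\<integral>x. (norm x)\<^sup>2 \<partial>\<nu>)"
    unfolding marg[symmetric] marg_eq_distr by (simp_all add: integral_distr)
  ultimately have n1: "(\<integral>w. (norm (snd (snd w)))\<^sup>2 \<partial>M) \<le> D" using m2 by linarith
  have n2: "(\<integral>w. \<xi> k (snd (snd w)) \<partial>M) = 0" for k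
    using cz[of 4 k] by (simp add: constraint_def)
  have "marg1 M = \<mu> \<and> marg2 M = \<nu> \<and> martingale_pair M fst (\<lambda>w. snd (snd w)) \<and>
    martingale_pair M (\<lambda>w. fst (snd w)) (\<lambda>w. snd (snd w)) \<and> (\<integral>w. (norm (snd (snd w)))\<^sup>2 \<partial>M) \<le> D \<and>
    (\<forall>k. (\<integral>w. \<xi> k (snd (snd w)) \<partial>M) = 0)"
    by (intro conjI marg mart1 mart2 n1 allI n2)
  with M show ?thesis by (rule bexI[rotated])
qed

section \<open>The main theorem\<close>

lemma var_eq:
  fixes M :: "'a::euclidean_space measure"
  assumes "M \<in> P2"
  shows "var M = (\<integral>x. (norm x)\<^sup>2 \<partial>M) - (norm (bary M))\<^sup>2"
proof -
  note P = P2_D[OF assms] and [measurable_cong] = P2_D(2)[OF assms]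
  interpret prob_space M by (rule P)
  have i: "integrable M (\<lambda>x. x)" by (rule integrable_of_norm_square) (use P in auto)
  have "(norm (x - bary M))\<^sup>2 = (norm x)\<^sup>2 - 2 * (x \<bullet> bary M) + (norm (bary M))\<^sup>2" for x
    by (simp add: power2_norm_eq_inner algebra_simps inner_commute)
  then have "var M = (\<integral>x. (norm x)\<^sup>2 \<partial>M) - 2 * (bary M \<bullet> bary M) + (norm (bary M))\<^sup>2"
    using P(4) i by (simp add: var_def prob_space) (simp add: bary_def)
  then show ?thesis by (simp add: power2_norm_eq_inner)
qed

lemma convex_dom_integral_le:
  assumes "convex_dom \<rho> \<mu>" "convex_on UNIV f" "integrable \<mu> f" "integrable \<rho> f"
  shows "(\<integral>x. f x \<partial>\<mu>) \<le> (\<integral>x. f x \<partial>\<rho>)"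
  using assms(1,2) unfolding convex_dom_def by (auto simp: eint_eq_integral[OF assms(3)] eint_eq_integral[OF assms(4)])

text \<open>The convex order is tested on the one linear function given by the difference
  \<open>v\<close> of the barycentres, which yields |v|^2 <= 0.\<close>

lemma convex_dom_bary:
  fixes \<mu> \<rho> :: "'a::euclidean_space measure"
  assumes d: "convex_dom \<rho> \<mu>" and P2: "\<rho> \<in> P2" "\<mu> \<in> P2"
  shows "bary \<rho> = bary \<mu>"
proof -
  have i: "integrable M (\<lambda>x. x)" if "M \<in> P2" for M :: "'a measure"
  proof -
    note P = P2_D[OF that] and [measurable_cong] = P2_D(2)[OF that]
    interpret prob_space M by (rule P)
    show ?thesis by (rule integrable_of_norm_square) (use P in auto)
  qed
  define v where "v = bary \<mu> - bary \<rho>"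
  have "convex_on UNIV (\<lambda>x. v \<bullet> x)" using convex_on_UNIV_affine[of 0 v 0] by simp
  from convex_dom_integral_le[OF d this] have "v \<bullet> bary \<mu> \<le> v \<bullet> bary \<rho>"
    using i[OF P2(1)] i[OF P2(2)] by (simp add: bary_def)
  then have "v \<bullet> v \<le> 0" by (simp add: v_def inner_diff_right)
  then have "v = 0" using inner_gt_zero_iff[of v] by linarith
  then show ?thesis by (simp add: v_def)
qed

lemma C11_1_convex:
  assumes "C11_1 u"
  shows "convex_on UNIV (\<lambda>x. (norm x)\<^sup>2 / 2 + u x)" "convex_on UNIV (\<lambda>x. (norm x)\<^sup>2 / 2 - u x)"
  using C11_1_imp_convex[OF assms] C11_1_imp_convex[OF C11_1_uminus[OF assms]] by simp_all

text \<open>The two convex functions attached to \<open>u\<close> add up to |x|^2, so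
  \<open>convex_sum_quadratic\<close> bounds both of them.\<close>

lemma C11_1_integrable:
  assumes u: "C11_1 u" and M: "M \<in> P2"
  shows "integrable M u" "integrable M (\<lambda>x. (norm x)\<^sup>2 / 2 + u x)" "integrable M (\<lambda>x. (norm x)\<^sup>2 / 2 - u x)"
proof -
  note c = C11_1_convex[OF u]
  have le: "(norm z)\<^sup>2 / 2 + u z + ((norm z)\<^sup>2 / 2 - u z) \<le> 1 * (1 + (norm z)\<^sup>2)" for z by simp
  obtain C where C: "\<And>z. \<bar>(norm z)\<^sup>2 / 2 + u z\<bar> \<le> C * (1 + (norm z)\<^sup>2)" "\<And>z. \<bar>(norm z)\<^sup>2 / 2 - u z\<bar> \<le> C * (1 + (norm z)\<^sup>2)"
    using convex_sum_quadratic[OF c le] by blast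
  show 1: "integrable M (\<lambda>x. (norm x)\<^sup>2 / 2 + u x)"
    by (rule P2_integrable_quadratic[OF M convex_on_UNIV_measurable[OF c(1)], where C=C]) (use C in simp)
  show "integrable M (\<lambda>x. (norm x)\<^sup>2 / 2 - u x)"
    by (rule P2_integrable_quadratic[OF M convex_on_UNIV_measurable[OF c(2)], where C=C]) (use C in simp)
  show "integrable M u" using Bochner_Integration.integrable_diff[OF 1 integrable_divide[OF P2_D(4)[OF M], of 2]] by simp
qed

text \<open>\<open>\<mu>\<close> is compared with \<open>\<rho>\<close> through |x|^2/2 - u, and
  \<open>\<nu>\<close> through |x|^2/2 + u; in the sum, \<open>u\<close> cancels on the side of
  \<open>\<rho>\<close>.\<close>

lemma C11_1_weak_duality:
  assumes u: "C11_1 u" and P2: "\<mu> \<in> P2" "\<nu> \<in> P2" "\<rho> \<in> P2" and d: "convex_dom \<rho> \<mu>" "convex_dom \<rho> \<nu>"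
  shows "(\<integral>x. u x \<partial>\<nu>) - (\<integral>x. u x \<partial>\<mu>) \<le> (\<integral>x. (norm x)\<^sup>2 \<partial>\<rho>) - ((\<integral>x. (norm x)\<^sup>2 \<partial>\<mu>) + (\<integral>x. (norm x)\<^sup>2 \<partial>\<nu>)) / 2"
proof -
  note i = C11_1_integrable[OF u] and c = C11_1_convex[OF u]
  have e: "(\<integral>x. (norm x)\<^sup>2 / 2 + u x \<partial>M) = (\<integral>x. (norm x)\<^sup>2 \<partial>M) / 2 + (\<integral>x. u x \<partial>M)"
    "(\<integral>x. (norm x)\<^sup>2 / 2 - u x \<partial>M) = (\<integral>x. (norm x)\<^sup>2 \<partial>M) / 2 - (\<integral>x. u x \<partial>M)" if "M \<in> P2" for M
    using i(1)[OF that] P2_D(4)[OF that] by simp_all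
  show ?thesis
    using convex_dom_integral_le[OF d(1) c(2) i(3)[OF P2(1)] i(3)[OF P2(3)]]
      convex_dom_integral_le[OF d(2) c(1) i(2)[OF P2(2)] i(2)[OF P2(3)]]
    unfolding e[OF P2(1)] e[OF P2(2)] e[OF P2(3)] by (simp add: field_simps)
qed

text \<open>This keeps the supremum \<open>Ifun\<close> finite. The first-order expansion of
  \<open>u\<close> at 0 has an error of at most |x|^2/2, and its affine part has the same integral
  under both measures because the barycentres agree.\<close>

lemma C11_1_difference_bound:
  fixes \<mu> \<nu> :: "'a::euclidean_space measure"
  assumes u: "C11_1 u" and P2: "\<mu> \<in> P2" "\<nu> \<in> P2" and b: "bary \<mu> = bary \<nu>"
  shows "(\<integral>x. u x \<partial>\<nu>) - (\<integral>x. u x \<partial>\<mu>) \<le> ((\<integral>x. (norm x)\<^sup>2 \<partial>\<mu>) + (\<integral>x. (norm x)\<^sup>2 \<partial>\<nu>)) / 2"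
proof -
  obtain g where g: "\<And>y. \<bar>u y - u 0 - g \<bullet> (y - 0)\<bar> \<le> (norm (y - 0))\<^sup>2 / 2"
    using two_sided_quadratic_bound[OF C11_1_convex[OF u], of 0] by blast
  have *: "\<bar>(\<integral>x. u x \<partial>M) - u 0 - g \<bullet> bary M\<bar> \<le> (\<integral>x. (norm x)\<^sup>2 \<partial>M) / 2" if M: "M \<in> P2" for M
  proof -
    note P = P2_D[OF M] and [measurable_cong] = P2_D(2)[OF M]
    interpret prob_space M by (rule P)
    have i: "integrable M (\<lambda>x. x)" by (rule integrable_of_norm_square) (use P in auto)
    have iu: "integrable M u" by (rule C11_1_integrable[OF u M])
    have "(\<integral>x. u x \<partial>M) - u 0 - g \<bullet> bary M = (\<integral>x. u x - u 0 - g \<bullet> x \<partial>M)"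
      using i iu by (simp add: bary_def prob_space)
    also have "\<bar>\<dots>\<bar> \<le> (\<integral>x. \<bar>u x - u 0 - g \<bullet> x\<bar> \<partial>M)" by (rule integral_abs_bound)
    also have "\<dots> \<le> (\<integral>x. (norm x)\<^sup>2 / 2 \<partial>M)" using i iu P(4) g by (intro integral_mono) auto
    finally show ?thesis by simp
  qed
  show ?thesis using *[OF P2(1)] *[OF P2(2)] unfolding b by argo
qed

section \<open>Admissible plans as pairs of martingales\<close>

lemma test_field_bounded:
  assumes "test_field \<Phi>"
  shows "continuous_on UNIV \<Phi>" "\<exists>C. \<forall>x. norm (\<Phi> x) \<le> C"
proof -
  have "\<forall>x. \<Phi> differentiable (at x)" using assms iter_derivs.base[of \<Phi>] by (auto simp: test_field_def smooth_def)
  then show c: "continuous_on UNIV \<Phi>"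
    by (auto intro!: continuous_at_imp_continuous_on differentiable_imp_continuous_within)
  have "compact (closure {x. \<Phi> x \<noteq> 0})" using assms by (simp add: test_field_def compact_support_def)
  then have "bounded (\<Phi> ` closure {x. \<Phi> x \<noteq> 0})"
    by (intro compact_imp_bounded compact_continuous_image continuous_on_subset[OF c]) auto
  then obtain C where C: "\<And>x. x \<in> closure {x. \<Phi> x \<noteq> 0} \<Longrightarrow> norm (\<Phi> x) \<le> C" by (auto simp: bounded_iff)
  have "norm (\<Phi> x) \<le> max C 0" for x
  proof (cases "\<Phi> x = 0")
    case False
    then have "x \<in> closure {x. \<Phi> x \<noteq> 0}" by (intro subsetD[OF closure_subset]) simp
    then show ?thesis using C by (simp add: le_max_iff_disj)
  qed simp
  then show "\<exists>C. \<forall>x. norm (\<Phi> x) \<le> C" by (intro exI[of _ "max C 0"] allI)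
qed

lemma Sigma_set_martingale_pair:
  fixes \<mu> \<nu> :: "'a::euclidean_space measure"
  assumes "\<pi> \<in> Sigma_set \<mu> \<nu>"
  shows "martingale_pair \<pi> fst (\<lambda>w. snd (snd w))" "martingale_pair \<pi> (\<lambda>w. fst (snd w)) (\<lambda>w. snd (snd w))"
proof -
  have P2: "\<pi> \<in> P2" and t: "\<And>\<Phi>. test_field \<Phi> \<Longrightarrow> (\<integral>(x,y,z). (z - x) \<bullet> \<Phi> x \<partial>\<pi>) = 0"
     "\<And>\<Psi>. test_field \<Psi> \<Longrightarrow> (\<integral>(x,y,z). (z - y) \<bullet> \<Psi> y \<partial>\<pi>) = 0"
    using assms by (auto simp: Sigma_set_def)
  note [measurable_cong] = P2_D(2)[OF P2]
  have tf: "test_field (\<lambda>x. \<theta> x *\<^sub>R v)" if "\<theta> \<in> bumps" for \<theta> and v :: 'a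
    using that by (auto simp: bumps_def intro: test_field_bump)
  show "martingale_pair \<pi> fst (\<lambda>w. snd (snd w))" unfolding martingale_pair_def
  proof (intro conjI ballI P2_triple_integrable P2 P2_D(1)[OF P2])
    show "(\<integral>w. ((snd (snd w) - fst w) \<bullet> v) * \<theta> (fst w) \<partial>\<pi>) = 0" if "\<theta> \<in> bumps" for \<theta> v
      using t(1)[OF tf[OF that], of v] by (simp add: case_prod_beta' mult.commute)
  qed measurable
  show "martingale_pair \<pi> (\<lambda>w. fst (snd w)) (\<lambda>w. snd (snd w))" unfolding martingale_pair_def
  proof (intro conjI ballI P2_triple_integrable P2 P2_D(1)[OF P2])
    show "(\<integral>w. ((snd (snd w) - fst (snd w)) \<bullet> v) * \<theta> (fst (snd w)) \<partial>\<pi>) = 0" if "\<theta> \<in> bumps" for \<theta> v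
      using t(2)[OF tf[OF that], of v] by (simp add: case_prod_beta' mult.commute)
  qed measurable
qed

text \<open>Smooth compactly supported fields are bounded and Borel, so the extension of the
  martingale conditions beyond bumps covers them.\<close>

lemma Sigma_setI:
  assumes "\<pi> \<in> P2" "marg1 \<pi> = \<mu>" "marg2 \<pi> = \<nu>"
    and m: "martingale_pair \<pi> fst (\<lambda>w. snd (snd w))" "martingale_pair \<pi> (\<lambda>w. fst (snd w)) (\<lambda>w. snd (snd w))"
  shows "\<pi> \<in> Sigma_set \<mu> \<nu>"
proof -
  have "(\<integral>(x,y,z). (z - x) \<bullet> \<Phi> x \<partial>\<pi>) = 0" "(\<integral>(x,y,z). (z - y) \<bullet> \<Phi> y \<partial>\<pi>) = 0" if t: "test_field \<Phi>" for \<Phi>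
  proof -
    obtain C where C: "\<And>x. norm (\<Phi> x) \<le> C" using test_field_bounded(2)[OF t] by blast
    have "\<Phi> \<in> borel_measurable borel" by (rule borel_measurable_continuous_onI[OF test_field_bounded(1)[OF t]])
    from martingale_pair_test_field(2)[OF m(1) this C] martingale_pair_test_field(2)[OF m(2) this C]
    show "(\<integral>(x,y,z). (z - x) \<bullet> \<Phi> x \<partial>\<pi>) = 0" "(\<integral>(x,y,z). (z - y) \<bullet> \<Phi> y \<partial>\<pi>) = 0"
      by (simp_all add: case_prod_beta')
  qed
  then show ?thesis using assms(1-3) by (auto simp: Sigma_set_def)
qed

lemma integral_marg:
  fixes f :: "'a::euclidean_space \<Rightarrow> real"
  assumes M: "M \<in> P2" and f: "f \<in> borel_measurable borel"
  shows "(\<integral>x. f x \<partial>marg1 M) = (\<integral>w. f (fst w) \<partial>M)" "(\<integral>x. f x \<partial>marg2 M) = (\<integral>w. f (fst (snd w)) \<partial>M)"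
    "(\<integral>x. f x \<partial>marg3 M) = (\<integral>w. f (snd (snd w)) \<partial>M)"
proof -
  note [measurable_cong] = P2_D(2)[OF M] and [measurable] = f
  show "(\<integral>x. f x \<partial>marg1 M) = (\<integral>w. f (fst w) \<partial>M)" "(\<integral>x. f x \<partial>marg2 M) = (\<integral>w. f (fst (snd w)) \<partial>M)"
    "(\<integral>x. f x \<partial>marg3 M) = (\<integral>w. f (snd (snd w)) \<partial>M)"
    unfolding marg_eq_distr by (rule integral_distr; measurable)+
qed

text \<open>Pythagoras for both martingale pairs turns the cost into the second moment of the third
  marginal minus a constant fixed by \<open>\<mu>\<close> and \<open>\<nu>\<close>. Minimizing the
  cost thus becomes a problem about the third marginal alone.\<close>

lemma Sigma_set_marg3:
  fixes \<mu> \<nu> :: "'a::euclidean_space measure"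
  assumes S: "\<pi> \<in> Sigma_set \<mu> \<nu>"
  shows "marg3 \<pi> \<in> P2" "convex_dom (marg3 \<pi>) \<mu>" "convex_dom (marg3 \<pi>) \<nu>"
    "(\<integral>p. cost p \<partial>\<pi>) = (\<integral>x. (norm x)\<^sup>2 \<partial>marg3 \<pi>) - ((\<integral>x. (norm x)\<^sup>2 \<partial>\<mu>) + (\<integral>x. (norm x)\<^sup>2 \<partial>\<nu>)) / 2"
proof -
  have P2: "\<pi> \<in> P2" and marg: "marg1 \<pi> = \<mu>" "marg2 \<pi> = \<nu>" using S by (auto simp: Sigma_set_def)
  note m = Sigma_set_martingale_pair[OF S]
  show "marg3 \<pi> \<in> P2" unfolding marg_eq_distr by (intro distr_in_P2 martingale_pair_D[OF m(1)])
  show "convex_dom (marg3 \<pi>) \<mu>" using martingale_pair_convex_dom[OF m(1)] by (simp add: marg[symmetric] marg_eq_distr)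
  show "convex_dom (marg3 \<pi>) \<nu>" using martingale_pair_convex_dom[OF m(2)] by (simp add: marg[symmetric] marg_eq_distr)
  have sq: "(\<lambda>x::'a. (norm x)\<^sup>2) \<in> borel_measurable borel" by measurable
  show "(\<integral>p. cost p \<partial>\<pi>) = (\<integral>x. (norm x)\<^sup>2 \<partial>marg3 \<pi>) - ((\<integral>x. (norm x)\<^sup>2 \<partial>\<mu>) + (\<integral>x. (norm x)\<^sup>2 \<partial>\<nu>)) / 2"
    using martingale_pair_second_moment[OF m(1)] martingale_pair_second_moment[OF m(2)]
    unfolding marg[symmetric] integral_marg[OF P2 sq] by (simp add: cost_def case_prod_beta' field_simps)
qed

text \<open>Strassen's theorem for the pair \<open>(\<mu>, \<nu>)\<close>: both martingale couplings with \<open>\<rho>\<close> are obtained simultaneously.\<close>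
lemma Sigma_set_of_convex_dom:
  fixes \<mu> \<nu> \<rho> :: "'a::euclidean_space measure"
  assumes P2: "\<mu> \<in> P2" "\<nu> \<in> P2" "\<rho> \<in> P2" and d: "convex_dom \<rho> \<mu>" "convex_dom \<rho> \<nu>"
  shows "\<exists>\<pi>\<in>Sigma_set \<mu> \<nu>. marg3 \<pi> = \<rho>"
proof -
  note [measurable_cong] = P2_D(2)[OF P2(3)]
  interpret R: prob_space \<rho> by (rule P2_D[OF P2(3)])
  define \<beta> :: "nat \<Rightarrow> 'a \<Rightarrow> real" where "\<beta> = from_nat_into bumps"
  have \<beta>in: "\<beta> k \<in> bumps" for k unfolding \<beta>_def by (rule from_nat_into[OF bumps_nonempty])
  have \<beta>c: "continuous_on UNIV (\<beta> k)" and \<beta>1: "\<bar>\<beta> k x\<bar> \<le> 1" for k x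
    using \<beta>in[of k] by (auto simp: bumps_def continuous_on_bump abs_bump_le_1)
  have \<beta>m[measurable]: "\<beta> k \<in> borel_measurable borel" for k by (rule borel_measurable_continuous_onI[OF \<beta>c])
  have \<beta>i: "integrable \<rho> (\<beta> k)" for k by (rule R.integrable_const_bound[where B=1]) (use \<beta>1 in auto)
  define \<xi> where "\<xi> k x = \<beta> k x - (\<integral>x. \<beta> k x \<partial>\<rho>)" for k x
  have \<xi>m: "\<xi> k \<in> borel_measurable borel" for k unfolding \<xi>_def[abs_def] by measurable
  have \<xi>0: "(\<integral>x. \<xi> k x \<partial>\<rho>) = 0" and \<xi>i: "integrable \<rho> (\<xi> k)" for k
    using \<beta>i[of k] by (simp_all add: \<xi>_def[abs_def] R.prob_space)
  have "\<exists>M\<in>P2. marg1 M = \<mu> \<and> marg2 M = \<nu> \<and> martingale_pair M fst (\<lambda>w. snd (snd w)) \<and>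
    martingale_pair M (\<lambda>w. fst (snd w)) (\<lambda>w. snd (snd w)) \<and> (\<integral>w. (norm (snd (snd w)))\<^sup>2 \<partial>M) \<le> (\<integral>x. (norm x)\<^sup>2 \<partial>\<rho>) \<and>
    (\<forall>k :: nat. (\<integral>w. \<xi> k (snd (snd w)) \<partial>M) = 0)"
  proof (rule martingale_coupling_exists[OF P2(1,2)])
    show "continuous_on UNIV (\<xi> k)" for k unfolding \<xi>_def[abs_def] by (intro continuous_intros \<beta>c)
    show "\<bar>\<xi> k x\<bar> \<le> 1 + \<bar>\<integral>x. \<beta> k x \<partial>\<rho>\<bar>" for k x using \<beta>1[of k x] unfolding \<xi>_def by linarith
    fix n :: nat and a A B m \<kappa>
    assume \<kappa>: "\<And>i :: nat. \<kappa> i \<in> insert (\<lambda>_. 0) (range \<xi>)" and A: "convex_on UNIV A" and B: "convex_on UNIV B"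
      and AB: "\<And>z. A z + B z \<le> (norm z)\<^sup>2 + (\<Sum>i<n. a i * \<kappa> i z) - m"
    have \<kappa>i: "integrable \<rho> (\<kappa> i)" and \<kappa>0: "(\<integral>x. \<kappa> i x \<partial>\<rho>) = 0" for i using \<kappa>[of i] \<xi>i \<xi>0 by auto
    have "\<exists>c. \<forall>z. \<bar>\<kappa> i z\<bar> \<le> c" for i
    proof -
      consider "\<kappa> i = (\<lambda>_. 0)" | k where "\<kappa> i = \<xi> k" using \<kappa>[of i] by auto
      then show ?thesis
      proof cases
        case 2
        have "\<bar>\<xi> k z\<bar> \<le> 1 + \<bar>\<integral>x. \<beta> k x \<partial>\<rho>\<bar>" for z using \<beta>1[of k z] unfolding \<xi>_def by linarith
        then show ?thesis using 2 by auto
      qed auto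
    qed
    then obtain c where c: "\<And>i z. \<bar>\<kappa> i z\<bar> \<le> c i" by metis
    define L where "L = 1 + (\<Sum>i<n. \<bar>a i\<bar> * c i) + \<bar>m\<bar>"
    have bk: "\<bar>\<Sum>i<n. a i * \<kappa> i z\<bar> \<le> (\<Sum>i<n. \<bar>a i\<bar> * c i)" for z
      by (rule order_trans[OF sum_abs]) (auto intro!: sum_mono mult_left_mono c simp: abs_mult)
    have L: "L \<ge> 1" using bk[of 0] by (simp add: L_def)
    have ABL: "A z + B z \<le> L * (1 + (norm z)\<^sup>2)" for z
    proof -
      have "(norm z)\<^sup>2 \<le> L * (norm z)\<^sup>2" using L mult_right_mono[of 1 L "(norm z)\<^sup>2"] by simp
      then show ?thesis using AB[of z] bk[of z] by (simp add: distrib_left L_def)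
    qed
    obtain C where C: "\<And>z. \<bar>A z\<bar> \<le> C * (1 + (norm z)\<^sup>2)" "\<And>z. \<bar>B z\<bar> \<le> C * (1 + (norm z)\<^sup>2)"
      using convex_sum_quadratic[OF A B ABL] by blast
    have iA: "integrable N A" and iB: "integrable N B" if "N \<in> P2" for N
      using C by (auto intro!: P2_integrable_quadratic[OF that, where C=C] convex_on_UNIV_measurable A B)
    \<comment> \<open>Here the convex order enters. Under \<open>\<rho>\<close> the terms
      \<open>\<kappa> i\<close> integrate to zero, so the dual value is at most the second moment of
      \<open>\<rho>\<close>.\<close>
    have "(\<integral>x. A x \<partial>\<mu>) + (\<integral>x. B x \<partial>\<nu>) \<le> (\<integral>x. A x \<partial>\<rho>) + (\<integral>x. B x \<partial>\<rho>)"
      by (intro add_mono convex_dom_integral_le d A B iA iB P2)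
    also have "\<dots> = (\<integral>x. A x + B x \<partial>\<rho>)" using iA[OF P2(3)] iB[OF P2(3)] by simp
    also have "\<dots> \<le> (\<integral>x. (norm x)\<^sup>2 + (\<Sum>i<n. a i * \<kappa> i x) - m \<partial>\<rho>)"
      using iA[OF P2(3)] iB[OF P2(3)] \<kappa>i P2_D(4)[OF P2(3)] AB by (intro integral_mono) auto
    also have "\<dots> = (\<integral>x. (norm x)\<^sup>2 \<partial>\<rho>) - m"
      using \<kappa>i P2_D(4)[OF P2(3)] by (simp add: Bochner_Integration.integral_sum \<kappa>0 R.prob_space)
    finally show "(\<integral>x. A x \<partial>\<mu>) + (\<integral>x. B x \<partial>\<nu>) + m \<le> (\<integral>x. (norm x)\<^sup>2 \<partial>\<rho>)" by simp
  qed
  then obtain M where M: "M \<in> P2" "marg1 M = \<mu>" "marg2 M = \<nu>" "martingale_pair M fst (\<lambda>w. snd (snd w))"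
    "martingale_pair M (\<lambda>w. fst (snd w)) (\<lambda>w. snd (snd w))" and z: "\<And>k. (\<integral>w. \<xi> k (snd (snd w)) \<partial>M) = 0" by blast
  have S: "M \<in> Sigma_set \<mu> \<nu>" by (rule Sigma_setI[OF M])
  have P3: "marg3 M \<in> P2" by (rule Sigma_set_marg3[OF S])
  interpret M3: prob_space "marg3 M" by (rule P2_D[OF P3])
  have "marg3 M = \<rho>"
  proof (rule finite_measure_eqI_bumps)
    show "finite_measure (marg3 M)" "finite_measure \<rho>" by unfold_locales
    show "sets (marg3 M) = sets borel" "sets \<rho> = sets borel" by (rule P2_D[OF P3], rule P2_D[OF P2(3)])
    fix \<theta> :: "'a \<Rightarrow> real" assume "\<theta> \<in> bumps"
    then obtain k where k: "\<theta> = \<beta> k" unfolding \<beta>_def using from_nat_into_surj[OF countable_bumps] by metis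
    have [measurable_cong]: "sets (marg3 M) = sets borel" by (rule P2_D[OF P3])
    have "integrable (marg3 M) (\<beta> k)" by (rule M3.integrable_const_bound[where B=1]) (use \<beta>1 in auto)
    moreover have "(\<integral>x. \<xi> k x \<partial>marg3 M) = 0"
      using integral_marg(3)[OF M(1) \<xi>m] z by simp
    ultimately show "(\<integral>x. \<theta> x \<partial>marg3 M) = (\<integral>x. \<theta> x \<partial>\<rho>)" by (simp add: k \<xi>_def M3.prob_space)
  qed
  then show ?thesis using S by blast
qed

text \<open>Strong duality: with the third marginal free, the dual problem consists of convex pairs
  with A + B <= |z|^2 - m, and the function \<open>u\<close> supplied by
  \<open>C11_1_between\<close> bounds their integrals through \<open>I\<close>.\<close>

lemma optimal_coupling_exists:
  fixes \<mu> \<nu> :: "'a::euclidean_space measure"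
  assumes P2: "\<mu> \<in> P2" "\<nu> \<in> P2" and I: "\<And>u. C11_1 u \<Longrightarrow> (\<integral>x. u x \<partial>\<nu>) - (\<integral>x. u x \<partial>\<mu>) \<le> I"
  shows "\<exists>\<pi>\<in>Sigma_set \<mu> \<nu>. (\<integral>x. (norm x)\<^sup>2 \<partial>marg3 \<pi>) \<le> ((\<integral>x. (norm x)\<^sup>2 \<partial>\<mu>) + (\<integral>x. (norm x)\<^sup>2 \<partial>\<nu>)) / 2 + I"
proof -
  have "\<exists>M\<in>P2. marg1 M = \<mu> \<and> marg2 M = \<nu> \<and> martingale_pair M fst (\<lambda>w. snd (snd w)) \<and>
    martingale_pair M (\<lambda>w. fst (snd w)) (\<lambda>w. snd (snd w)) \<and>
    (\<integral>w. (norm (snd (snd w)))\<^sup>2 \<partial>M) \<le> ((\<integral>x. (norm x)\<^sup>2 \<partial>\<mu>) + (\<integral>x. (norm x)\<^sup>2 \<partial>\<nu>)) / 2 + I \<and>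
    (\<forall>k :: nat. (\<integral>w. 0 \<partial>M) = (0::real))"
  proof (rule martingale_coupling_exists[OF P2, where \<xi>="\<lambda>k x. 0" and K="\<lambda>_. 0"])
    fix n :: nat and a A B m and \<kappa> :: "nat \<Rightarrow> 'a \<Rightarrow> real"
    assume \<kappa>: "\<And>i. \<kappa> i \<in> insert (\<lambda>_. 0) (range (\<lambda>k x. 0))" and A: "convex_on UNIV A" and B: "convex_on UNIV B"
      and "\<And>z. A z + B z \<le> (norm z)\<^sup>2 + (\<Sum>i<n. a i * \<kappa> i z) - m"
    moreover have "\<kappa> i = (\<lambda>_. 0)" for i using \<kappa>[of i] by auto
    ultimately have AB: "A z + B z \<le> (norm z)\<^sup>2 - m" for z by simp
    obtain u where u: "C11_1 u" "\<And>z. B z \<le> (norm z)\<^sup>2 / 2 + u z" "\<And>z. A z \<le> (norm z)\<^sup>2 / 2 - u z - m"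
      using C11_1_between[OF A B AB] by blast
    have ABm: "A z + B z \<le> (1 + \<bar>m\<bar>) * (1 + (norm z)\<^sup>2)" for z
    proof -
      have "0 \<le> \<bar>m\<bar> * (norm z)\<^sup>2" by simp
      moreover have "(1 + \<bar>m\<bar>) * (1 + (norm z)\<^sup>2) = 1 + \<bar>m\<bar> + (norm z)\<^sup>2 + \<bar>m\<bar> * (norm z)\<^sup>2"
        by (simp add: algebra_simps)
      ultimately show ?thesis using AB[of z] by linarith
    qed
    obtain C where C: "\<And>z. \<bar>A z\<bar> \<le> C * (1 + (norm z)\<^sup>2)" "\<And>z. \<bar>B z\<bar> \<le> C * (1 + (norm z)\<^sup>2)"
      using convex_sum_quadratic[OF A B ABm] by blast
    have iA: "integrable \<mu> A" and iB: "integrable \<nu> B"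
      using C by (auto intro!: P2_integrable_quadratic[OF P2(1), where C=C] P2_integrable_quadratic[OF P2(2), where C=C]
         convex_on_UNIV_measurable A B)
    interpret m: prob_space \<mu> by (rule P2_D[OF P2(1)])
    note i = C11_1_integrable[OF u(1)]
    have "(\<integral>x. A x \<partial>\<mu>) \<le> (\<integral>x. (norm x)\<^sup>2 / 2 - u x - m \<partial>\<mu>)"
      using iA i(3)[OF P2(1)] u(3) by (intro integral_mono) auto
    also have "\<dots> = (\<integral>x. (norm x)\<^sup>2 \<partial>\<mu>) / 2 - (\<integral>x. u x \<partial>\<mu>) - m"
      using i(1)[OF P2(1)] P2_D(4)[OF P2(1)] by (simp add: m.prob_space)
    finally have 1: "(\<integral>x. A x \<partial>\<mu>) \<le> (\<integral>x. (norm x)\<^sup>2 \<partial>\<mu>) / 2 - (\<integral>x. u x \<partial>\<mu>) - m" .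
    have "(\<integral>x. B x \<partial>\<nu>) \<le> (\<integral>x. (norm x)\<^sup>2 / 2 + u x \<partial>\<nu>)"
      using iB i(2)[OF P2(2)] u(2) by (intro integral_mono) auto
    also have "\<dots> = (\<integral>x. (norm x)\<^sup>2 \<partial>\<nu>) / 2 + (\<integral>x. u x \<partial>\<nu>)"
      using i(1)[OF P2(2)] P2_D(4)[OF P2(2)] by simp
    finally show "(\<integral>x. A x \<partial>\<mu>) + (\<integral>x. B x \<partial>\<nu>) + m \<le> ((\<integral>x. (norm x)\<^sup>2 \<partial>\<mu>) + (\<integral>x. (norm x)\<^sup>2 \<partial>\<nu>)) / 2 + I"
      using 1 I[OF u(1)] by (simp add: field_simps)
  qed auto
  then obtain M where M: "M \<in> P2" "marg1 M = \<mu>" "marg2 M = \<nu>" "martingale_pair M fst (\<lambda>w. snd (snd w))"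
    "martingale_pair M (\<lambda>w. fst (snd w)) (\<lambda>w. snd (snd w))"
    and le: "(\<integral>w. (norm (snd (snd w)))\<^sup>2 \<partial>M) \<le> ((\<integral>x. (norm x)\<^sup>2 \<partial>\<mu>) + (\<integral>x. (norm x)\<^sup>2 \<partial>\<nu>)) / 2 + I" by blast
  have "M \<in> Sigma_set \<mu> \<nu>" by (rule Sigma_setI[OF M])
  moreover have "(\<integral>x. (norm x)\<^sup>2 \<partial>marg3 M) = (\<integral>w. (norm (snd (snd w)))\<^sup>2 \<partial>M)" by (rule integral_marg[OF M(1)]) measurable
  ultimately show ?thesis using le by (intro bexI[of _ M]) auto
qed

theorem theorem1p3:
  fixes \<mu> \<nu> :: "'a::euclidean_space measure"
  assumes "\<mu> \<in> P2" and "\<nu> \<in> P2" and "bary \<mu> = bary \<nu>"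
  shows "Ifun \<mu> \<nu> = Vfun \<mu> \<nu> - ereal ((var \<mu> + var \<nu>) / 2)
       \<and> Vfun \<mu> \<nu> - ereal ((var \<mu> + var \<nu>) / 2) = Jfun \<mu> \<nu>
       \<and> (\<forall>\<pi> \<in> Sigma_set \<mu> \<nu>. Jmin \<mu> \<nu> \<pi> \<longleftrightarrow> Vmin \<mu> \<nu> (marg3 \<pi>))
       \<and> (\<exists>\<rho>. Vmin \<mu> \<nu> \<rho>)
       \<and> (\<forall>\<rho>. Vmin \<mu> \<nu> \<rho> \<longrightarrow>
            (\<exists>\<pi>. Jmin \<mu> \<nu> \<pi> \<and> marg1 \<pi> = \<mu> \<and> marg2 \<pi> = \<nu> \<and> marg3 \<pi> = \<rho>))"
proof -
  note P2 = assms(1,2)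
  define m2 where "m2 M = (\<integral>x. (norm x)\<^sup>2 \<partial>M)" for M :: "'a measure"
  define h where "h = (m2 \<mu> + m2 \<nu>) / 2"
  \<comment> \<open>Every admissible \<open>\<rho>\<close> shares the barycentre of
    \<open>\<mu>\<close>, so its variance is its second moment minus the constant
    \<open>b\<close>.\<close>
  define b where "b = (norm (bary \<mu>))\<^sup>2"
  define adm where "adm \<rho> \<longleftrightarrow> \<rho> \<in> P2 \<and> convex_dom \<rho> \<mu> \<and> convex_dom \<rho> \<nu>" for \<rho>
  have var_adm: "var \<rho> = m2 \<rho> - b" if "adm \<rho>" for \<rho>
    using that convex_dom_bary[of \<rho> \<mu>] P2 by (simp add: adm_def var_eq m2_def b_def)
  have vmn: "(var \<mu> + var \<nu>) / 2 = h - b"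
    using assms by (simp add: var_eq m2_def b_def h_def)
  have Ile: "Ifun \<mu> \<nu> \<le> ereal h" unfolding Ifun_def h_def m2_def
    by (rule SUP_least) (use C11_1_difference_bound[OF _ P2 assms(3)] in auto)
  have Iup: "ereal ((\<integral>x. u x \<partial>\<nu>) - (\<integral>x. u x \<partial>\<mu>)) \<le> Ifun \<mu> \<nu>" if "C11_1 u" for u
    unfolding Ifun_def
    using SUP_upper[of u "{u. C11_1 u}" "\<lambda>u. ereal ((\<integral>x. u x \<partial>\<nu>) - (\<integral>x. u x \<partial>\<mu>))"] that by simp
  \<comment> \<open>The zero potential excludes the value \<open>- \<infinity>\<close>, so that
    \<open>Ifun\<close> is a real number.\<close>
  have "C11_1 (\<lambda>_::'a. 0)" unfolding C11_1_def
  proof (intro exI[of _ "\<lambda>_. 0"] conjI allI)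
    show "((\<lambda>_. 0) has_derivative (\<lambda>h. 0 \<bullet> h)) (at x)" for x :: 'a
      by (simp only: inner_zero_left has_derivative_const)
  qed simp
  from Iup[OF this] have "ereal 0 \<le> Ifun \<mu> \<nu>" by simp
  with Ile obtain I where I: "Ifun \<mu> \<nu> = ereal I" by (cases "Ifun \<mu> \<nu>") auto
  have uI: "(\<integral>x. u x \<partial>\<nu>) - (\<integral>x. u x \<partial>\<mu>) \<le> I" if "C11_1 u" for u
    using Iup[OF that] by (simp add: I)
  have lower: "h + I \<le> m2 \<rho>" if "adm \<rho>" for \<rho>
  proof -
    have "Ifun \<mu> \<nu> \<le> ereal (m2 \<rho> - h)" unfolding Ifun_def m2_def h_def
      by (rule SUP_least) (use C11_1_weak_duality[OF _ P2] that in \<open>auto simp: adm_def\<close>)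
    then show ?thesis by (simp add: I)
  qed
  have S: "adm (marg3 \<pi>)" "(\<integral>p. cost p \<partial>\<pi>) = m2 (marg3 \<pi>) - h" if "\<pi> \<in> Sigma_set \<mu> \<nu>" for \<pi>
    using Sigma_set_marg3[OF that] by (simp_all add: adm_def m2_def h_def)
  \<comment> \<open>This plan attains the weak duality bound, so it serves as the witness for the
    values of both \<open>Vfun\<close> and \<open>Jfun\<close>.\<close>
  obtain \<pi>0 where \<pi>0: "\<pi>0 \<in> Sigma_set \<mu> \<nu>" and "m2 (marg3 \<pi>0) \<le> h + I"
    using optimal_coupling_exists[OF P2 uI] by (auto simp: m2_def h_def)
  then have opt: "m2 (marg3 \<pi>0) = h + I" using lower[OF S(1)[OF \<pi>0]] by simp
  have V: "Vfun \<mu> \<nu> = ereal (h + I - b)"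
  proof (rule antisym)
    have "Vfun \<mu> \<nu> \<le> ereal (var (marg3 \<pi>0))" unfolding Vfun_def
      by (rule INF_lower) (use S(1)[OF \<pi>0] in \<open>simp add: adm_def\<close>)
    then show "Vfun \<mu> \<nu> \<le> ereal (h + I - b)" by (simp add: var_adm[OF S(1)[OF \<pi>0]] opt)
    show "ereal (h + I - b) \<le> Vfun \<mu> \<nu>" unfolding Vfun_def
    proof (rule INF_greatest)
      fix \<rho> assume "\<rho> \<in> {\<rho>. \<rho> \<in> P2 \<and> convex_dom \<rho> \<mu> \<and> convex_dom \<rho> \<nu>}"
      then have "adm \<rho>" by (simp add: adm_def)
      then show "ereal (h + I - b) \<le> ereal (var \<rho>)" using lower var_adm by simp
    qed
  qed
  have J: "Jfun \<mu> \<nu> = ereal I"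
  proof (rule antisym)
    have "Jfun \<mu> \<nu> \<le> ereal (\<integral>p. cost p \<partial>\<pi>0)" unfolding Jfun_def by (rule INF_lower[OF \<pi>0])
    then show "Jfun \<mu> \<nu> \<le> ereal I" by (simp add: S(2)[OF \<pi>0] opt)
    show "ereal I \<le> Jfun \<mu> \<nu>" unfolding Jfun_def
    proof (rule INF_greatest)
      fix \<pi> assume "\<pi> \<in> Sigma_set \<mu> \<nu>"
      then show "ereal I \<le> ereal (\<integral>p. cost p \<partial>\<pi>)" using lower[OF S(1)] S(2) by fastforce
    qed
  qed
  \<comment> \<open>Both kinds of minimality reduce to a second moment equal to
    \<open>h + I\<close>; for a plan it is that of its third marginal.\<close>
  have Vmin: "Vmin \<mu> \<nu> \<rho> \<longleftrightarrow> adm \<rho> \<and> m2 \<rho> = h + I" for \<rho>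
    using var_adm[of \<rho>] by (auto simp: Vmin_def V adm_def)
  have Jmin: "Jmin \<mu> \<nu> \<pi> \<longleftrightarrow> \<pi> \<in> Sigma_set \<mu> \<nu> \<and> m2 (marg3 \<pi>) = h + I" for \<pi>
    using S(2)[of \<pi>] by (auto simp: Jmin_def J)
  have "\<exists>\<pi>. Jmin \<mu> \<nu> \<pi> \<and> marg1 \<pi> = \<mu> \<and> marg2 \<pi> = \<nu> \<and> marg3 \<pi> = \<rho>" if v: "Vmin \<mu> \<nu> \<rho>" for \<rho>
  proof -
    obtain \<pi> where \<pi>: "\<pi> \<in> Sigma_set \<mu> \<nu>" "marg3 \<pi> = \<rho>"
      using Sigma_set_of_convex_dom[OF P2, of \<rho>] v by (auto simp: Vmin_def)
    then show ?thesis using v by (intro exI[of _ \<pi>]) (auto simp: Jmin Vmin Sigma_set_def)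
  qed
  moreover have "Vmin \<mu> \<nu> (marg3 \<pi>0)" using S(1)[OF \<pi>0] opt by (simp add: Vmin)
  moreover have "\<forall>\<pi>\<in>Sigma_set \<mu> \<nu>. Jmin \<mu> \<nu> \<pi> \<longleftrightarrow> Vmin \<mu> \<nu> (marg3 \<pi>)" using S(1) by (auto simp: Jmin Vmin)
  moreover have "Ifun \<mu> \<nu> = Vfun \<mu> \<nu> - ereal ((var \<mu> + var \<nu>) / 2)" by (simp add: I V vmn)
  moreover have "Vfun \<mu> \<nu> - ereal ((var \<mu> + var \<nu>) / 2) = Jfun \<mu> \<nu>" by (simp add: J V vmn)
  ultimately show ?thesis by blast
qed

end
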